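(* Assume (A1), (A2), (A3), (A4) and (A5). Then in the class of bounded and continuous functions on $[0,T]\times\mathbb{R}^n$ there exists at most one viscosity solution $u$ of $$\begin{cases}\min\Big(u_x^{\top}(t,x)G+K,\ \dfrac{\partial u}{\partial t}(t,x)+\min_{v\in U}\big\{\mathcal{L}(t,x,v)u(t,x)+f(t,x,u(t,x),\nabla u(t,x)\sigma(t,x,v),v)\big\}\Big)=0,\\ u(T,x)=\Phi(x).\end{cases}$$
   Context: $T>0$; $U\subset\mathbb{R}^k$ is compact. Coefficients: $b:[0,T]\times\mathbb{R}^n\times\mathbb{R}^k\to\mathbb{R}^n$, $\sigma:[0,T]\times\mathbb{R}^n\times\mathbb{R}^k\to\mathbb{R}^{n\times d}$, $f:[0,T]\times\mathbb{R}^n\times\mathbb{R}\times\mathbb{R}^d\times\mathbb{R}^k\to\mathbb{R}$, $\Phi:\mathbb{R}^n\to\mathbb{R}$, $G$ ($n\times m$) and $K$ ($1\times m$). (A1) $b,\sigma$ are uniformly continuous in $(s,x,u)$ and there is $C>0$ with $|b(s,x^1,u^1)-b(s,x^2,u^2)|+|\sigma(s,x^1,u^1)-\sigma(s,x^2,u^2)|\le C(|x^1-x^2|+|u^1-u^2|)$ and $|b(s,x,u)|+|\sigma(s,x,u)|\le C(1+|x|)$ for all arguments. (A2) $f,\Phi$ are uniformly continuous in $(s,x,y,u)$ and there is $C>0$ with $|f(s,x^1,y^1,z^1,u^1)-f(s,x^2,y^2,z^2,u^2)|+|\Phi(x^1)-\Phi(x^2)|\le C(|x^1-x^2|+|y^1-y^2|+|z^1-z^2|+|u^1-u^2|)$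 and $|f(s,x,0,0,u)|+|\Phi(x)|\le C(1+|x|)$ for all arguments. (A3) $G$ and $K$ are deterministic constant matrices and there is $k_0$ with $K^i>k_0>0$ for $1\le i\le m$. (A4) $b$, $\sigma$, $\Phi$, $f(t,\cdot,y,z,v)$ are uniformly continuous, uniformly with respect to $(t,y,z,v)$, and bounded. (A5) For every $R>0$ there is a function $\varpi_R$ with $\varpi_R(s)\to0$ as $s\to0^+$ such that $|f(t,x,r,p,v)-f(t,y,r,p,v)|\le\varpi_R(|x-y|(1+|p|))$ for all $t\in[0,T]$, $|x|,|y|\le R$, $|r|\le R$, and all $p$, $v$. Notation: $\mathcal{L}(t,x,v)\Psi=\frac12\mathrm{Tr}(\sigma\sigma^{\top}(t,x,v)D^2\Psi)+\langle D\Psi,b(t,x,v)\rangle$. The expression $u_x^\top G+K$ is a row vector with $m$ coordinates; the minimum is taken over all its coordinates and the remaining scalar term. Viscosity solution: $w\in C([0,T]\times\mathbb{R}^n)$ is a subsolution (resp. supersolution) if for every $\varphi\in C^{1,2}([0,T]\times\mathbb{R}^n)$ and every local maximum (resp. local minimum) point $(t_0,x_0)$ of $w-\varphi$ in the interior of $[0,T]\times\mathbb{R}^n$ with $w(t_0,x_0)=\varphi(t_0,x_0)$, $$\min\Big(\varphi_x^\top G+K,\ \frac{\partial\varphi}{\partial t}+\min_{v\in U}\{\mathcal{L}\varphi+f(t_0,x_0,\varphi,\nabla\varphi\,\sigma,v)\}\Big)\ge 0\quad(\text{resp. }\le 0)\quad\text{at }(t_0,x_0).$$ $w$ is a viscosity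 solution of the problem if it is both a subsolution and a supersolution and $w(T,x)=\Phi(x)$ for all $x\in\mathbb{R}^n$. *)

theory Defs
  imports "HOL-Analysis.Analysis"
begin

text \<open>
  The dimensions $n$, $d$, $k$, $m$ are the cardinalities of the finite types
  \<open>'n\<close>, \<open>'d\<close>, \<open>'k\<close>, \<open>'m\<close>.  An $n \times d$ matrix has type \<open>real^'d^'n\<close> and
  its norm is the Frobenius norm.  Row vectors are represented by plain vectors, and
  a row vector times a matrix is \<open>p v* A\<close>.  Functions are total in the time argument, but
  only times in \<open>{0..T}\<close> are ever used.
\<close>

section \<open>Standing assumptions\<close>

definition lipschitz_diffusion_coeffs ::
  "real \<Rightarrow> (real \<Rightarrow> real^'n \<Rightarrow> real^'k \<Rightarrow> real^'n) \<Rightarrow>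
   (real \<Rightarrow> real^'n \<Rightarrow> real^'k \<Rightarrow> real^'d^'n) \<Rightarrow> bool"
where
  "lipschitz_diffusion_coeffs T b \<sigma> \<longleftrightarrow>
     uniformly_continuous_on ({0..T} \<times> UNIV \<times> UNIV) (\<lambda>(s, x, u). b s x u) \<and>
     uniformly_continuous_on ({0..T} \<times> UNIV \<times> UNIV) (\<lambda>(s, x, u). \<sigma> s x u) \<and>
     (\<exists>C>0.
       (\<forall>s\<in>{0..T}. \<forall>x1 x2 u1 u2.
          norm (b s x1 u1 - b s x2 u2) + norm (\<sigma> s x1 u1 - \<sigma> s x2 u2)
            \<le> C * (norm (x1 - x2) + norm (u1 - u2))) \<and>
       (\<forall>s\<in>{0..T}. \<forall>x u. norm (b s x u) + norm (\<sigma> s x u) \<le> C * (1 + norm x)))"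

text \<open>
  Uniform continuity of the driver \<open>f s x y z u\<close> in \<open>(s, x, y, u)\<close> is required for each
  fixed \<open>z\<close>, with no uniformity in \<open>z\<close>.
\<close>

definition lipschitz_driver_terminal ::
  "real \<Rightarrow> (real \<Rightarrow> real^'n \<Rightarrow> real \<Rightarrow> real^'d \<Rightarrow> real^'k \<Rightarrow> real) \<Rightarrow> (real^'n \<Rightarrow> real) \<Rightarrow> bool"
where
  "lipschitz_driver_terminal T f \<Phi> \<longleftrightarrow>
     (\<forall>z. uniformly_continuous_on ({0..T} \<times> UNIV \<times> UNIV \<times> UNIV)
            (\<lambda>(s, x, y, u). f s x y z u)) \<and>
     uniformly_continuous_on UNIV \<Phi> \<and>
     (\<exists>C>0.
       (\<forall>s\<in>{0..T}. \<forall>x1 x2 y1 y2 z1 z2 u1 u2.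
          \<bar>f s x1 y1 z1 u1 - f s x2 y2 z2 u2\<bar> + \<bar>\<Phi> x1 - \<Phi> x2\<bar>
            \<le> C * (norm (x1 - x2) + \<bar>y1 - y2\<bar> + norm (z1 - z2) + norm (u1 - u2))) \<and>
       (\<forall>s\<in>{0..T}. \<forall>x u. \<bar>f s x 0 0 u\<bar> + \<bar>\<Phi> x\<bar> \<le> C * (1 + norm x)))"

definition positive_singular_cost :: "real^'m \<Rightarrow> bool" where
  "positive_singular_cost K \<longleftrightarrow> (\<exists>k0>0. \<forall>i. K $ i > k0)"

text \<open>
  For \<open>f\<close>, the modulus of continuity in \<open>x\<close> is uniform in the other arguments, whereas the
  bound of \<open>x \<mapsto> f t x y z v\<close> may depend on \<open>(t, y, z, v)\<close>.
\<close>

definition bounded_ucont_data ::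
  "real \<Rightarrow> (real \<Rightarrow> real^'n \<Rightarrow> real^'k \<Rightarrow> real^'n) \<Rightarrow>
   (real \<Rightarrow> real^'n \<Rightarrow> real^'k \<Rightarrow> real^'d^'n) \<Rightarrow>
   (real \<Rightarrow> real^'n \<Rightarrow> real \<Rightarrow> real^'d \<Rightarrow> real^'k \<Rightarrow> real) \<Rightarrow> (real^'n \<Rightarrow> real) \<Rightarrow> bool"
where
  "bounded_ucont_data T b \<sigma> f \<Phi> \<longleftrightarrow>
     uniformly_continuous_on ({0..T} \<times> UNIV \<times> UNIV) (\<lambda>(t, x, v). b t x v) \<and>
     bounded ((\<lambda>(t, x, v). b t x v) ` ({0..T} \<times> UNIV \<times> UNIV)) \<and>
     uniformly_continuous_on ({0..T} \<times> UNIV \<times> UNIV) (\<lambda>(t, x, v). \<sigma> t x v) \<and>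
     bounded ((\<lambda>(t, x, v). \<sigma> t x v) ` ({0..T} \<times> UNIV \<times> UNIV)) \<and>
     uniformly_continuous_on UNIV \<Phi> \<and> bounded (range \<Phi>) \<and>
     (\<forall>\<epsilon>>0. \<exists>\<delta>>0. \<forall>t\<in>{0..T}. \<forall>y z v x x'.
        dist x x' < \<delta> \<longrightarrow> \<bar>f t x y z v - f t x' y z v\<bar> < \<epsilon>) \<and>
     (\<forall>t\<in>{0..T}. \<forall>y z v. bounded (range (\<lambda>x. f t x y z v)))"

definition driver_spatial_modulus ::
  "real \<Rightarrow> (real \<Rightarrow> real^'n \<Rightarrow> real \<Rightarrow> real^'d \<Rightarrow> real^'k \<Rightarrow> real) \<Rightarrow> bool"
where
  "driver_spatial_modulus T f \<longleftrightarrow>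
     (\<forall>R>0. \<exists>\<omega> :: real \<Rightarrow> real. (\<omega> \<longlongrightarrow> 0) (at_right 0) \<and>
        (\<forall>t\<in>{0..T}. \<forall>x y r p v. norm x \<le> R \<and> norm y \<le> R \<and> \<bar>r\<bar> \<le> R \<longrightarrow>
           \<bar>f t x r p v - f t y r p v\<bar> \<le> \<omega> (norm (x - y) * (1 + norm p))))"

section \<open>The equation\<close>

text \<open>
  In the following, \<open>a\<close>, \<open>r\<close>, \<open>p\<close>, \<open>X\<close> stand for the values of the time derivative, the function
  itself, its spatial gradient and its spatial Hessian.
\<close>

definition generator ::
  "(real \<Rightarrow> real^'n \<Rightarrow> real^'k \<Rightarrow> real^'n) \<Rightarrow> (real \<Rightarrow> real^'n \<Rightarrow> real^'k \<Rightarrow> real^'d^'n) \<Rightarrow>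
   real \<Rightarrow> real^'n \<Rightarrow> real^'k \<Rightarrow> real^'n \<Rightarrow> real^'n^'n \<Rightarrow> real"
where
  "generator b \<sigma> t x v p X =
     1/2 * trace (\<sigma> t x v ** transpose (\<sigma> t x v) ** X) + p \<bullet> b t x v"

text \<open>
  The infimum over \<open>U\<close> is a minimum when \<open>U\<close> is compact and nonempty and the
  coefficients are continuous in the control.
\<close>

definition hjb_operator ::
  "(real^'k) set \<Rightarrow> (real \<Rightarrow> real^'n \<Rightarrow> real^'k \<Rightarrow> real^'n) \<Rightarrow>
   (real \<Rightarrow> real^'n \<Rightarrow> real^'k \<Rightarrow> real^'d^'n) \<Rightarrow>
   (real \<Rightarrow> real^'n \<Rightarrow> real \<Rightarrow> real^'d \<Rightarrow> real^'k \<Rightarrow> real) \<Rightarrow> real^'m^'n \<Rightarrow> real^'m \<Rightarrow>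
   real \<Rightarrow> real^'n \<Rightarrow> real \<Rightarrow> real \<Rightarrow> real^'n \<Rightarrow> real^'n^'n \<Rightarrow> real"
where
  "hjb_operator U b \<sigma> f G K t x a r p X =
     Min (insert (a + (INF v\<in>U. generator b \<sigma> t x v p X + f t x r (p v* \<sigma> t x v) v))
                 (range (\<lambda>i. (p v* G + K) $ i)))"

section \<open>Viscosity solutions\<close>

text \<open>
  \<open>\<phi>\<close> is of class $C^{1,2}$ on \<open>{0..T} \<times> UNIV\<close> with time derivative \<open>\<phi>t\<close>, spatial gradient
  \<open>D\<phi>\<close> and spatial Hessian \<open>D2\<phi>\<close>; time derivatives at \<open>0\<close> and \<open>T\<close> are one-sided.
\<close>

definition C12 ::
  "real \<Rightarrow> (real \<Rightarrow> real^'n \<Rightarrow> real) \<Rightarrow> (real \<Rightarrow> real^'n \<Rightarrow> real) \<Rightarrow>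
   (real \<Rightarrow> real^'n \<Rightarrow> real^'n) \<Rightarrow> (real \<Rightarrow> real^'n \<Rightarrow> real^'n^'n) \<Rightarrow> bool"
where
  "C12 T \<phi> \<phi>t D\<phi> D2\<phi> \<longleftrightarrow>
     (\<forall>t\<in>{0..T}. \<forall>x.
        ((\<lambda>s. \<phi> s x) has_real_derivative \<phi>t t x) (at t within {0..T}) \<and>
        (GDERIV (\<phi> t) x :> D\<phi> t x) \<and>
        (D\<phi> t has_derivative (\<lambda>h. D2\<phi> t x *v h)) (at x)) \<and>
     continuous_on ({0..T} \<times> UNIV) (\<lambda>(t, x). \<phi> t x) \<and>
     continuous_on ({0..T} \<times> UNIV) (\<lambda>(t, x). \<phi>t t x) \<and>
     continuous_on ({0..T} \<times> UNIV) (\<lambda>(t, x). D\<phi> t x) \<and>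
     continuous_on ({0..T} \<times> UNIV) (\<lambda>(t, x). D2\<phi> t x)"

definition local_max_on :: "'a::metric_space set \<Rightarrow> ('a \<Rightarrow> real) \<Rightarrow> 'a \<Rightarrow> bool" where
  "local_max_on S g z \<longleftrightarrow> z \<in> S \<and> (\<exists>e>0. \<forall>p \<in> S \<inter> ball z e. g p \<le> g z)"

definition local_min_on :: "'a::metric_space set \<Rightarrow> ('a \<Rightarrow> real) \<Rightarrow> 'a \<Rightarrow> bool" where
  "local_min_on S g z \<longleftrightarrow> z \<in> S \<and> (\<exists>e>0. \<forall>p \<in> S \<inter> ball z e. g z \<le> g p)"

text \<open>
  The problem is posed with a terminal condition, whence a subsolution satisfies \<open>\<ge> 0\<close> and a
  supersolution \<open>\<le> 0\<close>.
\<close>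

definition viscosity_subsolution ::
  "real \<Rightarrow> (real^'k) set \<Rightarrow> (real \<Rightarrow> real^'n \<Rightarrow> real^'k \<Rightarrow> real^'n) \<Rightarrow>
   (real \<Rightarrow> real^'n \<Rightarrow> real^'k \<Rightarrow> real^'d^'n) \<Rightarrow>
   (real \<Rightarrow> real^'n \<Rightarrow> real \<Rightarrow> real^'d \<Rightarrow> real^'k \<Rightarrow> real) \<Rightarrow> real^'m^'n \<Rightarrow> real^'m \<Rightarrow>
   (real \<Rightarrow> real^'n \<Rightarrow> real) \<Rightarrow> bool"
where
  "viscosity_subsolution T U b \<sigma> f G K w \<longleftrightarrow>
     continuous_on ({0..T} \<times> UNIV) (\<lambda>(t, x). w t x) \<and>
     (\<forall>\<phi> \<phi>t D\<phi> D2\<phi> t0 x0.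
        C12 T \<phi> \<phi>t D\<phi> D2\<phi> \<and>
        (t0, x0) \<in> interior ({0..T} \<times> UNIV) \<and>
        local_max_on ({0..T} \<times> UNIV) (\<lambda>(t, x). w t x - \<phi> t x) (t0, x0) \<and>
        w t0 x0 = \<phi> t0 x0 \<longrightarrow>
        hjb_operator U b \<sigma> f G K t0 x0 (\<phi>t t0 x0) (\<phi> t0 x0) (D\<phi> t0 x0) (D2\<phi> t0 x0) \<ge> 0)"

definition viscosity_supersolution ::
  "real \<Rightarrow> (real^'k) set \<Rightarrow> (real \<Rightarrow> real^'n \<Rightarrow> real^'k \<Rightarrow> real^'n) \<Rightarrow>
   (real \<Rightarrow> real^'n \<Rightarrow> real^'k \<Rightarrow> real^'d^'n) \<Rightarrow>
   (real \<Rightarrow> real^'n \<Rightarrow> real \<Rightarrow> real^'d \<Rightarrow> real^'k \<Rightarrow> real) \<Rightarrow> real^'m^'n \<Rightarrow> real^'m \<Rightarrow>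
   (real \<Rightarrow> real^'n \<Rightarrow> real) \<Rightarrow> bool"
where
  "viscosity_supersolution T U b \<sigma> f G K w \<longleftrightarrow>
     continuous_on ({0..T} \<times> UNIV) (\<lambda>(t, x). w t x) \<and>
     (\<forall>\<phi> \<phi>t D\<phi> D2\<phi> t0 x0.
        C12 T \<phi> \<phi>t D\<phi> D2\<phi> \<and>
        (t0, x0) \<in> interior ({0..T} \<times> UNIV) \<and>
        local_min_on ({0..T} \<times> UNIV) (\<lambda>(t, x). w t x - \<phi> t x) (t0, x0) \<and>
        w t0 x0 = \<phi> t0 x0 \<longrightarrow>
        hjb_operator U b \<sigma> f G K t0 x0 (\<phi>t t0 x0) (\<phi> t0 x0) (D\<phi> t0 x0) (D2\<phi> t0 x0) \<le> 0)"

definition viscosity_solution ::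
  "real \<Rightarrow> (real^'k) set \<Rightarrow> (real \<Rightarrow> real^'n \<Rightarrow> real^'k \<Rightarrow> real^'n) \<Rightarrow>
   (real \<Rightarrow> real^'n \<Rightarrow> real^'k \<Rightarrow> real^'d^'n) \<Rightarrow>
   (real \<Rightarrow> real^'n \<Rightarrow> real \<Rightarrow> real^'d \<Rightarrow> real^'k \<Rightarrow> real) \<Rightarrow> (real^'n \<Rightarrow> real) \<Rightarrow>
   real^'m^'n \<Rightarrow> real^'m \<Rightarrow> (real \<Rightarrow> real^'n \<Rightarrow> real) \<Rightarrow> bool"
where
  "viscosity_solution T U b \<sigma> f \<Phi> G K w \<longleftrightarrow>
     viscosity_subsolution T U b \<sigma> f G K w \<and>
     viscosity_supersolution T U b \<sigma> f G K w \<and>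
     (\<forall>x. w T x = \<Phi> x)"

definition bounded_continuous :: "real \<Rightarrow> (real \<Rightarrow> real^'n \<Rightarrow> real) \<Rightarrow> bool" where
  "bounded_continuous T w \<longleftrightarrow>
     bounded ((\<lambda>(t, x). w t x) ` ({0..T} \<times> UNIV)) \<and>
     continuous_on ({0..T} \<times> UNIV) (\<lambda>(t, x). w t x)"

end

theory Submission
  imports Defs
begin

text \<open>
  Both solutions are compared by doubling the variables.  The obstacle is that the driver is only
  Lipschitz in the gradient, so scaling the subsolution \<open>u\<close> by a factor below one, which makes the
  gradient constraint strict, produces an error proportional to the gradient.  Instead \<open>u\<close> is
  written as \<open>u = w - \<delta> exp(-w)\<close>.  The concavity of this change of variable contributes a negative
  multiple of \<open>\<delta>\<close> times the squared gradient, which absorbs the error, while the gradient constraint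
  for \<open>w\<close> is strict of order \<open>\<delta>\<close>.  The weight \<open>exp(l t)\<close> makes the equation proper, and the
  decreasing penalty \<open>B exp(-N t)\<close> keeps maximum points away from time \<open>0\<close>.

  Time is doubled together with space and with its own, much larger penalty parameter, so the
  elliptic theorem on sums suffices.  It is obtained from sup-convolutions: on the set of points
  where a sup-convolution minus the penalty is touched from above by a nearly horizontal plane,
  which is not negligible because the slope is a Lipschitz function of the point (Jensen), the
  resolvent of the subdifferential is differentiable outside a negligible set (Rademacher), and
  this gives second-order expansions (Alexandrov).
\<close>

section \<open>Rademacher's theorem\<close>

text \<open>The change of variable \<open>r - \<delta> * exp (- r)\<close> has first derivative
  \<open>1 + E\<close> and second derivative \<open>- E\<close> with the same
  \<open>E = \<delta> * exp (- r)\<close>. The linear error in the gradient and the quadratic gain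
  thus carry the same small factor, and completing the square leaves an error of order
  \<open>\<delta>\<close> that does not depend on the gradient. The time penalty
  \<open>\<gamma>\<close> may be as large as desired because the two equations carry the weights
  \<open>exp (- (l * t))\<close> and \<open>exp (- (l * s))\<close>: their difference multiplies
  \<open>\<gamma> * (t - s)\<close> with a nonpositive product. The obstacle is the order of the
  choices. Gradients grow with the space penalty \<open>\<alpha>\<close>, and the modulus of
  \<open>f\<close> in time is uniform only for bounded gradients, so \<open>\<gamma>\<close> must
  follow \<open>\<alpha>\<close>; yet smallness of \<open>\<alpha> * (norm (x - y))\<^sup>2\<close>
  is a statement about varying \<open>\<alpha>\<close> with everything else fixed. A bounded list of
  candidates for \<open>\<alpha>\<close>, fixed in advance, breaks the circle.\<close>

lemma negligible_borel_emeasure_0: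
  assumes "negligible N" "S \<in> sets borel" "S \<subseteq> N"
  shows "emeasure lborel S = 0"
proof -
  have "negligible S" using assms negligible_subset by blast
  then have "S \<in> null_sets lborel"
    using assms(2) by (simp add: negligible_iff_null_sets null_sets_completion_iff)
  then show ?thesis by auto
qed

text \<open>
  Adding \<open>(L + 1) x\<close> to \<open>g\<close> gives a bi-Lipschitz bijection; the image of Lebesgue measure under its
  inverse has a density, whose averages over short intervals are the difference quotients.
\<close>

lemma lipschitz_real_quotient_convergent:
  fixes g :: "real \<Rightarrow> real"
  assumes lip: "\<And>x y. \<bar>g x - g y\<bar> \<le> L * \<bar>x - y\<bar>"
  shows "\<exists>N. negligible N \<and> (\<forall>x. x \<notin> N \<longrightarrow>
     convergent (\<lambda>n. real (Suc n) * (g (x + 1 / real (Suc n)) - g x)))"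
proof -
  \<comment> \<open>The slope of \<open>F\<close> lies between \<open>1\<close> and
    \<open>2 * L + 1\<close>, so \<open>F\<close> maps null sets to null sets and its inverse
    \<open>I\<close> is nonexpansive.\<close>
  define F where "F x = g x + (L + 1) * x" for x
  have F_ge: "F y - F x \<ge> y - x" if "x \<le> y" for x y
    using lip[of y x] that unfolding F_def by (simp add: algebra_simps abs_if split: if_splits)
  have F_le: "\<bar>F y - F x\<bar> \<le> (2 * L + 1) * \<bar>y - x\<bar>" for x y
  proof -
    have L: "L * \<bar>y - x\<bar> \<ge> 0" using lip[of y x] abs_ge_zero order_trans by blast
    have "\<bar>F y - F x\<bar> \<le> \<bar>g y - g x\<bar> + \<bar>(L + 1) * (y - x)\<bar>"
      unfolding F_def by (simp add: algebra_simps)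
    also have "\<bar>(L + 1) * (y - x)\<bar> = \<bar>L * (y - x) + (y - x)\<bar>" by (simp add: algebra_simps)
    also have "\<dots> \<le> L * \<bar>y - x\<bar> + \<bar>y - x\<bar>"
      using L by (cases "y = x") (auto simp: abs_mult zero_le_mult_iff intro: order_trans[OF abs_triangle_ineq])
    finally show ?thesis using lip[of y x] by (simp add: algebra_simps)
  qed
  have F_inj: "F x = F y \<Longrightarrow> x = y" for x y
    using F_ge[of x y] F_ge[of y x] by force
  have F_cont: "continuous_on A F" for A
    unfolding F_def
  proof (intro continuous_intros)
    have "\<bar>g x - g y\<bar> \<le> (max L 0) * \<bar>x - y\<bar>" for x y
      by (rule order_trans[OF lip mult_right_mono]) auto
    then have "(max L 0)-lipschitz_on UNIV g"
      by (intro lipschitz_onI) (auto simp: dist_real_def)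
    then show "continuous_on A g"
      using continuous_on_subset lipschitz_on_continuous_on by blast
  qed
  have F_surj: "\<exists>x. F x = y" for y
  proof -
    define a where "a = - \<bar>y - F 0\<bar>"
    have "F a \<le> y" using F_ge[of a 0] unfolding a_def by auto
    moreover have "y \<le> F (-a)" using F_ge[of 0 "-a"] unfolding a_def by auto
    moreover have "a \<le> -a" unfolding a_def by auto
    ultimately obtain x where "F x = y" using IVT'[of F a y "-a"] F_cont by blast
    then show ?thesis by blast
  qed
  define I where "I = inv F"
  have FI: "F (I y) = y" for y unfolding I_def using F_surj by (metis surj_def surj_f_inv_f)
  have IF: "I (F x) = x" for x using F_inj FI by blast
  have I_lip: "1-lipschitz_on UNIV I"
  proof (intro lipschitz_onI)
    fix x y show "dist (I x) (I y) \<le> 1 * dist x y"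
      using F_ge[of "I x" "I y"] F_ge[of "I y" "I x"] FI[of x] FI[of y]
      by (cases "I x \<le> I y") (auto simp: dist_real_def)
  qed simp
  have [measurable]: "I \<in> borel_measurable borel"
    by (intro borel_measurable_continuous_onI lipschitz_on_continuous_on[OF I_lip])
  define \<mu> where "\<mu> = distr lborel borel I"
  \<comment> \<open>The preimage of a set under \<open>I\<close> is its image under
    \<open>F\<close>, and a Lipschitz image of a null set is null; hence a density exists.\<close>
  have ac: "absolutely_continuous lborel \<mu>"
    unfolding absolutely_continuous_def
  proof safe
    fix A :: "real set" assume A: "A \<in> null_sets lborel"
    then have [measurable]: "A \<in> sets borel" by auto
    have "negligible A" using A
      by (simp add: negligible_iff_null_sets null_sets_completion_iff null_sets_def)
    then have "negligible (F ` A)"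
    proof (intro negligible_locally_Lipschitz_image)
      show "\<exists>T B. open T \<and> x \<in> T \<and> (\<forall>y\<in>A \<inter> T. norm (F y - F x) \<le> B * norm (y - x))" for x
        using F_le by (intro exI[of _ UNIV] exI[of _ "2*L+1"]) auto
    qed auto
    moreover have "I -` A = F ` A" using FI IF by (auto simp: image_iff) (metis FI)
    moreover have "I -` A \<in> sets borel"
      using measurable_sets[of I borel borel A] by simp
    ultimately have "emeasure lborel (I -` A) = 0"
      by (intro negligible_borel_emeasure_0[of "F ` A"]) auto
    then have "emeasure \<mu> A = 0" unfolding \<mu>_def
      by (subst emeasure_distr) auto
    then show "A \<in> null_sets \<mu>" unfolding \<mu>_def null_sets_def by auto
  qed
  obtain h where [measurable]: "h \<in> borel_measurable lborel" and h: "density lborel h = \<mu>"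
    using sigma_finite_measure.Radon_Nikodym[OF sigma_finite_lborel ac] unfolding \<mu>_def by auto
  have h_int: "(\<integral>\<^sup>+x. h x * indicator {a..b} x \<partial>lborel) = ennreal (F b - F a)" if "a \<le> b" for a b
  proof -
    have "I -` {a..b} = {F a..F b}"
    proof (intro equalityI subsetI)
      fix x assume "x \<in> I -` {a..b}"
      then show "x \<in> {F a..F b}" using F_ge[of a "I x"] F_ge[of "I x" b] FI[of x] by auto
    next
      fix x assume "x \<in> {F a..F b}"
      then show "x \<in> I -` {a..b}"
        using F_ge[of "I x" a] F_ge[of b "I x"] FI[of x] by (auto intro: ccontr simp: not_le)
    qed
    then have "emeasure \<mu> {a..b} = emeasure lborel {F a..F b}" unfolding \<mu>_def
      by (subst emeasure_distr) auto
    also have "\<dots> = ennreal (F b - F a)" using F_ge[OF that] that by simp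
    finally show ?thesis unfolding h[symmetric] by (subst (asm) emeasure_density) auto
  qed
  define r where "r x = enn2real (h x)" for x
  have [measurable]: "r \<in> borel_measurable borel" unfolding r_def by measurable
  have fin: "AE x in lborel. h x * indicator {a..b} x \<noteq> \<infinity>" for a b
    by (cases "a \<le> b", rule nn_integral_noteq_infinite) (auto simp: h_int)
  have r_int: "(r has_integral (F b - F a)) {a..b}" if "a \<le> b" for a b
  proof -
    have "(\<integral>\<^sup>+x. ennreal (indicator {a..b} x * r x) \<partial>lborel) = (\<integral>\<^sup>+x. h x * indicator {a..b} x \<partial>lborel)"
      using fin[of a b] by (intro nn_integral_cong_AE, eventually_elim)
        (auto simp: r_def indicator_def less_top)
    then have "((\<lambda>x. indicator {a..b} x * r x) has_integral (F b - F a)) UNIV"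
      using F_ge[OF that] that by (intro nn_integral_has_integral) (auto simp: h_int r_def)
    then show ?thesis by (subst has_integral_restrict_UNIV[symmetric])
      (auto simp: indicator_def of_bool_def if_distrib[of "\<lambda>c. c * _"] cong: if_cong)
  qed
  \<comment> \<open>Lebesgue differentiation over the intervals from \<open>x\<close> to
    \<open>x + h\<close>. It controls right difference quotients, which are the only ones occurring
    in the claim.\<close>
  obtain N where N: "negligible N" and
    N2: "\<And>x e. x \<notin> N \<Longrightarrow> 0 < e \<Longrightarrow> \<exists>d>0. \<forall>h. 0 < h \<and> h < d \<longrightarrow>
          norm (integral (cbox x (x + h *\<^sub>R One)) r /\<^sub>R h ^ DIM(real) - r x) < e"
    using integrable_ccontinuous_explicit[of r] r_int
    by (metis box_real(2) has_integral_integrable integrable_on_empty atLeastatMost_empty_iff)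
  show ?thesis
  proof (intro exI conjI allI impI)
    fix x assume x: "x \<notin> N"
    have "(\<lambda>n. real (Suc n) * (F (x + 1 / real (Suc n)) - F x)) \<longlonglongrightarrow> r x"
    proof (rule LIMSEQ_I)
      fix e :: real assume "e > 0"
      then obtain d where d: "d > 0" "\<And>h. 0 < h \<Longrightarrow> h < d \<Longrightarrow>
          \<bar>integral {x..x+h} r / h - r x\<bar> < e"
        using N2[OF x, of e] by (auto simp: divide_inverse mult.commute)
      obtain k where k: "1 / real (Suc k) < d" using d(1) nat_approx_posE by blast
      show "\<exists>no. \<forall>n\<ge>no. norm (real (Suc n) * (F (x + 1 / real (Suc n)) - F x) - r x) < e"
      proof (intro exI allI impI)
        fix n assume "n \<ge> k"
        then have "1 / real (Suc n) < d" using k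
          by (smt (verit) frac_le of_nat_0_less_iff of_nat_mono Suc_le_mono zero_less_Suc)
        then show "norm (real (Suc n) * (F (x + 1 / real (Suc n)) - F x) - r x) < e"
          using d(2)[of "1 / real (Suc n)"] r_int[of x "x + 1 / real (Suc n)"]
          by (simp add: integral_unique mult.commute)
      qed
    qed
    then have "(\<lambda>n. real (Suc n) * (F (x + 1 / real (Suc n)) - F x) - (L + 1)) \<longlonglongrightarrow> r x - (L + 1)"
      by (intro tendsto_intros)
    moreover have "real (Suc n) * (F (x + 1 / real (Suc n)) - F x) - (L + 1) =
        real (Suc n) * (g (x + 1 / real (Suc n)) - g x)" for n
      unfolding F_def by (simp add: field_simps)
    ultimately show "convergent (\<lambda>n. real (Suc n) * (g (x + 1 / real (Suc n)) - g x))"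
      unfolding convergent_def by auto
  qed (rule N)
qed

text \<open>Fubini without a rotation of coordinates: the indicator of the exceptional set at
  \<open>x + s *\<^sub>R v\<close> is integrated over \<open>s\<close> and \<open>x\<close> in both
  orders. Along each line it vanishes by the one-dimensional result; for each fixed \<open>s\<close>
  translation invariance gives the measure of the set. So this measure times the infinite length of
  the real line is \<open>0\<close>.\<close>

lemma lipschitz_directional_quotient_convergent:
  fixes g :: "'a::euclidean_space \<Rightarrow> real"
  assumes lip: "\<And>x y. \<bar>g x - g y\<bar> \<le> L * norm (x - y)"
  shows "AE x in lborel. convergent (\<lambda>n. real (Suc n) * (g (x + v /\<^sub>R real (Suc n)) - g x))"
proof -
  have "(max L 0)-lipschitz_on UNIV g"
    using lip by (intro lipschitz_onI) (auto simp: dist_real_def dist_norm intro: order_trans[OF lip mult_right_mono])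
  then have "continuous_on UNIV g" by (rule lipschitz_on_continuous_on)
  then have [measurable]: "g \<in> borel_measurable borel" by (rule borel_measurable_continuous_onI)
  \<comment> \<open>Failure of the Cauchy property is equivalent to divergence of the quotients and
    gives a Borel set at once.\<close>
  define S where "S = {x. \<not> Cauchy (\<lambda>n. real (Suc n) * (g (x + v /\<^sub>R real (Suc n)) - g x))}"
  have [measurable]: "S \<in> sets borel"
  proof -
    have "{x\<in>space borel. Cauchy (\<lambda>n. real (Suc n) * (g (x + v /\<^sub>R real (Suc n)) - g x))} \<in> sets borel"
      by (rule sets_Collect_Cauchy) measurable
    then have "space borel - {x\<in>space borel. Cauchy (\<lambda>n. real (Suc n) * (g (x + v /\<^sub>R real (Suc n)) - g x))} \<in> sets borel"
      by blast
    then show ?thesis unfolding S_def by (simp add: Compl_eq_Diff_UNIV[symmetric] Collect_neg_eq)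
  qed
  have line: "(\<integral>\<^sup>+s. indicator S (x + s *\<^sub>R v) \<partial>lborel) = 0" for x
  proof -
    have "\<bar>g (x + s *\<^sub>R v) - g (x + t *\<^sub>R v)\<bar> \<le> (L * norm v) * \<bar>s - t\<bar>" for s t
    proof -
      have "norm ((x + s *\<^sub>R v) - (x + t *\<^sub>R v)) = \<bar>s - t\<bar> * norm v"
        by (simp add: scaleR_left_diff_distrib[symmetric])
      then show ?thesis using lip[of "x + s *\<^sub>R v" "x + t *\<^sub>R v"] by (simp add: mult_ac)
    qed
    from lipschitz_real_quotient_convergent[of "\<lambda>s. g (x + s *\<^sub>R v)", OF this]
    obtain N where N: "negligible N" and conv: "\<And>s. s \<notin> N \<Longrightarrow> convergent (\<lambda>n. real (Suc n) *
        (g (x + (s + 1 / real (Suc n)) *\<^sub>R v) - g (x + s *\<^sub>R v)))" by blast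
    define A where "A = (\<lambda>s. x + s *\<^sub>R v) -` S"
    have "(\<lambda>s. x + s *\<^sub>R v) \<in> borel_measurable borel" by measurable
    from measurable_sets[OF this, of S] have [measurable]: "A \<in> sets borel" by (simp add: A_def)
    have "A \<subseteq> N"
    proof (rule subsetI, rule ccontr)
      fix s assume "s \<in> A" "s \<notin> N"
      then show False using conv[of s] unfolding A_def S_def
        by (auto simp: convergent_eq_Cauchy[symmetric] convergent_def scaleR_left_distrib add.assoc divide_inverse)
    qed
    then have "emeasure lborel A = 0" by (intro negligible_borel_emeasure_0[OF N]) auto
    moreover have "(\<integral>\<^sup>+s. indicator S (x + s *\<^sub>R v) \<partial>lborel) = (\<integral>\<^sup>+s. indicator A s \<partial>lborel)"
      by (intro nn_integral_cong) (auto simp: A_def indicator_def)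
    ultimately show ?thesis by simp
  qed
  have trans: "(\<integral>\<^sup>+x. indicator S (x + s *\<^sub>R v) \<partial>lborel) = emeasure lborel S" for s
  proof -
    have "emeasure lborel S = (\<integral>\<^sup>+x. indicator S x \<partial>(distr lborel borel ((+) (s *\<^sub>R v))))"
      by (simp add: lborel_distr_plus)
    also have "\<dots> = (\<integral>\<^sup>+x. indicator S (s *\<^sub>R v + x) \<partial>lborel)"
      by (subst nn_integral_distr) auto
    finally show ?thesis by (simp add: add.commute)
  qed
  have "(\<integral>\<^sup>+s. \<integral>\<^sup>+x. indicator S (x + s *\<^sub>R v) \<partial>lborel \<partial>(lborel::real measure)) = (\<integral>\<^sup>+x. \<integral>\<^sup>+s. indicator S (x + s *\<^sub>R v) \<partial>lborel \<partial>lborel)"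
    by (rule lborel_pair.Fubini') measurable
  then have "emeasure lborel S * emeasure (lborel::real measure) UNIV = 0"
    by (simp add: trans line)
  then have "emeasure lborel S = 0" by simp
  then have "S \<in> null_sets lborel" by auto
  then show ?thesis
    by (rule AE_I'[where P="\<lambda>x. convergent (\<lambda>n. real (Suc n) * (g (x + v /\<^sub>R real (Suc n)) - g x))"])
       (auto simp: S_def Cauchy_convergent_iff)
qed

text \<open>By Lebesgue differentiation almost every value of \<open>h\<close> is a limit of
  averages over small cubes, and all these averages vanish.\<close>

lemma negligible_if_box_integrals_0:
  fixes h :: "'a::euclidean_space \<Rightarrow> real"
  assumes "\<And>a b. (h has_integral 0) (cbox a b)"
  shows "negligible {x. h x \<noteq> 0}"
proof -
  obtain N where N: "negligible N" and
    N2: "\<And>x e. x \<notin> N \<Longrightarrow> 0 < e \<Longrightarrow> \<exists>d>0. \<forall>k. 0 < k \<and> k < d \<longrightarrow>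
          norm (integral (cbox x (x + k *\<^sub>R One)) h /\<^sub>R k ^ DIM('a) - h x) < e"
    using integrable_ccontinuous_explicit[of h] assms by (metis has_integral_integrable)
  have "h x = 0" if "x \<notin> N" for x
  proof (rule ccontr)
    assume "h x \<noteq> 0"
    then have "0 < \<bar>h x\<bar>" by simp
    from N2[OF \<open>x \<notin> N\<close> this] obtain d where d: "d > 0" and dd: "\<forall>k. 0 < k \<and> k < d \<longrightarrow>
          norm (integral (cbox x (x + k *\<^sub>R One)) h /\<^sub>R k ^ DIM('a) - h x) < \<bar>h x\<bar>"
      by blast
    have "norm (integral (cbox x (x + (d/2) *\<^sub>R One)) h /\<^sub>R (d/2) ^ DIM('a) - h x) < \<bar>h x\<bar>"
      using d dd[rule_format, of "d/2"] by simp
    moreover have "integral (cbox x (x + (d/2) *\<^sub>R One)) h = 0"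
      using assms integral_unique by blast
    ultimately show False by simp
  qed
  then show ?thesis using N by (auto intro: negligible_subset)
qed

text \<open>The steps run through \<open>1 / (n + 1)\<close> only: limits of sequences keep
  measurability, and a Lipschitz function is controlled between consecutive steps anyway.\<close>

definition dq :: "('a::euclidean_space \<Rightarrow> real) \<Rightarrow> 'a \<Rightarrow> nat \<Rightarrow> 'a \<Rightarrow> real" where
  "dq g v n x = real (Suc n) * (g (x + v /\<^sub>R real (Suc n)) - g x)"

lemma dq_bound:
  assumes lip: "\<And>x y. \<bar>g x - g y\<bar> \<le> L * norm (x - y)"
  shows "\<bar>dq g v n x\<bar> \<le> L * norm v"
proof -
  have "\<bar>dq g v n x\<bar> = real (Suc n) * \<bar>g (x + v /\<^sub>R real (Suc n)) - g x\<bar>"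
    unfolding dq_def by (simp add: abs_mult)
  also have "\<dots> \<le> real (Suc n) * (L * norm (v /\<^sub>R real (Suc n)))"
    by (intro mult_left_mono) (use lip[of "x + v /\<^sub>R real (Suc n)" x] in auto)
  also have "\<dots> = L * norm v" by (simp add: field_simps)
  finally show ?thesis .
qed

lemma lipschitz_const_continuous:
  fixes g :: "'a::euclidean_space \<Rightarrow> real"
  assumes lip: "\<And>x y. \<bar>g x - g y\<bar> \<le> L * norm (x - y)"
  shows "continuous_on UNIV g"
proof -
  have "(max L 0)-lipschitz_on UNIV g"
    using lip by (intro lipschitz_onI) (auto simp: dist_real_def dist_norm intro: order_trans[OF lip mult_right_mono])
  then show ?thesis by (rule lipschitz_on_continuous_on)
qed

text \<open>
  The defect of additivity integrates to zero over every box, because shifting the difference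
  quotient by \<open>v / (n + 1)\<close> changes its integral over the box by a vanishing amount.
\<close>

lemma directional_limits_additive:
  fixes g :: "'a::euclidean_space \<Rightarrow> real"
  assumes lip: "\<And>x y. \<bar>g x - g y\<bar> \<le> L * norm (x - y)"
  shows "\<exists>N. negligible N \<and> (\<forall>x. x \<notin> N \<longrightarrow> lim (\<lambda>n. dq g (v + w) n x) = lim (\<lambda>n. dq g v n x) + lim (\<lambda>n. dq g w n x))"
proof -
  have [measurable]: "g \<in> borel_measurable borel"
    using lipschitz_const_continuous[OF lip] by (rule borel_measurable_continuous_onI)
  have dqm[measurable]: "dq g u n \<in> borel_measurable borel" for u n
    unfolding dq_def by measurable
  define D where "D u x = lim (\<lambda>n. dq g u n x)" for u x
  have [measurable]: "D u \<in> borel_measurable borel" for u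
    unfolding D_def by measurable
  have conv: "AE x in lborel. (\<lambda>n. dq g u n x) \<longlonglongrightarrow> D u x" for u
    using lipschitz_directional_quotient_convergent[OF lip, of u]
    by eventually_elim (simp add: D_def dq_def convergent_LIMSEQ_iff)
  have L0: "L * norm u \<ge> 0" for u :: 'a
    using dq_bound[OF lip, of u 0 0] abs_ge_zero order_trans by blast
  define M where "M = L * norm v + L * norm w + L * norm (v + w)"
  have M0: "M \<ge> 0" unfolding M_def using L0 by simp
  define h where "h x = D (v + w) x - D v x - D w x" for x
  have [measurable]: "h \<in> borel_measurable borel" unfolding h_def by measurable
  define r where "r n x = dq g (v + w) n x - dq g v n x - dq g w n x" for n x
  have [measurable]: "r n \<in> borel_measurable borel" for n unfolding r_def by measurable
  have r_bound: "\<bar>r n x\<bar> \<le> M" for n x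
    using dq_bound[OF lip, of v n x] dq_bound[OF lip, of w n x] dq_bound[OF lip, of "v + w" n x]
    unfolding r_def M_def by linarith
  have box0: "(h has_integral 0) (cbox a b)" for a b
  proof -
    let ?I = "indicator (cbox a b) :: 'a \<Rightarrow> real"
    have int_ball: "integrable lborel (\<lambda>x. C * indicator (cball 0 R) x)" for C R :: real
      by (intro integrable_mult_right integrable_real_indicator) (auto intro!: emeasure_bounded_finite[unfolded infinity_ennreal_def])
    have int_box: "integrable lborel (\<lambda>x. M * ?I x)"
      by (intro integrable_mult_right integrable_real_indicator) (auto intro!: emeasure_bounded_finite[unfolded infinity_ennreal_def])
    have AE_lim: "AE x in lborel. (\<lambda>n. ?I x * r n x) \<longlonglongrightarrow> ?I x * h x"
      using conv[of "v+w"] conv[of v] conv[of w]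
      by eventually_elim (unfold r_def h_def, intro tendsto_intros)
    have AE_bd: "AE x in lborel. norm (?I x * r n x) \<le> M * ?I x" for n
      by (rule AE_I2) (use r_bound M0 in \<open>auto simp: indicator_def abs_mult\<close>)
    have lim1: "(\<lambda>n. \<integral>x. ?I x * r n x \<partial>lborel) \<longlonglongrightarrow> (\<integral>x. ?I x * h x \<partial>lborel)"
      by (rule integral_dominated_convergence[OF _ _ int_box AE_lim AE_bd]) measurable
    have h_int: "integrable lborel (\<lambda>x. ?I x * h x)"
      by (rule integrable_dominated_convergence[OF _ _ int_box AE_lim AE_bd]) measurable
    obtain R0 where R0: "cbox a b \<subseteq> cball 0 R0"
      using bounded_cbox[of a b] unfolding bounded_iff by (auto simp: subset_iff)
    \<comment> \<open>All translates of the box by \<open>v / (n + 1)\<close> lie in the ball of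
      radius \<open>R\<close>, which provides one integrable majorant for every
      \<open>n\<close>.\<close>
    define R where "R = R0 + norm v"
    define vn where "vn n = v /\<^sub>R real (Suc n)" for n
    have vn_norm: "norm (vn n) \<le> norm v" for n
  proof -
    have "inverse (real (Suc n)) \<le> 1" by (simp add: inverse_le_1_iff)
    then have "inverse (real (Suc n)) * norm v \<le> 1 * norm v" by (rule mult_right_mono) simp
    then show ?thesis unfolding vn_def by simp
  qed
    have vn_lim: "vn \<longlonglongrightarrow> 0"
    proof -
      have "(\<lambda>n. inverse (real (Suc n)) *\<^sub>R v) \<longlonglongrightarrow> 0 *\<^sub>R v"
        by (intro tendsto_intros LIMSEQ_inverse_real_of_nat)
      then show ?thesis unfolding vn_def by simp
    qed
    have box_int: "integrable lborel (\<lambda>x. ?I x * k x)"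
      if [measurable]: "k \<in> borel_measurable borel" and k: "\<And>x. \<bar>k x\<bar> \<le> M" for k
      by (rule Bochner_Integration.integrable_bound[OF int_box])
         (use k M0 in \<open>auto simp: indicator_def abs_mult\<close>)
    have dq_M: "\<bar>dq g w n x\<bar> \<le> M" for n x
      using dq_bound[OF lip, of w n x] L0[of v] L0[of "v+w"] unfolding M_def by linarith
    have sh: "(\<integral>x. ?I x * r n x \<partial>lborel) = (\<integral>x. (?I (x - vn n) - ?I x) * dq g w n x \<partial>lborel)"
      and sh_int: "integrable lborel (\<lambda>x. (?I (x - vn n) - ?I x) * dq g w n x)" for n
    proof -
      \<comment> \<open>The defect of additivity is the increment of the quotient in direction
        \<open>w\<close> under a shift by \<open>v / (n + 1)\<close>; the shift is then moved from
        the quotient to the box.\<close>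
      have eq: "r n x = dq g w n (vn n + x) - dq g w n x" for x
        unfolding r_def dq_def vn_def by (simp add: algebra_simps)
      have i1: "integrable lborel (\<lambda>x. ?I x * dq g w n (vn n + x))"
        by (rule box_int) (use dq_M in auto)
      have i2: "integrable lborel (\<lambda>x. ?I x * dq g w n x)"
        by (rule box_int) (use dq_M in auto)
      have "(\<integral>x. ?I x * r n x \<partial>lborel) = (\<integral>x. ?I x * dq g w n (vn n + x) \<partial>lborel) - (\<integral>x. ?I x * dq g w n x \<partial>lborel)"
        unfolding eq right_diff_distrib by (rule Bochner_Integration.integral_diff[OF i1 i2])
      also have "(\<integral>x. ?I x * dq g w n (vn n + x) \<partial>lborel) = (\<integral>x. ?I (vn n + x - vn n) * dq g w n (vn n + x) \<partial>lborel)"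
        by simp
      also have "\<dots> = (\<integral>x. ?I (x - vn n) * dq g w n x \<partial>(distr lborel borel ((+) (vn n))))"
        by (rule integral_distr[symmetric]) measurable
      also have "\<dots> = (\<integral>x. ?I (x - vn n) * dq g w n x \<partial>lborel)" by (simp add: lborel_distr_plus)
      finally have e1: "(\<integral>x. ?I x * r n x \<partial>lborel) = (\<integral>x. ?I (x - vn n) * dq g w n x \<partial>lborel) - (\<integral>x. ?I x * dq g w n x \<partial>lborel)" .
      have "integrable (distr lborel borel ((+) (vn n))) (\<lambda>x. ?I (x - vn n) * dq g w n x)"
        by (subst integrable_distr_eq) (use i1 in auto)
      then have i3: "integrable lborel (\<lambda>x. ?I (x - vn n) * dq g w n x)" by (simp add: lborel_distr_plus)
      show "(\<integral>x. ?I x * r n x \<partial>lborel) = (\<integral>x. (?I (x - vn n) - ?I x) * dq g w n x \<partial>lborel)"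
        unfolding e1 left_diff_distrib by (rule Bochner_Integration.integral_diff[OF i3 i2, symmetric])
      show "integrable lborel (\<lambda>x. (?I (x - vn n) - ?I x) * dq g w n x)"
        unfolding left_diff_distrib by (rule Bochner_Integration.integrable_diff[OF i3 i2])
    qed
    \<comment> \<open>Off the boundary of the box, a null set, a point and its shifted copy are
      eventually both inside or both outside.\<close>
    have "AE x in lborel. (\<lambda>n. (?I (x - vn n) - ?I x) * dq g w n x) \<longlonglongrightarrow> 0"
    proof (rule AE_I')
      have "negligible (cbox a b - box a b)" by (rule negligible_frontier_interval)
      then show "cbox a b - box a b \<in> null_sets lborel"
        by (simp add: negligible_iff_null_sets null_sets_completion_iff)
      show "{x \<in> space lborel. \<not> (\<lambda>n. (?I (x - vn n) - ?I x) * dq g w n x) \<longlonglongrightarrow> 0} \<subseteq> cbox a b - box a b"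
      proof (safe, goal_cases)
        case (1 x)
        show ?case
        proof (rule ccontr)
          assume nx: "x \<notin> cbox a b"
          have "(\<lambda>n. x - vn n) \<longlonglongrightarrow> x - 0" by (intro tendsto_intros vn_lim)
          then have "\<forall>\<^sub>F n in sequentially. x - vn n \<in> - cbox a b"
            by (rule topological_tendstoD) (use nx in auto)
          then have "\<forall>\<^sub>F n in sequentially. (?I (x - vn n) - ?I x) * dq g w n x = 0"
            by eventually_elim (use nx in \<open>auto simp: indicator_def\<close>)
          from tendsto_eventually[OF this] 1 show False by simp
        qed
      next
        case (2 x)
        then have nx: "x \<in> cbox a b" using box_subset_cbox by blast
        have "(\<lambda>n. x - vn n) \<longlonglongrightarrow> x - 0" by (intro tendsto_intros vn_lim)
        then have "\<forall>\<^sub>F n in sequentially. x - vn n \<in> box a b"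
          by (rule topological_tendstoD) (use 2 in auto)
        then have "\<forall>\<^sub>F n in sequentially. (?I (x - vn n) - ?I x) * dq g w n x = 0"
          by eventually_elim (use nx box_subset_cbox in \<open>auto simp: indicator_def\<close>)
        from tendsto_eventually[OF this] 2 show False by simp
      qed
    qed
    then have lim2: "(\<lambda>n. \<integral>x. (?I (x - vn n) - ?I x) * dq g w n x \<partial>lborel) \<longlonglongrightarrow> (\<integral>x. 0 \<partial>(lborel::'a measure))"
    proof (rule integral_dominated_convergence[OF _ _ int_ball[of "2 * M" R], rotated 2])
      show "AE x in lborel. norm ((?I (x - vn n) - ?I x) * dq g w n x) \<le> 2 * M * indicator (cball 0 R) x" for n
      proof (rule AE_I2)
        fix x
        have "norm (?I (x - vn n) - ?I x) \<le> 2 * indicator (cball 0 R) x"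
        proof (cases "x \<in> cball 0 R")
          case False
          then have "norm x > R0 + norm v" by (simp add: R_def dist_norm)
          then have "norm (x - vn n) > R0" "norm x > R0"
            using vn_norm[of n] norm_triangle_ineq2[of x "vn n"] norm_ge_zero[of v] by linarith+
          then have "x - vn n \<notin> cbox a b" "x \<notin> cbox a b" using R0 by (auto simp: subset_iff)
          then show ?thesis by (simp add: indicator_def)
        qed (simp add: indicator_def)
        then have "norm (?I (x - vn n) - ?I x) * \<bar>dq g w n x\<bar> \<le> (2 * indicator (cball 0 R) x) * M"
          by (rule mult_mono) (use dq_M in auto)
        then show "norm ((?I (x - vn n) - ?I x) * dq g w n x) \<le> 2 * M * indicator (cball 0 R) x"
          by (simp add: abs_mult mult_ac)
      qed
    qed measurable
    have "(\<integral>x. ?I x * h x \<partial>lborel) = 0"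
      using LIMSEQ_unique[OF lim1] lim2 unfolding sh by simp
    then have "((\<lambda>x. ?I x * h x) has_integral 0) UNIV"
      using has_integral_integral_lborel[OF h_int] by simp
    then show ?thesis by (subst has_integral_restrict_UNIV[symmetric])
      (auto simp: indicator_def of_bool_def if_distrib[of "\<lambda>c. c * _"] cong: if_cong)
  qed
  show ?thesis
    by (intro exI[of _ "{x. h x \<noteq> 0}"] conjI negligible_if_box_integrals_0 box0)
       (auto simp: h_def D_def)
qed

text \<open>Countable, so the null sets belonging to all directions can be united; finite in every
  ball, so convergence is uniform over bounded directions; and dense at scale \<open>1 / m\<close>
  after division by \<open>m\<close>.\<close>

definition int_lattice :: "'a::euclidean_space set" where
  "int_lattice = {v. \<forall>i\<in>Basis. v \<bullet> i \<in> \<int>}"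

lemma int_lattice_add: "v \<in> int_lattice \<Longrightarrow> w \<in> int_lattice \<Longrightarrow> v + w \<in> int_lattice"
  unfolding int_lattice_def by (auto simp: inner_add_left)

lemma int_lattice_eq_image:
  "int_lattice \<inter> {v::'a::euclidean_space. norm v \<le> r} \<subseteq>
     (\<lambda>k. \<Sum>i\<in>Basis. of_int (k i) *\<^sub>R i) ` (Basis \<rightarrow>\<^sub>E {-\<lceil>r\<rceil>..\<lceil>r\<rceil>})"
proof
  fix v :: 'a assume v: "v \<in> int_lattice \<inter> {v. norm v \<le> r}"
  define k where "k = restrict (\<lambda>i. \<lfloor>v \<bullet> i\<rfloor>) Basis"
  have vi: "of_int (k i) = v \<bullet> i" if "i \<in> Basis" for i
    using v that unfolding int_lattice_def k_def by (auto elim!: Ints_cases)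
  have "v = (\<Sum>i\<in>Basis. of_int (k i) *\<^sub>R i)"
    using vi by (simp add: euclidean_representation cong: sum.cong)
  moreover have "k \<in> Basis \<rightarrow>\<^sub>E {-\<lceil>r\<rceil>..\<lceil>r\<rceil>}"
  proof
    fix i :: 'a assume i: "i \<in> Basis"
    then have "\<bar>of_int (k i)\<bar> \<le> r" using v vi[OF i] Basis_le_norm[OF i, of v] by auto
    then show "k i \<in> {-\<lceil>r\<rceil>..\<lceil>r\<rceil>}" by (auto; linarith)
  qed (simp add: k_def)
  ultimately show "v \<in> (\<lambda>k. \<Sum>i\<in>Basis. of_int (k i) *\<^sub>R i) ` (Basis \<rightarrow>\<^sub>E {-\<lceil>r\<rceil>..\<lceil>r\<rceil>})" by blast
qed

lemma finite_int_lattice_bounded: "finite (int_lattice \<inter> {v::'a::euclidean_space. norm v \<le> r})"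
  by (rule finite_subset[OF int_lattice_eq_image]) (intro finite_imageI finite_PiE, auto)

lemma countable_int_lattice: "countable (int_lattice :: 'a::euclidean_space set)"
proof -
  have "int_lattice \<subseteq> (\<Union>n::nat. int_lattice \<inter> {v::'a. norm v \<le> real n})"
    using real_arch_simple by blast
  moreover have "countable (\<Union>n::nat. int_lattice \<inter> {v::'a. norm v \<le> real n})"
    by (rule countable_UN) (auto intro!: countable_finite finite_int_lattice_bounded)
  ultimately show ?thesis by (rule countable_subset)
qed

lemma int_lattice_approx: "\<exists>v\<in>int_lattice. norm (h - v) \<le> DIM('a)" for h :: "'a::euclidean_space"
proof
  define v where "v = (\<Sum>i\<in>Basis. of_int \<lfloor>h \<bullet> i\<rfloor> *\<^sub>R i :: 'a)"
  have vi: "v \<bullet> i = of_int \<lfloor>h \<bullet> i\<rfloor>" if "i \<in> Basis" for i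
    unfolding v_def using that by simp
  show "v \<in> int_lattice" unfolding int_lattice_def using vi by auto
  have "norm (h - v) \<le> (\<Sum>i\<in>Basis. \<bar>(h - v) \<bullet> i\<bar>)" by (rule norm_le_l1)
  also have "\<dots> \<le> (\<Sum>i\<in>(Basis::'a set). 1)"
  proof (rule sum_mono)
    fix i :: 'a assume "i \<in> Basis"
    then show "\<bar>(h - v) \<bullet> i\<bar> \<le> 1" using vi by (simp add: inner_diff_left abs_le_iff) linarith
  qed
  finally show "norm (h - v) \<le> DIM('a)" by simp
qed

text \<open>Additivity yields homogeneity under integer factors by induction in both directions, and
  lattice points have integer coordinates.\<close>

lemma additive_on_int_lattice:
  fixes D :: "'a::euclidean_space \<Rightarrow> real"
  assumes add: "\<And>v w. v \<in> int_lattice \<Longrightarrow> w \<in> int_lattice \<Longrightarrow> D (v + w) = D v + D w"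
    and v: "v \<in> int_lattice"
  shows "D v = (\<Sum>i\<in>Basis. (v \<bullet> i) * D i)"
proof -
  have z: "0 \<in> (int_lattice :: 'a set)" unfolding int_lattice_def by auto
  have D0: "D 0 = 0" using add[OF z z] by simp
  have mi: "of_int m *\<^sub>R i \<in> int_lattice" if "i \<in> Basis" for m :: int and i :: 'a
    using that unfolding int_lattice_def by (auto simp: inner_Basis)
  have Dm: "D (of_int m *\<^sub>R i) = of_int m * D i" if i: "i \<in> Basis" for m :: int and i
  proof (induction m rule: int_induct[where k=0])
    case base show ?case using D0 by simp
  next
    case (step1 m)
    have "D (of_int (m + 1) *\<^sub>R i) = D (of_int m *\<^sub>R i + of_int 1 *\<^sub>R i)"
      by (simp add: scaleR_left_distrib)
    also have "\<dots> = D (of_int m *\<^sub>R i) + D (of_int 1 *\<^sub>R i)" by (rule add[OF mi mi]) (use i in auto)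
    finally show ?case using step1 by (simp add: algebra_simps)
  next
    case (step2 m)
    have "D (of_int m *\<^sub>R i) = D (of_int (m - 1) *\<^sub>R i + of_int 1 *\<^sub>R i)"
      by (simp add: scaleR_left_diff_distrib)
    also have "\<dots> = D (of_int (m - 1) *\<^sub>R i) + D (of_int 1 *\<^sub>R i)" by (rule add[OF mi mi]) (use i in auto)
    finally show ?case using step2 by (simp add: algebra_simps)
  qed
  have "(\<Sum>i\<in>F. (v \<bullet> i) *\<^sub>R i) \<in> int_lattice \<and> D (\<Sum>i\<in>F. (v \<bullet> i) *\<^sub>R i) = (\<Sum>i\<in>F. (v \<bullet> i) * D i)"
    if "finite F" "F \<subseteq> Basis" for F
    using that
  proof (induction F rule: finite_induct)
    case empty show ?case using D0 z by simp
  next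
    case (insert i F)
    then have i: "i \<in> Basis" by auto
    from v i obtain m where m: "v \<bullet> i = of_int m" unfolding int_lattice_def by (auto elim: Ints_cases)
    show ?case using insert mi[OF i, of m] Dm[OF i, of m] m
      by (simp add: add int_lattice_add)
  qed
  from this[of Basis] show ?thesis by (simp add: euclidean_representation)
qed

text \<open>
  A small increment \<open>k\<close> is compared with \<open>v / m\<close>, where \<open>m\<close> is about \<open>A / norm k\<close> for a large constant
  \<open>A\<close> and \<open>v\<close> is a lattice point close to \<open>m k\<close>; then \<open>v\<close> ranges over a finite set.
\<close>

lemma has_derivative_from_lattice_directions:
  fixes g :: "'a::euclidean_space \<Rightarrow> real"
  assumes lip: "\<And>x y. \<bar>g x - g y\<bar> \<le> L * norm (x - y)"
    and conv: "\<And>v. v \<in> int_lattice \<Longrightarrow> (\<lambda>n. dq g v n x) \<longlonglongrightarrow> D v"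
    and add: "\<And>v w. v \<in> int_lattice \<Longrightarrow> w \<in> int_lattice \<Longrightarrow> D (v + w) = D v + D w"
  shows "(g has_derivative (\<lambda>h. \<Sum>i\<in>Basis. (h \<bullet> i) * D i)) (at x)"
proof -
  define l where "l h = (\<Sum>i\<in>Basis. (h \<bullet> i) * D i)" for h :: 'a
  have bl: "bounded_linear l" unfolding l_def
    by (intro bounded_linear_sum bounded_linear_mult_left[THEN bounded_linear_compose]
        bounded_linear_inner_left)
  then interpret l: bounded_linear l .
  have Dl: "D v = l v" if "v \<in> int_lattice" for v
    unfolding l_def by (rule additive_on_int_lattice[OF add that])
  obtain B where B: "B > 0" "\<And>h. norm (l h) \<le> B * norm h"
    using l.pos_bounded by (auto simp: mult.commute)
  have L0: "L \<ge> 0"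
  proof -
    have "(SOME i. i \<in> Basis) \<in> (Basis :: 'a set)" by (rule some_in_eq[THEN iffD2]) simp
    then have "norm (SOME i. i \<in> (Basis :: 'a set)) = 1" by (rule norm_Basis)
    then show ?thesis using lip[of 0 "SOME i. i \<in> (Basis :: 'a set)"] by simp
  qed
  define s where "s = real DIM('a)"
  have s0: "s > 0" unfolding s_def by simp
  \<comment> \<open>Total error after multiplication by \<open>m\<close>: \<open>L * s\<close> and
    \<open>B * s\<close> for replacing \<open>m *\<^sub>R k\<close> by a lattice point in
    \<open>g\<close> and in \<open>l\<close>, and \<open>1\<close> for the convergence of the
    quotients.\<close>
  define C where "C = (L + B) * s + 1"
  have C0: "C > 0" unfolding C_def using L0 B s0 by (simp add: add_nonneg_pos)
  have "(g has_derivative l) (at x)"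
    unfolding has_derivative_at_alt
  proof (intro conjI allI impI bl)
    fix e :: real assume e: "e > 0"
    define A where "A = 2 * C / e + 2"
    have A: "A > 2" unfolding A_def using C0 e by simp
    have "\<forall>v\<in>int_lattice \<inter> {v. norm v \<le> A + s}. \<forall>\<^sub>F n in sequentially. \<bar>dq g v n x - l v\<bar> < 1"
    proof
      fix v :: 'a assume "v \<in> int_lattice \<inter> {v. norm v \<le> A + s}"
      then have "(\<lambda>n. dq g v n x) \<longlonglongrightarrow> l v" using conv Dl by auto
      then show "\<forall>\<^sub>F n in sequentially. \<bar>dq g v n x - l v\<bar> < 1"
        by (auto dest!: tendstoD[where e=1] simp: dist_real_def)
    qed
    then have "\<forall>\<^sub>F n in sequentially. \<forall>v\<in>int_lattice \<inter> {v. norm v \<le> A + s}. \<bar>dq g v n x - l v\<bar> < 1"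
      by (rule eventually_ball_finite[OF finite_int_lattice_bounded])
    then obtain n0 where n0: "\<And>n v. n \<ge> n0 \<Longrightarrow> v \<in> int_lattice \<Longrightarrow> norm v \<le> A + s \<Longrightarrow> \<bar>dq g v n x - l v\<bar> < 1"
      unfolding eventually_sequentially by auto
    \<comment> \<open>For increments shorter than \<open>d\<close> the quotient
      \<open>A / norm k\<close> exceeds \<open>n0 + 2\<close>, so the index \<open>m - 1\<close> is
      beyond the threshold \<open>n0\<close>.\<close>
    define d where "d = A / (real n0 + 2)"
    show "\<exists>d>0. \<forall>y. norm (y - x) < d \<longrightarrow> norm (g y - g x - l (y - x)) \<le> e * norm (y - x)"
    proof (intro exI[of _ d] conjI allI impI)
      show "d > 0" unfolding d_def using A by simp
      fix y assume y: "norm (y - x) < d"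
      show "norm (g y - g x - l (y - x)) \<le> e * norm (y - x)"
      proof (cases "y = x")
        case True then show ?thesis by (simp add: l.zero)
      next
        case False
        define k where "k = y - x"
        have k0: "norm k > 0" using False by (simp add: k_def)
        have kA: "A / norm k > real n0 + 2"
          using y k0 unfolding d_def k_def by (simp add: field_simps)
        define m where "m = nat \<lfloor>A / norm k\<rfloor>"
        have m1: "real m \<le> A / norm k" "A / norm k < real m + 1"
          unfolding m_def using kA by linarith+
        have mn: "m > n0 + 1" using m1 kA by linarith
        \<comment> \<open>The quotient \<open>dq\<close> with index \<open>n\<close> has step
          \<open>1 / (n + 1)\<close>, which is \<open>1 / m\<close>.\<close>
        define n where "n = m - 1"
        have mS: "m = Suc n" unfolding n_def using mn by simp
        have nn0: "n \<ge> n0" unfolding n_def using mn by simp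
        have m0: "real m > 0" using mn by simp
        have "A / norm k \<le> 2 * real m" using m1 mn by linarith
        then have invm: "1 / real m \<le> 2 * norm k / A"
          using m0 A k0 by (simp add: field_simps)
        obtain v where v: "v \<in> int_lattice" "norm (real m *\<^sub>R k - v) \<le> s"
          using int_lattice_approx[of "real m *\<^sub>R k"] unfolding s_def by blast
        have "norm (real m *\<^sub>R k) \<le> A" using m1(1) k0 by (simp add: field_simps)
        then have "norm v \<le> A + s" using v(2) norm_triangle_ineq3[of "real m *\<^sub>R k" v] by linarith
        then have 1: "\<bar>dq g v n x - l v\<bar> < 1" using n0 nn0 v(1) by blast
        have dq: "dq g v n x = real m * (g (x + v /\<^sub>R real m) - g x)" unfolding dq_def mS ..
        have 2: "\<bar>real m * g (x + k) - real m * g (x + v /\<^sub>R real m)\<bar> \<le> L * s"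
        proof -
          have "\<bar>real m * g (x + k) - real m * g (x + v /\<^sub>R real m)\<bar> = real m * \<bar>g (x + k) - g (x + v /\<^sub>R real m)\<bar>"
            using m0 by (simp add: right_diff_distrib[symmetric] abs_mult)
          also have "\<dots> \<le> real m * (L * norm ((x + k) - (x + v /\<^sub>R real m)))"
            by (intro mult_left_mono lip) simp
          also have "\<dots> = L * norm (real m *\<^sub>R ((x + k) - (x + v /\<^sub>R real m)))"
            using m0 by simp
          also have "real m *\<^sub>R ((x + k) - (x + v /\<^sub>R real m)) = real m *\<^sub>R k - v"
            using m0 by (simp add: scaleR_right_diff_distrib)
          also have "L * norm (real m *\<^sub>R k - v) \<le> L * s" using v(2) L0 by (rule mult_left_mono)
          finally show ?thesis .
        qed
        have 3: "\<bar>l v - real m * l k\<bar> \<le> B * s"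
        proof -
          have "\<bar>l v - real m * l k\<bar> = norm (l (real m *\<^sub>R k - v))" by (simp add: l.diff l.scaleR)
          also have "\<dots> \<le> B * norm (real m *\<^sub>R k - v)" by (rule B(2))
          also have "\<dots> \<le> B * s" using v(2) B(1) by (intro mult_left_mono) auto
          finally show ?thesis .
        qed
        have "real m * \<bar>g (x + k) - g x - l k\<bar> = \<bar>real m * (g (x + k) - g x - l k)\<bar>"
          using m0 by (simp add: abs_mult)
        also have "\<dots> = \<bar>(real m * g (x + k) - real m * g (x + v /\<^sub>R real m)) + (dq g v n x - l v) + (l v - real m * l k)\<bar>"
          unfolding dq by (simp add: algebra_simps)
        also have "\<dots> \<le> L * s + 1 + B * s" using 1 2 3 by linarith
        also have "\<dots> = C" unfolding C_def by (simp add: algebra_simps)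
        finally have "\<bar>g (x + k) - g x - l k\<bar> \<le> C * (1 / real m)" using m0 by (simp add: field_simps)
        also have "\<dots> \<le> C * (2 * norm k / A)" using invm C0 by (intro mult_left_mono) auto
        also have "\<dots> = (2 * C / A) * norm k" by simp
        also have "\<dots> \<le> e * norm k"
        proof (rule mult_right_mono)
          have "2 * C \<le> e * A" unfolding A_def using e by (simp add: field_simps)
          then show "2 * C / A \<le> e" using A by (simp add: field_simps)
        qed simp
        finally show ?thesis unfolding k_def by simp
      qed
    qed
  qed
  then show ?thesis unfolding l_def .
qed

text \<open>The exceptional set is a countable union, over lattice directions for the existence of
  the limits and over pairs of them for additivity. Outside it the lattice directions already
  determine a derivative.\<close>

theorem Rademacher_real:
  fixes g :: "'a::euclidean_space \<Rightarrow> real"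
  assumes lip: "\<And>x y. \<bar>g x - g y\<bar> \<le> L * norm (x - y)"
  obtains N where "negligible N" "\<And>x. x \<notin> N \<Longrightarrow> g differentiable (at x)"
proof -
  let ?Z = "int_lattice :: 'a set"
  have "\<exists>N. negligible N \<and> (\<forall>x. x \<notin> N \<longrightarrow> convergent (\<lambda>n. dq g v n x))" for v
  proof -
    have "AE x in lborel. convergent (\<lambda>n. dq g v n x)"
      using lipschitz_directional_quotient_convergent[OF lip, of v] unfolding dq_def .
    then obtain N where "{x \<in> space lborel. \<not> convergent (\<lambda>n. dq g v n x)} \<subseteq> N" "emeasure lborel N = 0" "N \<in> sets lborel"
      by (rule AE_E)
    then show ?thesis
      by (intro exI[of _ N]) (auto simp: negligible_iff_null_sets null_sets_completion_iff null_sets_def)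
  qed
  then obtain N1 where N1: "\<And>v. negligible (N1 v)" "\<And>v x. x \<notin> N1 v \<Longrightarrow> convergent (\<lambda>n. dq g v n x)"
    by metis
  have "\<forall>v w. \<exists>N. negligible N \<and> (\<forall>x. x \<notin> N \<longrightarrow> lim (\<lambda>n. dq g (v + w) n x) = lim (\<lambda>n. dq g v n x) + lim (\<lambda>n. dq g w n x))"
    using directional_limits_additive[OF lip] by simp
  then obtain N2 where N2: "\<And>v w. negligible (N2 v w)" "\<And>v w x. x \<notin> N2 v w \<Longrightarrow>
      lim (\<lambda>n. dq g (v + w) n x) = lim (\<lambda>n. dq g v n x) + lim (\<lambda>n. dq g w n x)"
    by metis
  define N where "N = (\<Union>v\<in>?Z. N1 v) \<union> (\<Union>p\<in>?Z \<times> ?Z. N2 (fst p) (snd p))"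
  show ?thesis
  proof
    have c: "countable (N1 ` ?Z)" "countable ((\<lambda>p. N2 (fst p) (snd p)) ` (?Z \<times> ?Z))"
      using countable_int_lattice[where 'a='a] by auto
    show "negligible N" unfolding N_def
      by (intro negligible_Un negligible_countable_Union c) (use N1 N2 in auto)
    fix x assume x: "x \<notin> N"
    have "(g has_derivative (\<lambda>h. \<Sum>i\<in>Basis. (h \<bullet> i) * lim (\<lambda>n. dq g i n x))) (at x)"
    proof (rule has_derivative_from_lattice_directions[OF lip, where D="\<lambda>v. lim (\<lambda>n. dq g v n x)"])
      fix v :: 'a assume "v \<in> ?Z"
      then have "x \<notin> N1 v" using x unfolding N_def by blast
      then show "(\<lambda>n. dq g v n x) \<longlonglongrightarrow> lim (\<lambda>n. dq g v n x)"
        using N1(2) convergent_LIMSEQ_iff by blast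
    next
      fix v w :: 'a assume "v \<in> ?Z" "w \<in> ?Z"
      then have "x \<notin> N2 v w" using x unfolding N_def by force
      then show "lim (\<lambda>n. dq g (v + w) n x) = lim (\<lambda>n. dq g v n x) + lim (\<lambda>n. dq g w n x)"
        by (rule N2(2))
    qed
    then show "g differentiable (at x)" unfolding differentiable_def by blast
  qed
qed

corollary Rademacher_euclidean:
  fixes J :: "'a::euclidean_space \<Rightarrow> 'b::euclidean_space"
  assumes lip: "\<And>x y. norm (J x - J y) \<le> L * norm (x - y)"
  obtains N where "negligible N" "\<And>x. x \<notin> N \<Longrightarrow> J differentiable (at x)"
proof -
  have "\<exists>N. negligible N \<and> (\<forall>x. x \<notin> N \<longrightarrow> (\<lambda>x. J x \<bullet> i) differentiable (at x))" if "i \<in> Basis" for i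
  proof -
    have "\<bar>J x \<bullet> i - J y \<bullet> i\<bar> \<le> L * norm (x - y)" for x y
      using Basis_le_norm[OF that, of "J x - J y"] lip[of x y] by (simp add: inner_diff_left)
    from Rademacher_real[OF this] show ?thesis by metis
  qed
  then obtain N where N: "\<And>i. i \<in> Basis \<Longrightarrow> negligible (N i)"
    "\<And>i x. i \<in> Basis \<Longrightarrow> x \<notin> N i \<Longrightarrow> (\<lambda>x. J x \<bullet> i) differentiable (at x)" by metis
  show ?thesis
  proof
    show "negligible (\<Union>i\<in>Basis. N i)" using N(1) by (intro negligible_Union) auto
    show "J differentiable (at x)" if "x \<notin> (\<Union>i\<in>Basis. N i)" for x
      using that N(2) by (subst differentiable_componentwise_within) auto
  qed
qed

section \<open>Second-order expansions of convex functions\<close>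

text \<open>This replaces integrating a derivative, as \<open>\<phi>\<close> need not be
  differentiable. After subtraction of the expected parabola, the subgradient inequalities at both
  ends of a subinterval bound the increment by its length times \<open>e\<close>, up to an error
  quadratic in the length; summing over \<open>n\<close> equal pieces and letting \<open>n\<close>
  grow removes that error.\<close>

lemma quadratic_expansion_of_slopes:
  fixes \<phi> \<sigma> :: "real \<Rightarrow> real"
  assumes sub: "\<And>t t'. t \<in> {0..1} \<Longrightarrow> t' \<in> {0..1} \<Longrightarrow> \<phi> t' \<ge> \<phi> t + \<sigma> t * (t' - t)"
    and app: "\<And>t. t \<in> {0..1} \<Longrightarrow> \<bar>\<sigma> t - p - t * a\<bar> \<le> e"
  shows "\<bar>\<phi> 1 - \<phi> 0 - p - a / 2\<bar> \<le> e"
proof -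
  define G where "G t = \<phi> t - p * t - a * t\<^sup>2 / 2" for t
  have step: "\<bar>G t' - G t\<bar> \<le> (t' - t) * (e + \<bar>a\<bar> * (t' - t) / 2)"
    if t: "0 \<le> t" "t \<le> t'" "t' \<le> 1" for t t'
  proof -
    have sq: "t'\<^sup>2 - t\<^sup>2 = (t' - t) * (t' + t)" by (simp add: algebra_simps power2_eq_square)
    have up: "G t' - G t \<le> (t' - t) * (\<sigma> t' - p - t' * a + a * (t' - t) / 2)"
    proof -
      have "G t' - G t = \<phi> t' - \<phi> t - p * (t' - t) - a * (t'\<^sup>2 - t\<^sup>2) / 2"
        unfolding G_def by (simp add: algebra_simps diff_divide_distrib)
      also have "\<dots> \<le> \<sigma> t' * (t' - t) - p * (t' - t) - a * (t'\<^sup>2 - t\<^sup>2) / 2"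
        using sub[of t' t] t by (simp add: algebra_simps)
      also have "\<dots> = (t' - t) * (\<sigma> t' - p - t' * a + a * (t' - t) / 2)"
        unfolding sq by (simp add: field_simps)
      finally show ?thesis .
    qed
    have lo: "G t' - G t \<ge> (t' - t) * (\<sigma> t - p - t * a - a * (t' - t) / 2)"
    proof -
      have "(t' - t) * (\<sigma> t - p - t * a - a * (t' - t) / 2) = \<sigma> t * (t' - t) - p * (t' - t) - a * (t'\<^sup>2 - t\<^sup>2) / 2"
        unfolding sq by (simp add: field_simps)
      also have "\<dots> \<le> \<phi> t' - \<phi> t - p * (t' - t) - a * (t'\<^sup>2 - t\<^sup>2) / 2"
        using sub[of t t'] t by (simp add: algebra_simps)
      also have "\<dots> = G t' - G t"
        unfolding G_def by (simp add: algebra_simps diff_divide_distrib)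
      finally show ?thesis .
    qed
    have ab: "a * (t' - t) \<le> \<bar>a\<bar> * (t' - t)" "- (a * (t' - t)) \<le> \<bar>a\<bar> * (t' - t)"
      using t mult_right_mono[of a "\<bar>a\<bar>" "t' - t"] mult_right_mono[of "-a" "\<bar>a\<bar>" "t' - t"] by auto
    have "(t' - t) * (\<sigma> t' - p - t' * a + a * (t' - t) / 2) \<le> (t' - t) * (e + \<bar>a\<bar> * (t' - t) / 2)"
      by (rule mult_left_mono) (use app[of t'] ab t in auto)
    moreover have "(t' - t) * (- (e + \<bar>a\<bar> * (t' - t) / 2)) \<le> (t' - t) * (\<sigma> t - p - t * a - a * (t' - t) / 2)"
      by (rule mult_left_mono) (use app[of t] ab t in auto)
    ultimately show ?thesis using up lo unfolding abs_le_iff mult_minus_right by simp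
  qed
  have n_bd: "\<bar>G 1 - G 0\<bar> \<le> e + \<bar>a\<bar> / (2 * real n)" if n: "n > 0" for n :: nat
  proof -
    have "G 1 - G 0 = (\<Sum>i<n. G (real (Suc i) / real n) - G (real i / real n))"
      using n by (subst sum_lessThan_telescope[of "\<lambda>i. G (real i / real n)"]) simp
    also have "\<bar>\<dots>\<bar> \<le> (\<Sum>i<n. \<bar>G (real (Suc i) / real n) - G (real i / real n)\<bar>)" by (rule sum_abs)
    also have "\<dots> \<le> (\<Sum>i<n. (1 / real n) * (e + \<bar>a\<bar> * (1 / real n) / 2))"
    proof (rule sum_mono)
      fix i assume i: "i \<in> {..<n}"
      have "real (Suc i) / real n - real i / real n = 1 / real n"
        by (simp add: diff_divide_distrib[symmetric])
      then show "\<bar>G (real (Suc i) / real n) - G (real i / real n)\<bar> \<le> (1 / real n) * (e + \<bar>a\<bar> * (1 / real n) / 2)"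
        using step[of "real i / real n" "real (Suc i) / real n"] i n by (simp add: divide_right_mono)
    qed
    also have "\<dots> = e + \<bar>a\<bar> / (2 * real n)" using n by (simp add: field_simps)
    finally show ?thesis .
  qed
  have "\<bar>G 1 - G 0\<bar> \<le> e"
  proof (rule LIMSEQ_le_const)
    have "(\<lambda>n. e + \<bar>a\<bar> / 2 * inverse (real (Suc n))) \<longlonglongrightarrow> e + \<bar>a\<bar> / 2 * 0"
      by (intro tendsto_intros LIMSEQ_inverse_real_of_nat)
    then show "(\<lambda>n. e + \<bar>a\<bar> / 2 * inverse (real (Suc n))) \<longlonglongrightarrow> e" by simp
    show "\<exists>N. \<forall>n\<ge>N. \<bar>G 1 - G 0\<bar> \<le> e + \<bar>a\<bar> / 2 * inverse (real (Suc n))"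
    proof (intro exI allI impI)
      fix n show "\<bar>G 1 - G 0\<bar> \<le> e + \<bar>a\<bar> / 2 * inverse (real (Suc n))"
        using n_bd[of "Suc n"] by (simp add: field_simps)
    qed
  qed
  moreover have "G 1 - G 0 = \<phi> 1 - \<phi> 0 - p - a / 2" unfolding G_def by simp
  ultimately show ?thesis by simp
qed

definition subgradient :: "('a::real_inner \<Rightarrow> real) \<Rightarrow> 'a \<Rightarrow> 'a \<Rightarrow> bool" where
  "subgradient f z s \<longleftrightarrow> (\<forall>x. f z + s \<bullet> (x - z) \<le> f x)"

lemma subgradientD: "subgradient f z s \<Longrightarrow> f z + s \<bullet> (x - z) \<le> f x"
  unfolding subgradient_def by blast

lemma subgradient_monotone:
  assumes "subgradient f z1 s1" "subgradient f z2 s2"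
  shows "(s1 - s2) \<bullet> (z1 - z2) \<ge> 0"
  using subgradientD[OF assms(1), of z2] subgradientD[OF assms(2), of z1]
  by (simp add: inner_diff_left inner_diff_right)

lemma subdifferentiable_convex:
  fixes f :: "'a::real_inner \<Rightarrow> real"
  assumes "\<And>z. \<exists>s. subgradient f z s"
  shows "convex_on UNIV f"
proof (rule convex_onI)
  fix t :: real and x y :: 'a assume t: "0 < t" "t < 1"
  define z where "z = (1 - t) *\<^sub>R x + t *\<^sub>R y"
  obtain s where s: "subgradient f z s" using assms by blast
  have "(1 - t) * (f z + s \<bullet> (x - z)) + t * (f z + s \<bullet> (y - z)) \<le> (1 - t) * f x + t * f y"
    by (intro add_mono mult_left_mono subgradientD[OF s]) (use t in auto)
  moreover have "(1 - t) * (f z + s \<bullet> (x - z)) + t * (f z + s \<bullet> (y - z))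
      = f z + s \<bullet> ((1 - t) *\<^sub>R (x - z) + t *\<^sub>R (y - z))"
    by (simp add: inner_add_right algebra_simps)
  moreover have "(1 - t) *\<^sub>R (x - z) + t *\<^sub>R (y - z) = 0"
    unfolding z_def by (simp add: algebra_simps)
  ultimately show "f ((1 - t) *\<^sub>R x + t *\<^sub>R y) \<le> (1 - t) * f x + t * f y" unfolding z_def by simp
qed simp

text \<open>A minimum point of \<open>f z + (norm (z - y))\<^sup>2 / 2\<close> has
  \<open>y - z\<close> as a subgradient. The minimum exists because a subgradient \<open>s\<close>
  at \<open>y\<close> makes every point farther than \<open>2 * norm s\<close> from \<open>y\<close>
  no better than \<open>y\<close>.\<close>

lemma resolvent_exists:
  fixes f :: "'a::euclidean_space \<Rightarrow> real"
  assumes sd: "\<And>z. \<exists>s. subgradient f z s"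
  shows "\<exists>z. subgradient f z (y - z)"
proof -
  have cvx: "convex_on UNIV f" by (rule subdifferentiable_convex[OF sd])
  have cont: "continuous_on UNIV f" by (rule convex_on_continuous[OF open_UNIV cvx])
  define F where "F z = f z + (norm (z - y))\<^sup>2 / 2" for z
  obtain s where s: "subgradient f y s" using sd by blast
  have "continuous_on (cball y (2 * norm s)) F" unfolding F_def
    by (intro continuous_intros continuous_on_subset[OF cont]) auto
  then obtain z where z: "z \<in> cball y (2 * norm s)" "\<And>w. w \<in> cball y (2 * norm s) \<Longrightarrow> F z \<le> F w"
    using continuous_attains_inf[of "cball y (2 * norm s)" F] by auto
  have min: "F z \<le> F w" for w
  proof (cases "w \<in> cball y (2 * norm s)")
    case False
    then have far: "norm (w - y) \<ge> 2 * norm s" by (simp add: dist_norm norm_minus_commute)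
    have "F z \<le> F y" using z(2)[of y] by simp
    also have "F y = f y" unfolding F_def by simp
    also have "\<dots> \<le> f y - norm s * norm (w - y) + (norm (w - y))\<^sup>2 / 2"
      using mult_right_mono[OF far, of "norm (w - y)"] by (simp add: power2_eq_square)
    also have "\<dots> \<le> f y + s \<bullet> (w - y) + (norm (w - y))\<^sup>2 / 2"
      using Cauchy_Schwarz_ineq2[of s "w - y"] by linarith
    also have "\<dots> \<le> F w" unfolding F_def using subgradientD[OF s, of w] by simp
    finally show ?thesis .
  qed (rule z(2))
  have "f z + (y - z) \<bullet> (x - z) \<le> f x" for x
  proof -
    define h where "h = x - z"
    \<comment> \<open>Minimality is tested on the segment towards \<open>x\<close>; convexity bounds
      \<open>f\<close> there, and division by \<open>t\<close> leaves an error that vanishes with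
      \<open>t\<close>.\<close>
    have t_bd: "0 \<le> f x - f z - (y - z) \<bullet> h + t * ((norm h)\<^sup>2 / 2)" if t: "0 < t" "t \<le> 1" for t
    proof -
      have "f (z + t *\<^sub>R h) = f ((1 - t) *\<^sub>R z + t *\<^sub>R x)" unfolding h_def by (simp add: algebra_simps)
      also have "\<dots> \<le> (1 - t) * f z + t * f x"
        using convex_onD[OF cvx, of t z x] t by simp
      finally have 1: "f (z + t *\<^sub>R h) \<le> (1 - t) * f z + t * f x" .
      have 2: "(norm (z + t *\<^sub>R h - y))\<^sup>2 = (norm (z - y))\<^sup>2 + 2 * t * (h \<bullet> (z - y)) + t\<^sup>2 * (norm h)\<^sup>2"
        unfolding power2_norm_eq_inner
        by (simp add: inner_add_left inner_add_right inner_diff_left inner_diff_right inner_commute power2_eq_square algebra_simps)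
      have "F z \<le> F (z + t *\<^sub>R h)" by (rule min)
      then have "0 \<le> t * (f x - f z) + t * (h \<bullet> (z - y)) + t\<^sup>2 * (norm h)\<^sup>2 / 2"
        unfolding F_def 2 using 1 by (simp add: algebra_simps add_divide_distrib diff_divide_distrib)
      also have "\<dots> = t * (f x - f z - (y - z) \<bullet> h + t * ((norm h)\<^sup>2 / 2))"
        by (simp add: inner_diff_left inner_diff_right inner_commute power2_eq_square algebra_simps)
      finally show ?thesis using t by (simp add: zero_le_mult_iff)
    qed
    have "0 \<le> f x - f z - (y - z) \<bullet> h"
    proof (rule LIMSEQ_le_const)
      have "(\<lambda>n. f x - f z - (y - z) \<bullet> h + inverse (real (Suc n)) * ((norm h)\<^sup>2 / 2)) \<longlonglongrightarrow> f x - f z - (y - z) \<bullet> h + 0 * ((norm h)\<^sup>2 / 2)"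
        by (intro tendsto_intros LIMSEQ_inverse_real_of_nat)
      then show "(\<lambda>n. f x - f z - (y - z) \<bullet> h + inverse (real (Suc n)) * ((norm h)\<^sup>2 / 2)) \<longlonglongrightarrow> f x - f z - (y - z) \<bullet> h" by simp
      show "\<exists>N. \<forall>n\<ge>N. 0 \<le> f x - f z - (y - z) \<bullet> h + inverse (real (Suc n)) * ((norm h)\<^sup>2 / 2)"
        by (intro exI[of _ 0] allI impI t_bd) (auto simp: inverse_le_1_iff)
    qed
    then show ?thesis unfolding h_def by simp
  qed
  then show ?thesis unfolding subgradient_def by blast
qed

text \<open>A paraboloid above and a supporting plane below meet at \<open>z\<close>. Moving in the
  direction \<open>s - P\<close> with a step \<open>t\<close> satisfying \<open>C * t < 1\<close>
  separates them unless the slopes agree.\<close>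

lemma quadratic_bound_subgradient:
  fixes f :: "'a::real_inner \<Rightarrow> real"
  assumes touch: "\<And>h. f (z + h) \<le> f z + P \<bullet> h + C * (norm h)\<^sup>2" and s: "subgradient f z s" and C: "C \<ge> 0"
  shows "s = P"
proof (rule ccontr)
  assume "s \<noteq> P"
  define q where "q = s - P"
  have q: "q \<bullet> q > 0" using \<open>s \<noteq> P\<close> unfolding q_def by simp
  define t where "t = 1 / (C + 1)"
  have t: "t > 0" "C * t < 1" unfolding t_def using C by (auto simp: field_simps)
  have "f z + s \<bullet> (t *\<^sub>R q) \<le> f z + P \<bullet> (t *\<^sub>R q) + C * (norm (t *\<^sub>R q))\<^sup>2"
    using subgradientD[OF s, of "z + t *\<^sub>R q"] touch[of "t *\<^sub>R q"] by simp
  then have "q \<bullet> (t *\<^sub>R q) \<le> C * (norm (t *\<^sub>R q))\<^sup>2" unfolding q_def by (simp add: inner_diff_left right_diff_distrib)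
  then have "t * (q \<bullet> q) \<le> (C * t) * (t * (q \<bullet> q))"
    unfolding power2_norm_eq_inner by (simp add: mult_ac)
  moreover have "t * (q \<bullet> q) > 0" using t q by simp
  ultimately show False using t(2) by (simp add: mult_le_cancel_right1)
qed

text \<open>The plane at \<open>z + h\<close> is tested at \<open>z + h + e\<close>, where
  \<open>e\<close> points along \<open>s - P\<close> and has the length of \<open>h\<close>. The
  paraboloid there costs at most \<open>C * (2 * norm h)\<^sup>2\<close>, whence the factor
  \<open>4\<close>.\<close>

lemma quadratic_bound_nearby_subgradient:
  fixes f :: "'a::real_inner \<Rightarrow> real"
  assumes touch: "\<And>h. f (z + h) \<le> f z + P \<bullet> h + C * (norm h)\<^sup>2" and s: "subgradient f (z + h) s"
    and P: "subgradient f z P" and C: "C \<ge> 0"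
  shows "norm (s - P) \<le> 4 * C * norm h"
proof (cases "h = 0 \<or> s = P")
  case True
  then show ?thesis using quadratic_bound_subgradient[OF touch _ C, of s] s C by auto
next
  case False
  define q where "q = s - P"
  have q: "norm q > 0" and h: "norm h > 0" using False unfolding q_def by auto
  define e where "e = (norm h / norm q) *\<^sub>R q"
  have ne: "norm e = norm h" unfolding e_def using q by simp
  have "f z + P \<bullet> h + s \<bullet> e \<le> f z + P \<bullet> (h + e) + C * (norm (h + e))\<^sup>2"
    using subgradientD[OF s, of "z + (h + e)"] subgradientD[OF P, of "z + h"] touch[of "h + e"] by simp
  then have "q \<bullet> e \<le> C * (norm (h + e))\<^sup>2" unfolding q_def by (simp add: inner_diff_left inner_add_right)
  also have "\<dots> \<le> C * (2 * norm h)\<^sup>2"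
    using norm_triangle_ineq[of h e] ne C by (intro mult_left_mono power_mono) auto
  finally have "norm q * norm h \<le> (4 * C * norm h) * norm h"
    using q unfolding e_def by (simp add: power2_norm_eq_inner[symmetric] power2_eq_square mult_ac)
  then show ?thesis using h unfolding q_def by simp
qed

text \<open>
  The resolvent \<open>J\<close> of the subdifferential is nonexpansive, hence differentiable almost
  everywhere.  Where \<open>f\<close> is touched from above by a paraboloid, subgradients are controlled
  linearly, so the derivative of \<open>J\<close> is automatically injective there and can be inverted to
  differentiate the subgradient map; no Sard-type argument is required.
\<close>

theorem Alexandrov_at_touched_points:
  fixes f :: "'a::euclidean_space \<Rightarrow> real"
  assumes sd: "\<And>z. \<exists>s. subgradient f z s"
  obtains N where "negligible N"
    "\<And>z P C. z \<notin> N \<Longrightarrow> 0 \<le> C \<Longrightarrow> (\<And>h. f (z + h) \<le> f z + P \<bullet> h + C * (norm h)\<^sup>2) \<Longrightarrow>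
      \<exists>A. linear A \<and> (\<forall>e>0. \<exists>d>0. \<forall>h. norm h < d \<longrightarrow>
        \<bar>f (z + h) - f z - P \<bullet> h - (A h \<bullet> h) / 2\<bar> \<le> e * (norm h)\<^sup>2)"
proof -
  define J where "J y = (SOME z. subgradient f z (y - z))" for y
  have J: "subgradient f (J y) (y - J y)" for y
    unfolding J_def by (rule someI_ex[OF resolvent_exists[OF sd]])
  have J_ne: "norm (z1 - z2) \<le> norm (y1 - y2)"
    if "subgradient f z1 (y1 - z1)" "subgradient f z2 (y2 - z2)" for z1 z2 y1 y2
  proof -
    have "((y1 - z1) - (y2 - z2)) \<bullet> (z1 - z2) \<ge> 0" by (rule subgradient_monotone[OF that])
    then have "(norm (z1 - z2))\<^sup>2 \<le> (y1 - y2) \<bullet> (z1 - z2)"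
      unfolding power2_norm_eq_inner by (simp add: algebra_simps inner_diff_left inner_diff_right)
    also have "\<dots> \<le> norm (y1 - y2) * norm (z1 - z2)" by (rule norm_cauchy_schwarz)
    finally show ?thesis by (cases "norm (z1 - z2) = 0") (auto simp: power2_eq_square)
  qed
  have J_unique: "J y = z" if "subgradient f z (y - z)" for y z
    using J_ne[OF J[of y] that] by simp
  have J_lip: "norm (J x - J y) \<le> 1 * norm (x - y)" for x y
    using J_ne[OF J J] by simp
  obtain N0 where N0: "negligible N0" "\<And>y. y \<notin> N0 \<Longrightarrow> J differentiable (at y)"
    using Rademacher_euclidean[OF J_lip] by blast
  show ?thesis
  proof
    show "negligible (J ` N0)"
    proof (rule negligible_locally_Lipschitz_image[OF _ N0(1)])
      show "\<exists>T B. open T \<and> x \<in> T \<and> (\<forall>y\<in>N0 \<inter> T. norm (J y - J x) \<le> B * norm (y - x))" for x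
        using J_lip by (intro exI[of _ UNIV] exI[of _ 1]) auto
    qed simp
    fix z P :: 'a and C :: real
    assume zN: "z \<notin> J ` N0" and C: "0 \<le> C"
      and touch: "\<And>h. f (z + h) \<le> f z + P \<bullet> h + C * (norm h)\<^sup>2"
    have P: "subgradient f z P"
      using sd[of z] quadratic_bound_subgradient[OF touch _ C] by blast
    \<comment> \<open>The point whose resolvent is \<open>z\<close>, since \<open>P\<close> is the
      subgradient there; \<open>z\<close> avoids the image of the exceptional set, so
      \<open>J\<close> is differentiable at \<open>y\<close>.\<close>
    define y where "y = z + P"
    have Jy: "J y = z" by (rule J_unique) (simp add: y_def P)
    have "J differentiable (at y)" using N0(2) zN Jy by blast
    then obtain J' where J': "(J has_derivative J') (at y)" unfolding differentiable_def by blast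
    then interpret J': bounded_linear J' by (rule has_derivative_bounded_linear)
    define c where "c = 1 + 4 * C"
    have c: "c \<ge> 1" unfolding c_def using C by simp
    \<comment> \<open>A lower bound for the increments of \<open>J\<close>: an increment of its
      argument is one of the base point plus one of the subgradient, and the latter is at most
      \<open>4 * C\<close> times the former.\<close>
    have expand: "norm k \<le> c * norm (J (y + k) - z)" for k
    proof -
      define h where "h = J (y + k) - z"
      have s: "subgradient f (z + h) (y + k - J (y + k))" unfolding h_def using J by simp
      have k: "k = h + ((y + k - J (y + k)) - P)" unfolding h_def y_def by simp
      have "norm k \<le> norm h + norm ((y + k - J (y + k)) - P)" by (subst k) (rule norm_triangle_ineq)
      also have "\<dots> \<le> norm h + 4 * C * norm h"
        using quadratic_bound_nearby_subgradient[OF touch s P C] by simp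
      finally show ?thesis unfolding c_def h_def by (simp add: algebra_simps)
    qed
    have deriv: "\<exists>d>0. \<forall>k. norm k < d \<longrightarrow> norm (J (y + k) - z - J' k) \<le> e * norm k" if "e > 0" for e
    proof -
      obtain d where "d > 0" "\<And>w. norm (w - y) < d \<Longrightarrow> norm (J w - J y - J' (w - y)) \<le> e * norm (w - y)"
        using J' \<open>e > 0\<close> unfolding has_derivative_at_alt by blast
      then show ?thesis using Jy by (intro exI[of _ d]) (metis add_diff_cancel_left')
    qed
    have "inj J'"
    proof (rule linear_injective_0[OF J'.linear, THEN iffD2], intro allI impI, rule ccontr)
      fix k assume k: "J' k = 0" "k \<noteq> 0"
      obtain d where d: "d > 0" "\<And>k. norm k < d \<Longrightarrow> norm (J (y + k) - z - J' k) \<le> 1 / (2 * c) * norm k"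
        using deriv[of "1 / (2 * c)"] c by auto
      define t where "t = d / (2 * norm k)"
      have t: "t > 0" "norm (t *\<^sub>R k) < d" unfolding t_def using d k by (auto simp: field_simps)
      have "norm (J (y + t *\<^sub>R k) - z) \<le> 1 / (2 * c) * norm (t *\<^sub>R k)"
        using d(2)[OF t(2)] k by (simp add: J'.scaleR)
      then have "c * norm (J (y + t *\<^sub>R k) - z) \<le> c * (1 / (2 * c) * norm (t *\<^sub>R k))"
        using c by (intro mult_left_mono) auto
      also have "\<dots> = norm (t *\<^sub>R k) / 2" using c by simp
      finally have "norm (t *\<^sub>R k) \<le> norm (t *\<^sub>R k) / 2" using expand[of "t *\<^sub>R k"] by linarith
      then show False using t k by simp
    qed
    then obtain B where B: "linear B" "B \<circ> J' = id"
      using linear_injective_left_inverse[OF J'.linear] by blast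
    have BJ: "B (J' k) = k" for k using B(2) by (metis comp_apply id_apply)
    interpret B: bounded_linear B using B(1) by (simp add: linear_conv_bounded_linear)
    obtain b where b: "b > 0" "\<And>h. norm (B h) \<le> b * norm h"
      using B.pos_bounded by (auto simp: mult.commute)
    \<comment> \<open>The subgradient map is the inverse of \<open>J\<close> minus the identity, so
      its derivative is the inverse of \<open>J'\<close> minus the identity.\<close>
    define A where "A h = B h - h" for h
    have linA: "linear A" unfolding A_def by (intro linear_compose_sub B(1) linear_id[unfolded id_def])
    interpret A: bounded_linear A using linA by (simp add: linear_conv_bounded_linear)
    \<comment> \<open>The expansion holds for every choice of subgradients near \<open>z\<close>, so
      no continuity of a selection enters the integration along segments.\<close>
    have grad: "\<exists>d>0. \<forall>h s. norm h < d \<longrightarrow> subgradient f (z + h) s \<longrightarrow> norm (s - P - A h) \<le> e * norm h"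
      if e: "e > 0" for e
    proof -
      define e' where "e' = e / (b * c)"
      have e': "e' > 0" unfolding e'_def using e b c by simp
      obtain d where d: "d > 0" "\<And>k. norm k < d \<Longrightarrow> norm (J (y + k) - z - J' k) \<le> e' * norm k"
        using deriv[OF e'] by blast
      show ?thesis
      proof (intro exI[of _ "d / c"] conjI allI impI)
        show "d / c > 0" using d c by simp
        fix h s :: 'a assume h: "norm h < d / c" and s: "subgradient f (z + h) s"
        define k where "k = h + (s - P)"
        have Jk: "J (y + k) = z + h" by (rule J_unique) (use s in \<open>simp add: k_def y_def\<close>)
        have kh: "norm k \<le> c * norm h" using expand[of k] Jk by simp
        also have "\<dots> < d" using h c by (simp add: field_simps)
        finally have "norm (h - J' k) \<le> e' * norm k" using d(2)[of k] Jk by simp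
        also have "\<dots> \<le> e' * (c * norm h)" using kh e' by (intro mult_left_mono) auto
        finally have r: "norm (h - J' k) \<le> e' * (c * norm h)" .
        have "s - P - A h = - B (h - J' k)" unfolding A_def k_def B.diff BJ[unfolded k_def] by simp
        then have "norm (s - P - A h) \<le> b * norm (h - J' k)" using b(2)[of "h - J' k"] by simp
        also have "\<dots> \<le> b * (e' * (c * norm h))" using r b by (intro mult_left_mono) auto
        also have "\<dots> = e * norm h" unfolding e'_def using b c by simp
        finally show "norm (s - P - A h) \<le> e * norm h" .
      qed
    qed
    show "\<exists>A. linear A \<and> (\<forall>e>0. \<exists>d>0. \<forall>h. norm h < d \<longrightarrow>
        \<bar>f (z + h) - f z - P \<bullet> h - (A h \<bullet> h) / 2\<bar> \<le> e * (norm h)\<^sup>2)"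
    proof (intro exI[of _ A] conjI linA allI impI)
      fix e :: real assume "e > 0"
      then obtain d where d: "d > 0" "\<And>h s. norm h < d \<Longrightarrow> subgradient f (z + h) s \<Longrightarrow> norm (s - P - A h) \<le> e * norm h"
        using grad by blast
      show "\<exists>d>0. \<forall>h. norm h < d \<longrightarrow> \<bar>f (z + h) - f z - P \<bullet> h - (A h \<bullet> h) / 2\<bar> \<le> e * (norm h)\<^sup>2"
      proof (intro exI[of _ d] conjI allI impI d(1))
        fix h :: 'a assume h: "norm h < d"
        obtain S where S: "\<And>x. subgradient f x (S x)" using sd by metis
        define \<phi> where "\<phi> t = f (z + t *\<^sub>R h)" for t
        define \<sigma> where "\<sigma> t = S (z + t *\<^sub>R h) \<bullet> h" for t
        have "\<bar>\<phi> 1 - \<phi> 0 - P \<bullet> h - (A h \<bullet> h) / 2\<bar> \<le> e * (norm h)\<^sup>2"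
        proof (rule quadratic_expansion_of_slopes[where \<sigma>=\<sigma>])
          fix t t' :: real
          show "\<phi> t' \<ge> \<phi> t + \<sigma> t * (t' - t)"
            using subgradientD[OF S[of "z + t *\<^sub>R h"], of "z + t' *\<^sub>R h"]
            unfolding \<phi>_def \<sigma>_def by (simp add: scaleR_left_diff_distrib[symmetric] mult.commute)
          assume t: "t \<in> {0..1}"
          have "norm (t *\<^sub>R h) \<le> norm h" using t by (simp add: mult_left_le_one_le)
          then have n: "norm (t *\<^sub>R h) < d" using h by simp
          have "\<bar>\<sigma> t - P \<bullet> h - t * (A h \<bullet> h)\<bar> = \<bar>(S (z + t *\<^sub>R h) - P - A (t *\<^sub>R h)) \<bullet> h\<bar>"
            unfolding \<sigma>_def by (simp add: inner_diff_left A.scaleR)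
          also have "\<dots> \<le> norm (S (z + t *\<^sub>R h) - P - A (t *\<^sub>R h)) * norm h"
            by (rule Cauchy_Schwarz_ineq2)
          also have "\<dots> \<le> (e * norm (t *\<^sub>R h)) * norm h"
            by (intro mult_right_mono d(2)[OF n S]) simp
          also have "\<dots> \<le> (e * norm h) * norm h"
            using \<open>norm (t *\<^sub>R h) \<le> norm h\<close> \<open>e > 0\<close> by (intro mult_right_mono mult_left_mono) auto
          finally show "\<bar>\<sigma> t - P \<bullet> h - t * (A h \<bullet> h)\<bar> \<le> e * (norm h)\<^sup>2"
            by (simp add: power2_eq_square)
        qed
        then show "\<bar>f (z + h) - f z - P \<bullet> h - (A h \<bullet> h) / 2\<bar> \<le> e * (norm h)\<^sup>2"
          unfolding \<phi>_def by simp
      qed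
    qed
  qed
qed

section \<open>Sup-convolutions and the theorem on sums\<close>

text \<open>The form in which two second-order expansions with error \<open>o(t^2)\<close> are
  compared along a ray.\<close>

lemma le_of_scaled_expansion:
  fixes u v w :: real
  assumes "\<And>e. e > 0 \<Longrightarrow> \<exists>d>0. \<forall>t. 0 < t \<longrightarrow> t < d \<longrightarrow> t\<^sup>2 * u \<le> t\<^sup>2 * v + e * (t\<^sup>2 * w)" and "w \<ge> 0"
  shows "u \<le> v"
proof (rule field_le_epsilon)
  fix e :: real assume e: "e > 0"
  obtain d where d: "d > 0" "\<And>t. 0 < t \<Longrightarrow> t < d \<Longrightarrow> t\<^sup>2 * u \<le> t\<^sup>2 * v + (e / (w + 1)) * (t\<^sup>2 * w)"
    using assms(1)[of "e / (w + 1)"] e assms(2) by auto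
  have "(d/2)\<^sup>2 * u \<le> (d/2)\<^sup>2 * (v + e / (w + 1) * w)" using d(2)[of "d/2"] d(1) by (simp add: algebra_simps)
  then have "u \<le> v + e / (w + 1) * w" using d(1) by (subst (asm) mult_le_cancel_left_pos) auto
  also have "e / (w + 1) * w \<le> e" using e assms(2) by (simp add: field_simps)
  finally show "u \<le> v + e" by simp
qed

text \<open>Stated as an attained maximum: the maximising point of \<open>Q\<close> is what
  transfers expansions of \<open>S\<close> back to \<open>H\<close>.\<close>

definition is_sup_convolution :: "real \<Rightarrow> 'a::euclidean_space set \<Rightarrow> ('a \<Rightarrow> real) \<Rightarrow> ('a \<Rightarrow> real) \<Rightarrow> bool" where
  "is_sup_convolution c Q H S \<longleftrightarrow>
     (\<forall>y. (\<forall>x\<in>Q. H x - c / 2 * (norm (y - x))\<^sup>2 \<le> S y) \<and> (\<exists>x\<in>Q. S y = H x - c / 2 * (norm (y - x))\<^sup>2))"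

lemma norm_add_sq: "(norm (x + y))\<^sup>2 = (norm x)\<^sup>2 + 2 * (x \<bullet> y) + (norm y)\<^sup>2" for x y :: "'a::real_inner"
  unfolding power2_norm_eq_inner by (simp add: inner_add_left inner_add_right inner_commute)

text \<open>\<open>D\<close> is the Hessian of the penalty. The expansion is taken at a maximum
  point \<open>z\<close> of the tilted function, while \<open>z'\<close> is the point of
  \<open>Q\<close> attaining \<open>S z\<close>. Large \<open>c\<close> brings the two together, and
  small tilts \<open>p\<close> keep the first-order condition and the maximality of
  \<open>z'\<close> correct up to \<open>\<eta>\<close>.\<close>

lemma sup_convolution_twice_differentiable_near_maximum:
  fixes H :: "'a::euclidean_space \<Rightarrow> real" and D :: "'a \<Rightarrow> 'a"
  assumes Q: "compact Q" "Q \<noteq> {}" and H: "continuous_on Q H"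
    and D: "linear D" "\<And>x y. D x \<bullet> y = x \<bullet> D y" "\<And>x. 0 \<le> D x \<bullet> x" and eta: "\<eta> > 0"
  obtains c z z' S A where "c > 0" "is_sup_convolution c Q H S" "z' \<in> Q" "norm (z - z') \<le> \<eta>"
    "S z = H z' - c / 2 * (norm (z - z'))\<^sup>2"
    "norm (c *\<^sub>R (z' - z) - D z') \<le> \<eta>"
    "\<And>y. y \<in> Q \<Longrightarrow> H y - D y \<bullet> y / 2 \<le> H z' - D z' \<bullet> z' / 2 + \<eta>"
    "linear A" "\<And>h. A h \<bullet> h \<le> D h \<bullet> h"
    "\<And>e. e > 0 \<Longrightarrow> \<exists>d>0. \<forall>h. norm h < d \<longrightarrow>
       \<bar>S (z + h) - S z - (c *\<^sub>R (z' - z)) \<bullet> h - A h \<bullet> h / 2\<bar> \<le> e * (norm h)\<^sup>2"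
proof -
  interpret D: bounded_linear D using D(1) by (simp add: linear_conv_bounded_linear)
  obtain m where m: "m > 0" "\<And>x. norm (D x) \<le> m * norm x"
    using D.pos_bounded by (auto simp: mult.commute)
  obtain R where R: "R > 0" "\<And>x. x \<in> Q \<Longrightarrow> norm x \<le> R"
    using compact_imp_bounded[OF Q(1)] unfolding bounded_pos by blast
  obtain hmax where hmax: "\<And>x. x \<in> Q \<Longrightarrow> H x \<le> hmax"
    using continuous_attains_sup[OF Q H] by blast
  obtain hmin where hmin: "\<And>x. x \<in> Q \<Longrightarrow> hmin \<le> H x"
    using continuous_attains_inf[OF Q H] by blast
  \<comment> \<open>Bound for the tilts: over \<open>Q\<close>, and with
    \<open>norm z \<le> R + 1\<close>, the tilt changes values by at most
    \<open>\<eta> / 2\<close>.\<close>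
  define \<delta> where "\<delta> = min 1 (\<eta> / (4 * R + 4))"
  have \<delta>: "\<delta> > 0" "\<delta> \<le> 1" "\<delta> \<le> \<eta> / 4" "\<delta> * (2 * R + 1) \<le> \<eta> / 2"
  proof -
    have e: "\<eta> / (4 * R + 4) > 0" using eta R by simp
    show "\<delta> > 0" "\<delta> \<le> 1" unfolding \<delta>_def using e by auto
    have "\<delta> * (4 * R + 4) \<le> \<eta> / (4 * R + 4) * (4 * R + 4)"
      by (rule mult_right_mono) (use R in \<open>auto simp: \<delta>_def\<close>)
    also have "\<dots> = \<eta>" using R by simp
    finally have "\<delta> * (4 * R + 4) \<le> \<eta>" .
    then have *: "4 * (\<delta> * R) + 4 * \<delta> \<le> \<eta>" by (simp add: algebra_simps)
    moreover have "\<delta> * R > 0" using \<open>\<delta> > 0\<close> R by simp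
    ultimately show "\<delta> \<le> \<eta> / 4" by linarith
    show "\<delta> * (2 * R + 1) \<le> \<eta> / 2" using * \<open>\<delta> > 0\<close> by (simp add: algebra_simps)
  qed
  \<comment> \<open>Target for \<open>norm (z - z')\<close>; the displacement then changes
    \<open>D\<close> and its quadratic form by at most \<open>\<eta> / 2\<close>.\<close>
  define \<rho> where "\<rho> = \<eta> / (4 * (m + 1) * (R + 1))"
  have \<rho>: "\<rho> > 0" unfolding \<rho>_def using eta m R by simp
  have \<rho>m: "\<rho> * (4 * (m + 1) * (R + 1)) = \<eta>" unfolding \<rho>_def using m R by simp
  have \<rho>1: "\<rho> \<le> \<eta>" "m * \<rho> \<le> \<eta> / 2" "m * \<rho> * (2 * R + 1) / 2 \<le> \<eta> / 2"
  proof -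
    have p: "\<rho> * m > 0" "\<rho> * R > 0" "\<rho> * m * R > 0" using \<rho> m R by auto
    have *: "4 * (\<rho> * m * R) + 4 * (\<rho> * m) + 4 * (\<rho> * R) + 4 * \<rho> = \<eta>" using \<rho>m by (simp add: algebra_simps)
    show "\<rho> \<le> \<eta>" using * p \<rho> by linarith
    show "m * \<rho> \<le> \<eta> / 2" using * p \<rho> by (simp add: mult.commute)
    have "m * \<rho> * (2 * R + 1) / 2 = \<rho> * m * R + \<rho> * m / 2" by (simp add: algebra_simps)
    then show "m * \<rho> * (2 * R + 1) / 2 \<le> \<eta> / 2" using * p \<rho> by linarith
  qed
  \<comment> \<open>The first-order condition will give
    \<open>c * norm (z - z') \<le> m * (R + 1) + 1\<close>, and this choice makes the distance at
    most \<open>\<rho>\<close>.\<close>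
  define c where "c = max 1 ((m * (R + 1) + 1) / \<rho>)"
  have c: "c \<ge> 1" "(m * (R + 1) + 1) / c \<le> \<rho>"
  proof -
    show "c \<ge> 1" unfolding c_def by simp
    have "(m * (R + 1) + 1) / \<rho> \<le> c" unfolding c_def by simp
    then show "(m * (R + 1) + 1) / c \<le> \<rho>" using \<open>c \<ge> 1\<close> \<rho> by (simp add: field_simps)
  qed
  have "\<exists>x\<in>Q. \<forall>x'\<in>Q. H x' - c / 2 * (norm (y - x'))\<^sup>2 \<le> H x - c / 2 * (norm (y - x))\<^sup>2" for y
    by (rule continuous_attains_sup[OF Q]) (intro continuous_intros H)
  then obtain X where X: "\<And>y. X y \<in> Q"
    "\<And>y x. x \<in> Q \<Longrightarrow> H x - c / 2 * (norm (y - x))\<^sup>2 \<le> H (X y) - c / 2 * (norm (y - X y))\<^sup>2" by metis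
  define S where "S y = H (X y) - c / 2 * (norm (y - X y))\<^sup>2" for y
  have S: "is_sup_convolution c Q H S" unfolding is_sup_convolution_def S_def using X by blast
  have S_ge: "x \<in> Q \<Longrightarrow> H x - c / 2 * (norm (y - x))\<^sup>2 \<le> S y" for x y unfolding S_def by (rule X(2))
  define f where "f y = S y + c / 2 * (norm y)\<^sup>2" for y
  \<comment> \<open>Adding \<open>c / 2 * (norm y)\<^sup>2\<close> turns \<open>S\<close> into a
    maximum of affine functions, and the attaining point \<open>X y\<close> gives a slope.\<close>
  have sub: "subgradient f y (c *\<^sub>R X y)" for y
    unfolding subgradient_def
  proof
    fix w
    have sq: "c / 2 * (norm (u - x))\<^sup>2 = c / 2 * (norm u)\<^sup>2 - c * (x \<bullet> u) + c / 2 * (norm x)\<^sup>2" for u x :: 'a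
      unfolding power2_norm_eq_inner by (simp add: inner_diff_left inner_diff_right inner_commute algebra_simps)
    have "f y + c *\<^sub>R X y \<bullet> (w - y) = H (X y) - c / 2 * (norm (w - X y))\<^sup>2 + c / 2 * (norm w)\<^sup>2"
      unfolding f_def S_def sq by (simp add: inner_diff_right algebra_simps)
    also have "\<dots> \<le> f w" unfolding f_def using S_ge[OF X(1), of y w] by simp
    finally show "f y + c *\<^sub>R X y \<bullet> (w - y) \<le> f w" .
  qed
  have f_cont: "continuous_on UNIV f"
    using convex_on_continuous[OF open_UNIV subdifferentiable_convex] sub by blast
  have S_cont: "continuous_on UNIV S"
  proof -
    have "continuous_on UNIV (\<lambda>y. f y - c / 2 * (norm y)\<^sup>2)" by (intro continuous_intros f_cont)
    then show ?thesis unfolding f_def by simp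
  qed
  define \<phi> where "\<phi> y = D y \<bullet> y / 2" for y
  have \<phi>_add: "\<phi> (y + h) = \<phi> y + D y \<bullet> h + \<phi> h" for y h
    unfolding \<phi>_def using D(2)[of h y]
    by (simp add: D.add inner_add_left inner_add_right inner_commute field_simps)
  have \<phi>0: "\<phi> y \<ge> 0" for y unfolding \<phi>_def using D(3) by simp
  have \<phi>_le: "\<phi> y \<le> m / 2 * (norm y)\<^sup>2" for y
  proof -
    have "D y \<bullet> y \<le> norm (D y) * norm y" by (rule norm_cauchy_schwarz)
    also have "\<dots> \<le> m * norm y * norm y" by (intro mult_right_mono m) simp
    finally show ?thesis unfolding \<phi>_def by (simp add: power2_eq_square)
  qed
  have \<phi>_cont: "continuous_on A \<phi>" for A
    unfolding \<phi>_def by (intro continuous_intros linear_continuous_on D.bounded_linear_axioms) auto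
  \<comment> \<open>Since \<open>c \<ge> 1\<close>, \<open>S\<close> decreases at least like half
    the squared distance to the ball of radius \<open>R\<close>, which beats the linear tilt; beyond
    \<open>r0\<close> no value exceeds the one at \<open>x0\<close>.\<close>
  have "\<exists>z. \<forall>y. S y - \<phi> y - p \<bullet> y \<le> S z - \<phi> z - p \<bullet> z" if p: "norm p < \<delta>" for p
  proof -
    obtain x0 where x0: "x0 \<in> Q" using Q(2) by blast
    define \<Delta> where "\<Delta> = hmax - hmin + 2 * R + \<phi> x0"
    have "\<Delta> \<ge> 0" unfolding \<Delta>_def using hmax[OF x0] hmin[OF x0] R \<phi>0[of x0] by linarith
    define r0 where "r0 = R + 2 * \<Delta> + 3"
    have p1: "norm p \<le> 1" using p \<delta> by simp
    have px: "- R \<le> - (p \<bullet> x0)"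
    proof -
      have "p \<bullet> x0 \<le> norm p * norm x0" by (rule norm_cauchy_schwarz)
      also have "\<dots> \<le> 1 * R" using p1 R(2)[OF x0] by (intro mult_mono) auto
      finally show ?thesis by simp
    qed
    let ?W = "\<lambda>y. S y - \<phi> y - p \<bullet> y"
    have W0: "?W x0 \<ge> hmin - \<phi> x0 - R"
      using S_ge[OF x0, of x0] hmin[OF x0] px by simp
    have r0R: "r0 \<ge> R" "r0 > 0" unfolding r0_def using \<open>\<Delta> \<ge> 0\<close> R by auto
    have out: "?W y \<le> ?W x0" if y: "norm y \<ge> r0" for y
    proof -
      define r where "r = norm y - R"
      have r: "r \<ge> 2 * \<Delta> + 3" "r \<ge> 0" using y \<open>\<Delta> \<ge> 0\<close> unfolding r_def r0_def by auto
      have "r \<le> norm (y - X y)" unfolding r_def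
        using norm_triangle_ineq2[of y "X y"] R(2)[OF X(1), of y] by linarith
      then have "r\<^sup>2 \<le> (norm (y - X y))\<^sup>2" using r by (intro power_mono) auto
      then have "1 * r\<^sup>2 \<le> c * (norm (y - X y))\<^sup>2" using c by (intro mult_mono) auto
      then have Sy: "S y \<le> hmax - r\<^sup>2 / 2" unfolding S_def using hmax[OF X(1), of y] by simp
      have py: "- (p \<bullet> y) \<le> r + R"
      proof -
        have "- (p \<bullet> y) \<le> norm p * norm y" using Cauchy_Schwarz_ineq2[of p y] by linarith
        also have "\<dots> \<le> 1 * norm y" using p1 by (intro mult_right_mono) auto
        finally show ?thesis unfolding r_def by simp
      qed
      have "r * (2 * \<Delta> + 3 - 2) \<le> r * (r - 2)" using r by (intro mult_left_mono) auto
      moreover have "(2 * \<Delta> + 3) * (2 * \<Delta> + 1) \<le> r * (2 * \<Delta> + 1)" using r \<open>\<Delta> \<ge> 0\<close> by (intro mult_right_mono) auto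
      moreover have "2 * \<Delta> \<le> (2 * \<Delta> + 3) * (2 * \<Delta> + 1)" using \<open>\<Delta> \<ge> 0\<close> by (simp add: algebra_simps)
      ultimately have "2 * \<Delta> \<le> r\<^sup>2 - 2 * r" by (simp add: algebra_simps power2_eq_square)
      then have "\<Delta> + r \<le> r\<^sup>2 / 2" by simp
      then have "?W y \<le> hmax - \<Delta> + R"
        using Sy py \<phi>0[of y] by simp
      also have "\<dots> = hmin - \<phi> x0 - R" unfolding \<Delta>_def by simp
      finally have "?W y \<le> hmin - \<phi> x0 - R" .
      then show ?thesis using W0 by linarith
    qed
    have "continuous_on (cball 0 r0) ?W"
      by (intro continuous_intros \<phi>_cont continuous_on_subset[OF S_cont]) auto
    then obtain z where z: "z \<in> cball 0 r0" "\<And>y. y \<in> cball 0 r0 \<Longrightarrow> ?W y \<le> ?W z"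
      using continuous_attains_sup[of "cball 0 r0" ?W] r0R by auto
    have x0b: "x0 \<in> cball 0 r0" using R(2)[OF x0] r0R by simp
    have "?W y \<le> ?W z" for y
    proof (cases "y \<in> cball 0 r0")
      case False
      then have "norm y \<ge> r0" by simp
      then show ?thesis using out z(2)[OF x0b] by force
    qed (rule z(2))
    then show ?thesis by blast
  qed
  then obtain Z where Z: "\<And>p y. norm p < \<delta> \<Longrightarrow> S y - \<phi> y - p \<bullet> y \<le> S (Z p) - \<phi> (Z p) - p \<bullet> Z p"
    by metis
  define C where "C = m / 2 + c / 2"
  have C: "C \<ge> 0" unfolding C_def using m c by simp
  have touch: "f (Z p + h) \<le> f (Z p) + (D (Z p) + p + c *\<^sub>R Z p) \<bullet> h + C * (norm h)\<^sup>2" if p: "norm p < \<delta>" for p h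
  proof -
    have "f (Z p + h) \<le> (S (Z p) - \<phi> (Z p) - p \<bullet> Z p) + \<phi> (Z p + h) + p \<bullet> (Z p + h) + c / 2 * (norm (Z p + h))\<^sup>2"
      unfolding f_def using Z[OF p, of "Z p + h"] by simp
    also have "\<dots> = f (Z p) + (D (Z p) + p + c *\<^sub>R Z p) \<bullet> h + (\<phi> h + c / 2 * (norm h)\<^sup>2)"
      unfolding f_def \<phi>_add norm_add_sq by (simp add: inner_add_left inner_add_right algebra_simps)
    also have "\<dots> \<le> f (Z p) + (D (Z p) + p + c *\<^sub>R Z p) \<bullet> h + C * (norm h)\<^sup>2"
      unfolding C_def using \<phi>_le[of h] by (simp add: algebra_simps)
    finally show ?thesis .
  qed
  \<comment> \<open>The paraboloid from the maximality of \<open>Z p\<close> identifies the slope of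
    \<open>f\<close>. The equation recovers \<open>p\<close> from \<open>Z p\<close>, so
    \<open>Z\<close> is injective with a Lipschitz inverse.\<close>
  have XZ: "c *\<^sub>R X (Z p) = D (Z p) + p + c *\<^sub>R Z p" if p: "norm p < \<delta>" for p
    by (rule quadratic_bound_subgradient[OF touch[OF p] sub C])
  have Z_lip: "norm (p2 - p1) \<le> (4 * C + m + c) * norm (Z p2 - Z p1)"
    if p: "norm p1 < \<delta>" "norm p2 < \<delta>" for p1 p2
  proof -
    have s1: "subgradient f (Z p1) (D (Z p1) + p1 + c *\<^sub>R Z p1)" using sub[of "Z p1"] XZ[OF p(1)] by simp
    have s2: "subgradient f (Z p1 + (Z p2 - Z p1)) (D (Z p2) + p2 + c *\<^sub>R Z p2)"
      using sub[of "Z p2"] XZ[OF p(2)] by simp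
    have "norm ((D (Z p2) + p2 + c *\<^sub>R Z p2) - (D (Z p1) + p1 + c *\<^sub>R Z p1)) \<le> 4 * C * norm (Z p2 - Z p1)"
      by (rule quadratic_bound_nearby_subgradient[OF touch[OF p(1)] s2 s1 C])
    moreover have "p2 - p1 = ((D (Z p2) + p2 + c *\<^sub>R Z p2) - (D (Z p1) + p1 + c *\<^sub>R Z p1)) - D (Z p2 - Z p1) - c *\<^sub>R (Z p2 - Z p1)"
      by (simp add: D.diff algebra_simps)
    moreover have "norm (D (Z p2 - Z p1)) \<le> m * norm (Z p2 - Z p1)" by (rule m(2))
    moreover have "norm (c *\<^sub>R (Z p2 - Z p1)) = c * norm (Z p2 - Z p1)" using c by simp
    moreover have "norm (a - b - d) \<le> norm a + norm b + norm d" for a b d :: 'a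
      by (metis add_mono norm_triangle_ineq4 order_refl order_trans)
    ultimately show ?thesis by (smt (verit) distrib_right)
  qed
  obtain N where N: "negligible N"
    "\<And>z P C. z \<notin> N \<Longrightarrow> 0 \<le> C \<Longrightarrow> (\<And>h. f (z + h) \<le> f z + P \<bullet> h + C * (norm h)\<^sup>2) \<Longrightarrow>
      \<exists>A. linear A \<and> (\<forall>e>0. \<exists>d>0. \<forall>h. norm h < d \<longrightarrow>
        \<bar>f (z + h) - f z - P \<bullet> h - (A h \<bullet> h) / 2\<bar> \<le> e * (norm h)\<^sup>2)"
    using Alexandrov_at_touched_points[of f] sub by blast
  have "\<not> Z ` ball 0 \<delta> \<subseteq> N"
  proof
    assume "Z ` ball 0 \<delta> \<subseteq> N"
    then have neg: "negligible (Z ` ball 0 \<delta>)" using N(1) negligible_subset by blast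
    \<comment> \<open>If the maximum points formed a null set, the Lipschitz inverse of
      \<open>Z\<close> would map it onto a ball of tilts.\<close>
    define g where "g z = (SOME p. p \<in> ball 0 \<delta> \<and> Z p = z)" for z
    have g: "g z \<in> ball 0 \<delta> \<and> Z (g z) = z" if "z \<in> Z ` ball 0 \<delta>" for z
      unfolding g_def by (rule someI_ex) (use that in auto)
    have "negligible (g ` (Z ` ball 0 \<delta>))"
    proof (rule negligible_locally_Lipschitz_image[OF _ neg])
      fix x assume x: "x \<in> Z ` ball 0 \<delta>"
      have "norm (g y - g x) \<le> (4 * C + m + c) * norm (y - x)" if "y \<in> Z ` ball 0 \<delta>" for y
        using Z_lip[of "g x" "g y"] g[OF x] g[OF that] by simp
      then show "\<exists>T B. open T \<and> x \<in> T \<and> (\<forall>y\<in>Z ` ball 0 \<delta> \<inter> T. norm (g y - g x) \<le> B * norm (y - x))"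
        by (intro exI[of _ UNIV] exI[of _ "4 * C + m + c"]) auto
    qed simp
    moreover have "ball 0 \<delta> \<subseteq> g ` (Z ` ball 0 \<delta>)"
    proof
      fix p :: 'a assume p: "p \<in> ball 0 \<delta>"
      have "g (Z p) \<in> ball 0 \<delta>" "Z (g (Z p)) = Z p" using g p by auto
      then have "norm (g (Z p) - p) \<le> (4 * C + m + c) * 0"
        using Z_lip[of p "g (Z p)"] p by simp
      then have "g (Z p) = p" by simp
      then show "p \<in> g ` (Z ` ball 0 \<delta>)" using p by force
    qed
    ultimately have "negligible (ball (0::'a) \<delta>)" by (rule negligible_subset)
    then show False using \<delta>(1) open_not_negligible[of "ball (0::'a) \<delta>"] by simp
  qed
  then obtain p where "p \<in> ball 0 \<delta>" and pN: "Z p \<notin> N" by blast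
  then have p: "norm p < \<delta>" "Z p \<notin> N" by auto
  define z where "z = Z p"
  define z' where "z' = X z"
  define P where "P = c *\<^sub>R (z' - z)"
  have P: "P = D z + p" unfolding P_def z'_def z_def using XZ[OF p(1)] by (simp add: scaleR_right_diff_distrib)
  have z'Q: "z' \<in> Q" unfolding z'_def by (rule X(1))
  obtain A' where A': "linear A'" and exp: "\<And>e. e > 0 \<Longrightarrow> \<exists>d>0. \<forall>h. norm h < d \<longrightarrow>
        \<bar>f (z + h) - f z - (D z + p + c *\<^sub>R z) \<bullet> h - (A' h \<bullet> h) / 2\<bar> \<le> e * (norm h)\<^sup>2"
    using N(2)[OF p(2) C touch[OF p(1)]] unfolding z_def by blast
  define A where "A h = A' h - c *\<^sub>R h" for h
  have A: "linear A" unfolding A_def by (intro linear_compose_sub A' linear_scale_self)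
  interpret A: bounded_linear A using A by (simp add: linear_conv_bounded_linear)
  have expS: "\<exists>d>0. \<forall>h. norm h < d \<longrightarrow> \<bar>S (z + h) - S z - P \<bullet> h - A h \<bullet> h / 2\<bar> \<le> e * (norm h)\<^sup>2" if "e > 0" for e
  proof -
    have "S (z + h) - S z - P \<bullet> h - A h \<bullet> h / 2 = f (z + h) - f z - (D z + p + c *\<^sub>R z) \<bullet> h - (A' h \<bullet> h) / 2" for h
      unfolding f_def A_def P norm_add_sq
      by (simp add: inner_add_left inner_diff_left power2_norm_eq_inner field_simps)
    then show ?thesis using exp[OF that] by simp
  qed
  \<comment> \<open>Pairing the first-order condition with \<open>z\<close> and dropping the
    nonnegative form of \<open>D\<close> gives a bound for \<open>z\<close> free of
    \<open>c\<close>; only then does largeness of \<open>c\<close> control the displacement.\<close>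
  have zz: "norm (z - z') \<le> \<rho>" and zR: "norm z \<le> R + 1"
  proof -
    have "c * (norm z)\<^sup>2 \<le> c * (z \<bullet> z) + D z \<bullet> z" using D(3)[of z] by (simp add: power2_norm_eq_inner)
    also have "\<dots> = (c *\<^sub>R z' - p) \<bullet> z"
      using P unfolding P_def by (simp add: scaleR_right_diff_distrib inner_diff_left algebra_simps)
    also have "\<dots> \<le> norm (c *\<^sub>R z' - p) * norm z" by (rule norm_cauchy_schwarz)
    also have "\<dots> \<le> (c * R + c) * norm z"
    proof (rule mult_right_mono)
      have "norm (c *\<^sub>R z' - p) \<le> c * norm z' + norm p" using norm_triangle_ineq4[of "c *\<^sub>R z'" p] c by simp
      moreover have "c * norm z' \<le> c * R" using R(2)[OF z'Q] c by (intro mult_left_mono) auto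
      ultimately show "norm (c *\<^sub>R z' - p) \<le> c * R + c" using p \<delta> c by linarith
    qed simp
    finally have "c * norm z * norm z \<le> c * (R + 1) * norm z" by (simp add: power2_eq_square algebra_simps)
    then show zR: "norm z \<le> R + 1" using c R by (cases "norm z = 0") auto
    have "c * norm (z - z') = norm P" unfolding P_def using c by (simp add: norm_minus_commute)
    also have "\<dots> \<le> m * norm z + 1"
      unfolding P using norm_triangle_ineq[of "D z" p] m(2)[of z] p \<delta> by linarith
    also have "\<dots> \<le> m * (R + 1) + 1" using zR m by simp
    finally have "norm (z - z') \<le> (m * (R + 1) + 1) / c" using c by (simp add: field_simps)
    then show "norm (z - z') \<le> \<rho>" using c by simp
  qed
  show ?thesis
  proof (rule that[of c S z' z A])
    show "c > 0" using c by simp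
    show "is_sup_convolution c Q H S" by (rule S)
    show "z' \<in> Q" by (rule z'Q)
    show "norm (z - z') \<le> \<eta>" using zz \<rho>1 by simp
    show "S z = H z' - c / 2 * (norm (z - z'))\<^sup>2" unfolding S_def z'_def ..
    have "c *\<^sub>R (z' - z) - D z' = D (z - z') + p" using P unfolding P_def by (simp add: D.diff)
    then have "norm (c *\<^sub>R (z' - z) - D z') \<le> norm (D (z - z')) + norm p" using norm_triangle_ineq by metis
    also have "norm (D (z - z')) \<le> m * \<rho>"
      by (rule order_trans[OF m(2)]) (use zz m in \<open>intro mult_left_mono; simp\<close>)
    finally show "norm (c *\<^sub>R (z' - z) - D z') \<le> \<eta>" using \<rho>1 \<delta> p by linarith
    show "linear A" by (rule A)
    show "\<exists>d>0. \<forall>h. norm h < d \<longrightarrow>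
       \<bar>S (z + h) - S z - (c *\<^sub>R (z' - z)) \<bullet> h - A h \<bullet> h / 2\<bar> \<le> e * (norm h)\<^sup>2" if "e > 0" for e
      using expS[OF that] unfolding P_def .
  next
    fix y assume y: "y \<in> Q"
    have "H y - \<phi> y - p \<bullet> y \<le> S z - \<phi> z - p \<bullet> z"
      using Z[OF p(1), of y] S_ge[OF y, of y] unfolding z_def by simp
    moreover have "S z \<le> H z'" unfolding S_def z'_def using c by simp
    moreover have "p \<bullet> (y - z) \<le> \<eta> / 2"
    proof -
      have "p \<bullet> (y - z) \<le> norm p * norm (y - z)" by (rule norm_cauchy_schwarz)
      also have "\<dots> \<le> \<delta> * (2 * R + 1)"
        using p norm_triangle_ineq4[of y z] R(2)[OF y] zR \<delta> by (intro mult_mono) auto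
      finally show ?thesis using \<delta> by simp
    qed
    moreover have "\<phi> z' - \<phi> z \<le> \<eta> / 2"
    proof -
      have "\<phi> z' - \<phi> z = D (z' - z) \<bullet> (z' + z) / 2"
        unfolding \<phi>_def using D(2)[of z z'] by (simp add: D.diff inner_diff_left inner_diff_right inner_add_left inner_add_right inner_commute field_simps)
      also have "D (z' - z) \<bullet> (z' + z) \<le> norm (D (z' - z)) * norm (z' + z)" by (rule norm_cauchy_schwarz)
      also have "\<dots> \<le> (m * \<rho>) * (2 * R + 1)"
      proof (rule mult_mono)
        show "norm (D (z' - z)) \<le> m * \<rho>"
          by (rule order_trans[OF m(2)]) (use zz m in \<open>intro mult_left_mono; simp add: norm_minus_commute\<close>)
        show "norm (z' + z) \<le> 2 * R + 1" using norm_triangle_ineq[of z' z] R(2)[OF z'Q] zR by linarith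
      qed (use m \<rho> in auto)
      finally show ?thesis using \<rho>1 by simp
    qed
    ultimately show "H y - D y \<bullet> y / 2 \<le> H z' - D z' \<bullet> z' / 2 + \<eta>"
      unfolding \<phi>_def by (simp add: inner_diff_right)
  next
    fix h
    \<comment> \<open>Second-order condition at the maximum of \<open>S\<close> minus penalty and
      tilt: the linear parts cancel by the formula for \<open>P\<close>.\<close>
    have "A h \<bullet> h / 2 \<le> \<phi> h"
    proof (rule le_of_scaled_expansion[where w="(norm h)\<^sup>2"])
      fix e :: real assume "e > 0"
      then obtain d where d: "d > 0" "\<And>h. norm h < d \<Longrightarrow> \<bar>S (z + h) - S z - P \<bullet> h - A h \<bullet> h / 2\<bar> \<le> e * (norm h)\<^sup>2"
        using expS by blast
      show "\<exists>d>0. \<forall>t. 0 < t \<longrightarrow> t < d \<longrightarrow> t\<^sup>2 * (A h \<bullet> h / 2) \<le> t\<^sup>2 * \<phi> h + e * (t\<^sup>2 * (norm h)\<^sup>2)"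
      proof (intro exI[of _ "d / (norm h + 1)"] conjI allI impI)
        show "d / (norm h + 1) > 0" using d by (simp add: add_nonneg_pos)
        fix t assume t: "0 < t" "t < d / (norm h + 1)"
        have "t * (norm h + 1) < d" using t(2) by (simp add: pos_less_divide_eq add_nonneg_pos)
        then have "norm (t *\<^sub>R h) < d" using t by (simp add: algebra_simps)
        from d(2)[OF this] have 1: "A (t *\<^sub>R h) \<bullet> (t *\<^sub>R h) / 2 \<le> S (z + t *\<^sub>R h) - S z - P \<bullet> (t *\<^sub>R h) + e * (norm (t *\<^sub>R h))\<^sup>2"
          by linarith
        have "S (z + t *\<^sub>R h) - \<phi> (z + t *\<^sub>R h) - p \<bullet> (z + t *\<^sub>R h) \<le> S z - \<phi> z - p \<bullet> z"
          using Z[OF p(1)] unfolding z_def by blast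
        then have 2: "S (z + t *\<^sub>R h) - S z - P \<bullet> (t *\<^sub>R h) \<le> \<phi> (t *\<^sub>R h)"
          unfolding \<phi>_add P by (simp add: inner_add_left inner_add_right distrib_left)
        have 3: "\<phi> (t *\<^sub>R h) = t\<^sup>2 * \<phi> h" unfolding \<phi>_def by (simp add: D.scaleR power2_eq_square)
        show "t\<^sup>2 * (A h \<bullet> h / 2) \<le> t\<^sup>2 * \<phi> h + e * (t\<^sup>2 * (norm h)\<^sup>2)"
          using 1 2 3 by (simp add: A.scaleR power2_eq_square algebra_simps)
      qed
    qed simp
    then show "A h \<bullet> h \<le> D h \<bullet> h" unfolding \<phi>_def by simp
  qed
qed

text \<open>The cross terms between \<open>\<tau>\<close> and \<open>h\<close> are absorbed by
  Young's inequality into \<open>e * (norm h)\<^sup>2\<close> and a multiple of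
  \<open>\<tau>\<^sup>2\<close>. The size of \<open>C\<close> is harmless: a term in
  \<open>\<tau>\<^sup>2\<close> affects neither the time derivative nor the spatial Hessian of a
  test function at the touching point.\<close>

lemma space_time_form_bound:
  fixes A :: "real \<times> 'a::euclidean_space \<Rightarrow> real \<times> 'a"
  assumes A: "linear A" and e: "e > 0"
  obtains X C where "linear X" "\<And>\<tau> h. A (\<tau>, h) \<bullet> (\<tau>, h) \<le> X h \<bullet> h + C * \<tau>\<^sup>2"
    "\<And>h. X h \<bullet> h = A (0, h) \<bullet> (0, h) + e * (norm h)\<^sup>2"
proof -
  interpret A: bounded_linear A using A by (simp add: linear_conv_bounded_linear)
  obtain K where K: "K > 0" "\<And>x. norm (A x) \<le> K * norm x"
    using A.pos_bounded by (auto simp: mult.commute)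
  define X where "X h = snd (A (0, h)) + e *\<^sub>R h" for h
  have "linear X" unfolding X_def
  proof (rule linearI)
    fix b1 b2 :: 'a and r :: real
    have "A (0, b1 + b2) = A (0, b1) + A (0, b2)" using A.add[of "(0, b1)" "(0, b2)"] by simp
    then show "snd (A (0, b1 + b2)) + e *\<^sub>R (b1 + b2) = snd (A (0, b1)) + e *\<^sub>R b1 + (snd (A (0, b2)) + e *\<^sub>R b2)"
      by (simp add: scaleR_right_distrib)
    have "A (0, r *\<^sub>R b1) = r *\<^sub>R A (0, b1)" using A.scaleR[of r "(0, b1)"] by simp
    then show "snd (A (0, r *\<^sub>R b1)) + e *\<^sub>R (r *\<^sub>R b1) = r *\<^sub>R (snd (A (0, b1)) + e *\<^sub>R b1)"
      by (simp add: scaleR_right_distrib)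
  qed
  note lin = this
  have Xf: "X h \<bullet> h = A (0, h) \<bullet> (0, h) + e * (norm h)\<^sup>2" for h
    unfolding X_def by (cases "A (0, h)") (simp add: inner_add_left power2_norm_eq_inner)
  have "A (\<tau>, h) \<bullet> (\<tau>, h) \<le> X h \<bullet> h + (K + K\<^sup>2 / e) * \<tau>\<^sup>2" for \<tau> h
  proof -
    have split: "(\<tau>, h) = (\<tau>, 0) + (0, h)" by simp
    have n1: "norm (\<tau>, 0::'a) = \<bar>\<tau>\<bar>" and n2: "norm (0::real, h) = norm h" by (simp_all add: norm_Pair)
    have "A (\<tau>, h) \<bullet> (\<tau>, h) = A (0, h) \<bullet> (0, h) + A (\<tau>, 0) \<bullet> (0, h) + A (0, h) \<bullet> (\<tau>, 0) + A (\<tau>, 0) \<bullet> (\<tau>, 0)"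
      unfolding split A.add by (simp only: inner_add_left inner_add_right)
    moreover have "A u \<bullet> v \<le> K * norm u * norm v" for u v
      by (rule order_trans[OF norm_cauchy_schwarz mult_right_mono]) (use K in auto)
    from this[of "(\<tau>, 0)" "(0, h)"] this[of "(0, h)" "(\<tau>, 0)"] this[of "(\<tau>, 0)" "(\<tau>, 0)"]
    have "A (\<tau>, 0) \<bullet> (0, h) \<le> K * \<bar>\<tau>\<bar> * norm h" "A (0, h) \<bullet> (\<tau>, 0) \<le> K * \<bar>\<tau>\<bar> * norm h"
      "A (\<tau>, 0) \<bullet> (\<tau>, 0) \<le> K * \<tau>\<^sup>2"
      unfolding n1 n2 by (simp_all add: mult_ac power2_eq_square)
    moreover have "2 * (K * \<bar>\<tau>\<bar> * norm h) \<le> e * (norm h)\<^sup>2 + K\<^sup>2 / e * \<tau>\<^sup>2"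
    proof -
      have "0 \<le> (e * norm h - K * \<bar>\<tau>\<bar>)\<^sup>2 / e" using e by simp
      also have "\<dots> = e * (norm h)\<^sup>2 - 2 * (K * \<bar>\<tau>\<bar> * norm h) + K\<^sup>2 / e * \<tau>\<^sup>2"
        using e by (simp add: power2_diff power_mult_distrib field_simps power2_eq_square)
      finally show ?thesis by simp
    qed
    ultimately show ?thesis unfolding Xf by (simp add: distrib_right)
  qed
  with lin Xf show ?thesis by (intro that[of X "K + K\<^sup>2 / e"])
qed

text \<open>The penalty of a product splits as well, so exchanging components of the two maximising
  points gives competitors for the mixed pairs. The vanishing mixed difference says that
  \<open>S\<close> is a sum of functions of each variable, without naming them.\<close>

lemma sup_convolution_separable:
  assumes "is_sup_convolution c (Q1 \<times> Q2) (\<lambda>(x, y). F x + G y) S"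
  shows "S (x1, y1) + S (x2, y2) = S (x1, y2) + S (x2, y1)"
proof -
  have le: "S (x1, y1) + S (x2, y2) \<le> S (x1, y2) + S (x2, y1)" for x1 y1 x2 y2
  proof -
    obtain u1 v1 where 1: "u1 \<in> Q1" "v1 \<in> Q2" "S (x1, y1) = F u1 + G v1 - c / 2 * (norm ((x1, y1) - (u1, v1)))\<^sup>2"
      using assms unfolding is_sup_convolution_def by force
    obtain u2 v2 where 2: "u2 \<in> Q1" "v2 \<in> Q2" "S (x2, y2) = F u2 + G v2 - c / 2 * (norm ((x2, y2) - (u2, v2)))\<^sup>2"
      using assms unfolding is_sup_convolution_def by force
    have "F u1 + G v2 - c / 2 * (norm ((x1, y2) - (u1, v2)))\<^sup>2 \<le> S (x1, y2)"
      "F u2 + G v1 - c / 2 * (norm ((x2, y1) - (u2, v1)))\<^sup>2 \<le> S (x2, y1)"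
      using assms 1 2 unfolding is_sup_convolution_def by fastforce+
    then show ?thesis unfolding 1(3) 2(3) by (simp add: norm_Pair algebra_simps)
  qed
  show ?thesis using le[of x1 y1 x2 y2] le[of x1 y2 x2 y1] by simp
qed

text \<open>An approximate version: the pair is a maximum only up to \<open>\<eta>\<close>, and so
  are the identities for the first-order terms, but the touching paraboloids are genuine.
  Separability makes the expansion of the sup-convolution block diagonal; restricting the bound by
  the Hessian of the penalty to purely spatial increments gives the inequality for \<open>X\<close>
  and \<open>Y\<close>.\<close>

theorem theorem_on_sums:
  fixes U V :: "real \<times> 'a::euclidean_space \<Rightarrow> real"
  assumes Q: "compact Q" "Q \<noteq> {}" and U: "continuous_on Q U" and V: "continuous_on Q V"
    and par: "\<alpha> \<ge> 0" "\<beta> \<ge> 0" "\<gamma> \<ge> 0" "\<eta> > 0"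
  obtains t x s y a p a' q X Y C d where "(t, x) \<in> Q" "(s, y) \<in> Q" "d > 0"
    "\<And>t1 x1 s1 y1. (t1, x1) \<in> Q \<Longrightarrow> (s1, y1) \<in> Q \<Longrightarrow>
       U (t1, x1) - V (s1, y1) - (\<alpha> / 2 * (norm (x1 - y1))\<^sup>2 + \<gamma> / 2 * (t1 - s1)\<^sup>2 + \<beta> * (norm x1)\<^sup>2)
       \<le> U (t, x) - V (s, y) - (\<alpha> / 2 * (norm (x - y))\<^sup>2 + \<gamma> / 2 * (t - s)\<^sup>2 + \<beta> * (norm x)\<^sup>2) + \<eta>"
    "\<bar>a - \<gamma> * (t - s)\<bar> \<le> \<eta>" "\<bar>a' - \<gamma> * (t - s)\<bar> \<le> \<eta>"
    "norm (p - (\<alpha> *\<^sub>R (x - y) + (2 * \<beta>) *\<^sub>R x)) \<le> \<eta>" "norm (q - \<alpha> *\<^sub>R (x - y)) \<le> \<eta>"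
    "linear X" "linear Y"
    "\<And>\<tau> h. norm (\<tau>, h) < d \<Longrightarrow> (t + \<tau>, x + h) \<in> Q \<Longrightarrow>
       U (t + \<tau>, x + h) \<le> U (t, x) + a * \<tau> + p \<bullet> h + X h \<bullet> h / 2 + C * \<tau>\<^sup>2"
    "\<And>\<tau> h. norm (\<tau>, h) < d \<Longrightarrow> (s + \<tau>, y + h) \<in> Q \<Longrightarrow>
       V (s, y) + a' * \<tau> + q \<bullet> h + Y h \<bullet> h / 2 - C * \<tau>\<^sup>2 \<le> V (s + \<tau>, y + h)"
    "\<And>h k. X h \<bullet> h / 2 - Y k \<bullet> k / 2 \<le> \<alpha> / 2 * (norm (h - k))\<^sup>2 + \<beta> * (norm h)\<^sup>2 + \<eta> * ((norm h)\<^sup>2 + (norm k)\<^sup>2)"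
proof -
  \<comment> \<open>Hessian of the penalty in both space-time variables. Its half quadratic form is
    the penalty itself, so the penalty needs no expansion.\<close>
  define D :: "(real \<times> 'a) \<times> (real \<times> 'a) \<Rightarrow> (real \<times> 'a) \<times> (real \<times> 'a)" where
    "D z = ((\<gamma> * (fst (fst z) - fst (snd z)), \<alpha> *\<^sub>R (snd (fst z) - snd (snd z)) + (2 * \<beta>) *\<^sub>R snd (fst z)),
            (\<gamma> * (fst (snd z) - fst (fst z)), \<alpha> *\<^sub>R (snd (snd z) - snd (fst z))))" for z
  define H where "H = (\<lambda>(\<xi>, \<zeta>). U \<xi> + - V \<zeta>)"
  have D_form: "D ((t, x), (s, y)) \<bullet> ((t, x), (s, y)) = \<alpha> * (norm (x - y))\<^sup>2 + \<gamma> * (t - s)\<^sup>2 + 2 * \<beta> * (norm x)\<^sup>2" for t x s y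
    unfolding D_def power2_norm_eq_inner
    by (simp add: inner_add_left inner_diff_left inner_diff_right inner_commute power2_eq_square algebra_simps)
  have linD: "linear D"
    by (rule linearI) (auto simp: D_def algebra_simps)
  have symD: "D z \<bullet> w = z \<bullet> D w" for z w
    by (cases z; cases w; cases "fst z"; cases "snd z"; cases "fst w"; cases "snd w")
       (simp add: D_def inner_add_left inner_add_right inner_diff_left inner_diff_right inner_commute algebra_simps)
  have psdD: "0 \<le> D z \<bullet> z" for z
  proof -
    obtain t x s y where z: "z = ((t, x), (s, y))" by (metis surj_pair)
    show ?thesis unfolding z D_form using par by (simp add: add_nonneg_nonneg)
  qed
  have contH: "continuous_on (Q \<times> Q) H"
    unfolding H_def split_def
    by (intro continuous_intros continuous_on_compose2[OF U] continuous_on_compose2[OF V]) auto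
  have neQ: "Q \<times> Q \<noteq> {}" using Q(2) by simp
  have e2: "\<eta> / 2 > 0" and e4: "\<eta> / 4 > 0" using par by auto
  obtain c z z' S A where c: "c > 0" and S: "is_sup_convolution c (Q \<times> Q) H S" and z'Q: "z' \<in> Q \<times> Q"
    and zz: "norm (z - z') \<le> \<eta>"
    and Sz: "S z = H z' - c / 2 * (norm (z - z'))\<^sup>2"
    and PD: "norm (c *\<^sub>R (z' - z) - D z') \<le> \<eta>"
    and opt: "\<And>y. y \<in> Q \<times> Q \<Longrightarrow> H y - D y \<bullet> y / 2 \<le> H z' - D z' \<bullet> z' / 2 + \<eta>"
    and A: "linear A" "\<And>h. A h \<bullet> h \<le> D h \<bullet> h"
    and exp: "\<And>e. e > 0 \<Longrightarrow> \<exists>d>0. \<forall>h. norm h < d \<longrightarrow>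
       \<bar>S (z + h) - S z - (c *\<^sub>R (z' - z)) \<bullet> h - A h \<bullet> h / 2\<bar> \<le> e * (norm h)\<^sup>2"
    by (rule sup_convolution_twice_differentiable_near_maximum[OF compact_Times[OF Q(1) Q(1)] neQ contH linD symD psdD \<open>\<eta> > 0\<close>])
       (rule that; assumption)
  interpret A: bounded_linear A using A by (simp add: linear_conv_bounded_linear)
  define P where "P = c *\<^sub>R (z' - z)"
  obtain t x s y where z': "z' = ((t, x), (s, y))" by (metis surj_pair)
  have inQ: "(t, x) \<in> Q" "(s, y) \<in> Q" using z'Q z' by auto
  obtain a p b q where Pabq: "P = ((a, p), (b, q))" by (metis surj_pair)
  have PD': "norm (P - D z') \<le> \<eta>" using PD unfolding P_def .
  have diff: "P - D z' = ((a - \<gamma> * (t - s), p - (\<alpha> *\<^sub>R (x - y) + (2 * \<beta>) *\<^sub>R x)), (b - \<gamma> * (s - t), q - \<alpha> *\<^sub>R (y - x)))"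
    unfolding Pabq z' D_def by simp
  have n1: "norm (fst (P - D z')) \<le> \<eta>" "norm (snd (P - D z')) \<le> \<eta>"
  proof -
    have "norm (fst w) \<le> norm w" "norm (snd w) \<le> norm w" for w :: "(real \<times> 'a) \<times> (real \<times> 'a)"
      by (cases w; simp add: norm_fst_le norm_snd_le)+
    from this[of "P - D z'"] show "norm (fst (P - D z')) \<le> \<eta>" "norm (snd (P - D z')) \<le> \<eta>"
      using PD' by linarith+
  qed
  have n2: "norm (a - \<gamma> * (t - s)) \<le> \<eta>" "norm (p - (\<alpha> *\<^sub>R (x - y) + (2 * \<beta>) *\<^sub>R x)) \<le> \<eta>"
    "norm (b - \<gamma> * (s - t)) \<le> \<eta>" "norm (q - \<alpha> *\<^sub>R (y - x)) \<le> \<eta>"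
    using n1 unfolding diff fst_conv snd_conv
    by (meson norm_fst_le norm_snd_le order_trans)+
  define AU where "AU u = fst (A (u, 0))" for u
  define AV where "AV u = snd (A (0, u))" for u
  have linAU: "linear AU" unfolding AU_def
  proof (rule linearI)
    fix b1 b2 :: "real \<times> 'a" and r :: real
    show "fst (A (b1 + b2, 0)) = fst (A (b1, 0)) + fst (A (b2, 0))" using A.add[of "(b1, 0)" "(b2, 0)"] by simp
    show "fst (A (r *\<^sub>R b1, 0)) = r *\<^sub>R fst (A (b1, 0))" using A.scaleR[of r "(b1, 0)"] by simp
  qed
  have linAV: "linear AV" unfolding AV_def
  proof (rule linearI)
    fix b1 b2 :: "real \<times> 'a" and r :: real
    show "snd (A (0, b1 + b2)) = snd (A (0, b1)) + snd (A (0, b2))" using A.add[of "(0, b1)" "(0, b2)"] by simp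
    show "snd (A (0, r *\<^sub>R b1)) = r *\<^sub>R snd (A (0, b1))" using A.scaleR[of r "(0, b1)"] by simp
  qed
  have AUf: "A (u, 0) \<bullet> (u, 0) = AU u \<bullet> u" and AVf: "A (0, u) \<bullet> (0, u) = AV u \<bullet> u" for u
    unfolding AU_def AV_def by (cases "A (u, 0)", simp) (cases "A (0, u)", simp)
  \<comment> \<open>The mixed difference of \<open>S\<close> at \<open>z\<close> vanishes, so the
    off-diagonal part of \<open>A\<close> contributes nothing up to the error of the expansion,
    which is removed by scaling.\<close>
  have block: "AU u \<bullet> u + AV v \<bullet> v \<le> A (u, v) \<bullet> (u, v)" for u v
  proof (rule le_of_scaled_expansion[where w="4 * ((norm u)\<^sup>2 + (norm v)\<^sup>2)"])
    fix e :: real assume "e > 0"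
    then obtain d where d: "d > 0" "\<And>h. norm h < d \<Longrightarrow> \<bar>S (z + h) - S z - P \<bullet> h - A h \<bullet> h / 2\<bar> \<le> e * (norm h)\<^sup>2"
      using exp unfolding P_def by blast
    show "\<exists>d>0. \<forall>t. 0 < t \<longrightarrow> t < d \<longrightarrow> t\<^sup>2 * (AU u \<bullet> u + AV v \<bullet> v) \<le> t\<^sup>2 * (A (u, v) \<bullet> (u, v)) + e * (t\<^sup>2 * (4 * ((norm u)\<^sup>2 + (norm v)\<^sup>2)))"
    proof (intro exI[of _ "d / (norm u + norm v + 1)"] conjI allI impI)
      show "d / (norm u + norm v + 1) > 0" using d by (simp add: add_nonneg_pos)
      fix r assume r: "0 < r" "r < d / (norm u + norm v + 1)"
      have "r * (norm u + norm v + 1) < d" using r(2) by (simp add: pos_less_divide_eq add_nonneg_pos)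
      then have rd: "r * norm u + r * norm v < d" using r by (simp add: algebra_simps)
      have nn: "0 \<le> r * norm u" "0 \<le> r * norm v" using r by auto
      have 1: "norm (r *\<^sub>R u, 0 :: real \<times> 'a) < d" "norm (0 :: real \<times> 'a, r *\<^sub>R v) < d"
      proof -
        have "r * norm u < d" "r * norm v < d" using rd nn by linarith+
        then show "norm (r *\<^sub>R u, 0 :: real \<times> 'a) < d" "norm (0 :: real \<times> 'a, r *\<^sub>R v) < d"
          using r by (simp_all add: norm_Pair)
      qed
      have 2: "norm (r *\<^sub>R u, r *\<^sub>R v) < d"
        using norm_triangle_ineq[of "(r *\<^sub>R u, 0 :: real \<times> 'a)" "(0 :: real \<times> 'a, r *\<^sub>R v)"] rd r by (simp add: norm_Pair)
      have sep: "S (z + (r *\<^sub>R u, 0)) + S (z + (0, r *\<^sub>R v)) = S (z + (r *\<^sub>R u, r *\<^sub>R v)) + S z"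
        using sup_convolution_separable[of c Q Q U "\<lambda>\<zeta>. - V \<zeta>" S "fst z + r *\<^sub>R u" "snd z" "fst z" "snd z + r *\<^sub>R v"] S
        unfolding H_def by (cases z) simp
      have Psp: "P \<bullet> (r *\<^sub>R u, r *\<^sub>R v) = P \<bullet> (r *\<^sub>R u, 0) + P \<bullet> (0, r *\<^sub>R v)"
        unfolding Pabq by simp
      have sc: "A (r *\<^sub>R w) \<bullet> (r *\<^sub>R w) = r\<^sup>2 * (A w \<bullet> w)" for w
        by (simp add: A.scaleR power2_eq_square)
      have E: "A (r *\<^sub>R u, 0) \<bullet> (r *\<^sub>R u, 0) = r\<^sup>2 * (AU u \<bullet> u)" "A (0, r *\<^sub>R v) \<bullet> (0, r *\<^sub>R v) = r\<^sup>2 * (AV v \<bullet> v)"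
        "A (r *\<^sub>R u, r *\<^sub>R v) \<bullet> (r *\<^sub>R u, r *\<^sub>R v) = r\<^sup>2 * (A (u, v) \<bullet> (u, v))"
        using sc[of "(u, 0)"] sc[of "(0, v)"] sc[of "(u, v)"] AUf[of u] AVf[of v] by simp_all
      have N: "(norm (r *\<^sub>R u, 0 :: real \<times> 'a))\<^sup>2 = r\<^sup>2 * (norm u)\<^sup>2" "(norm (0 :: real \<times> 'a, r *\<^sub>R v))\<^sup>2 = r\<^sup>2 * (norm v)\<^sup>2"
        "(norm (r *\<^sub>R u, r *\<^sub>R v))\<^sup>2 = r\<^sup>2 * (norm u)\<^sup>2 + r\<^sup>2 * (norm v)\<^sup>2"
        using r by (simp_all add: norm_Pair power_mult_distrib)
      have "r\<^sup>2 * (AU u \<bullet> u) + r\<^sup>2 * (AV v \<bullet> v) \<le> r\<^sup>2 * (A (u, v) \<bullet> (u, v)) + 4 * (e * (r\<^sup>2 * (norm u)\<^sup>2) + e * (r\<^sup>2 * (norm v)\<^sup>2))"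
        using d(2)[OF 1(1)] d(2)[OF 1(2)] d(2)[OF 2] sep Psp unfolding E N by (simp add: distrib_left)
      then show "r\<^sup>2 * (AU u \<bullet> u + AV v \<bullet> v) \<le> r\<^sup>2 * (A (u, v) \<bullet> (u, v)) + e * (r\<^sup>2 * (4 * ((norm u)\<^sup>2 + (norm v)\<^sup>2)))"
        by (simp add: algebra_simps)
    qed
  qed simp
  obtain d where d: "d > 0" "\<And>h. norm h < d \<Longrightarrow> \<bar>S (z + h) - S z - P \<bullet> h - A h \<bullet> h / 2\<bar> \<le> \<eta> / 4 * (norm h)\<^sup>2"
    using exp[OF e4] unfolding P_def by blast
  obtain X1 C1 where X1: "linear X1" "\<And>\<tau> h. AU (\<tau>, h) \<bullet> (\<tau>, h) \<le> X1 h \<bullet> h + C1 * \<tau>\<^sup>2"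
    "\<And>h. X1 h \<bullet> h = AU (0, h) \<bullet> (0, h) + \<eta> / 2 * (norm h)\<^sup>2"
    using space_time_form_bound[OF linAU e2] by blast
  obtain Y1 C2 where Y1: "linear Y1" "\<And>\<tau> h. AV (\<tau>, h) \<bullet> (\<tau>, h) \<le> Y1 h \<bullet> h + C2 * \<tau>\<^sup>2"
    "\<And>h. Y1 h \<bullet> h = AV (0, h) \<bullet> (0, h) + \<eta> / 2 * (norm h)\<^sup>2"
    using space_time_form_bound[OF linAV e2] by blast
  \<comment> \<open>Of the total \<open>\<eta> * (norm h)\<^sup>2\<close> in the form of
    \<open>X\<close>, one half pays for the cross terms and the other for the expansion error
    \<open>\<eta> / 4\<close>, which doubles because forms enter with the factor
    \<open>1 / 2\<close>.\<close>
  define X where "X h = X1 h + (\<eta> / 2) *\<^sub>R h" for h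
  define Y where "Y h = - (Y1 h + (\<eta> / 2) *\<^sub>R h)" for h
  define C where "C = max (C1 / 2) (C2 / 2) + \<eta> / 4"
  have linX: "linear X" unfolding X_def by (intro linear_compose_add X1 linear_scale_self)
  have linY: "linear Y" unfolding Y_def by (intro linear_compose_neg linear_compose_add Y1 linear_scale_self)
  have Xf: "X h \<bullet> h = X1 h \<bullet> h + \<eta> / 2 * (norm h)\<^sup>2" and Yf: "Y h \<bullet> h = - (Y1 h \<bullet> h) - \<eta> / 2 * (norm h)\<^sup>2" for h
    unfolding X_def Y_def by (simp_all add: inner_add_left inner_diff_left power2_norm_eq_inner)
  \<comment> \<open>Shifting \<open>z\<close> and \<open>z'\<close> by the same increment leaves
    their distance unchanged, so an upper expansion of \<open>S\<close> at \<open>z\<close> is one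
    of \<open>H\<close> at \<open>z'\<close>.\<close>
  have Hle: "H (z' + k) - H z' \<le> P \<bullet> k + A k \<bullet> k / 2 + \<eta> / 4 * (norm k)\<^sup>2" if "z' + k \<in> Q \<times> Q" "norm k < d" for k
  proof -
    have "H (z' + k) - c / 2 * (norm (z + k - (z' + k)))\<^sup>2 \<le> S (z + k)"
      using S that(1) unfolding is_sup_convolution_def by metis
    moreover have "z + k - (z' + k) = z - z'" by simp
    ultimately have "H (z' + k) - c / 2 * (norm (z - z'))\<^sup>2 \<le> S (z + k)" by simp
    then show ?thesis using Sz abs_le_D1[OF d(2)[OF that(2)]] by linarith
  qed
  have CC: "C1 / 2 * \<tau>\<^sup>2 + \<eta> / 4 * \<tau>\<^sup>2 \<le> C * \<tau>\<^sup>2" "C2 / 2 * \<tau>\<^sup>2 + \<eta> / 4 * \<tau>\<^sup>2 \<le> C * \<tau>\<^sup>2" for \<tau>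
    unfolding C_def distrib_right[symmetric] by (intro mult_right_mono; simp)+
  show ?thesis
  \<comment> \<open>\<open>V\<close> enters \<open>H\<close> with a minus sign, hence the reversed
    signs of \<open>b\<close>, \<open>q\<close> and the lower block.\<close>
  proof (rule that[OF inQ d(1), of a "-b" p "-q" X Y C])
    show "\<bar>a - \<gamma> * (t - s)\<bar> \<le> \<eta>" "norm (p - (\<alpha> *\<^sub>R (x - y) + (2 * \<beta>) *\<^sub>R x)) \<le> \<eta>" using n2 by auto
    have "\<bar>- b - \<gamma> * (t - s)\<bar> = norm (b - \<gamma> * (s - t))" by (simp add: algebra_simps abs_minus_commute)
    then show "\<bar>- b - \<gamma> * (t - s)\<bar> \<le> \<eta>" using n2(3) by simp
    have "- q - \<alpha> *\<^sub>R (x - y) = - (q - \<alpha> *\<^sub>R (y - x))" by (simp add: algebra_simps)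
    then show "norm (- q - \<alpha> *\<^sub>R (x - y)) \<le> \<eta>" using n2(4) by (simp only: norm_minus_cancel)
    show "linear X" "linear Y" by (rule linX, rule linY)
    fix t1 x1 s1 y1 assume "(t1, x1) \<in> Q" "(s1, y1) \<in> Q"
    then have "((t1, x1), (s1, y1)) \<in> Q \<times> Q" by simp
    from opt[OF this]
    show "U (t1, x1) - V (s1, y1) - (\<alpha> / 2 * (norm (x1 - y1))\<^sup>2 + \<gamma> / 2 * (t1 - s1)\<^sup>2 + \<beta> * (norm x1)\<^sup>2)
       \<le> U (t, x) - V (s, y) - (\<alpha> / 2 * (norm (x - y))\<^sup>2 + \<gamma> / 2 * (t - s)\<^sup>2 + \<beta> * (norm x)\<^sup>2) + \<eta>"
      unfolding z' D_form H_def by (simp add: add_divide_distrib)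
  next
    fix \<tau> h assume *: "norm (\<tau>, h) < d" "(t + \<tau>, x + h) \<in> Q"
    let ?k = "((\<tau>, h), (0, 0)) :: (real \<times> 'a) \<times> (real \<times> 'a)"
    have nk: "norm ?k = norm (\<tau>, h)" by (simp add: norm_Pair)
    have "H (z' + ?k) - H z' \<le> P \<bullet> ?k + A ?k \<bullet> ?k / 2 + \<eta> / 4 * (norm ?k)\<^sup>2"
      by (rule Hle) (use * inQ nk in \<open>auto simp: z'\<close>)
    moreover have "A ?k \<bullet> ?k \<le> X1 h \<bullet> h + C1 * \<tau>\<^sup>2"
      using X1(2)[of \<tau> h] AUf[of "(\<tau>, h)"] by (simp add: zero_prod_def)
    moreover have "(norm ?k)\<^sup>2 = \<tau>\<^sup>2 + (norm h)\<^sup>2" unfolding nk by (simp add: norm_Pair)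
    ultimately show "U (t + \<tau>, x + h) \<le> U (t, x) + a * \<tau> + p \<bullet> h + X h \<bullet> h / 2 + C * \<tau>\<^sup>2"
      using CC(1)[of \<tau>] unfolding Xf z' Pabq H_def by (simp add: distrib_left add_divide_distrib)
  next
    fix \<tau> h assume *: "norm (\<tau>, h) < d" "(s + \<tau>, y + h) \<in> Q"
    let ?k = "((0, 0), (\<tau>, h)) :: (real \<times> 'a) \<times> (real \<times> 'a)"
    have nk: "norm ?k = norm (\<tau>, h)" by (simp add: norm_Pair)
    have "H (z' + ?k) - H z' \<le> P \<bullet> ?k + A ?k \<bullet> ?k / 2 + \<eta> / 4 * (norm ?k)\<^sup>2"
      by (rule Hle) (use * inQ nk in \<open>auto simp: z'\<close>)
    moreover have "A ?k \<bullet> ?k \<le> Y1 h \<bullet> h + C2 * \<tau>\<^sup>2"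
      using Y1(2)[of \<tau> h] AVf[of "(\<tau>, h)"] by (simp add: zero_prod_def)
    moreover have "(norm ?k)\<^sup>2 = \<tau>\<^sup>2 + (norm h)\<^sup>2" unfolding nk by (simp add: norm_Pair)
    ultimately show "V (s, y) + - b * \<tau> + - q \<bullet> h + Y h \<bullet> h / 2 - C * \<tau>\<^sup>2 \<le> V (s + \<tau>, y + h)"
      using CC(2)[of \<tau>] unfolding Yf z' Pabq H_def by (simp add: distrib_left diff_divide_distrib)
  next
    fix h k
    have "AU (0, h) \<bullet> (0, h) + AV (0, k) \<bullet> (0, k) \<le> A ((0, h), (0, k)) \<bullet> ((0, h), (0, k))" by (rule block)
    also have "\<dots> \<le> D ((0, h), (0, k)) \<bullet> ((0, h), (0, k))" by (rule A(2))
    also have "\<dots> = \<alpha> * (norm (h - k))\<^sup>2 + 2 * \<beta> * (norm h)\<^sup>2" unfolding D_form by simp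
    finally have le: "AU (0, h) \<bullet> (0, h) + AV (0, k) \<bullet> (0, k) \<le> \<alpha> * (norm (h - k))\<^sup>2 + 2 * \<beta> * (norm h)\<^sup>2" .
    have nn: "0 \<le> \<eta> * (norm h)\<^sup>2" "0 \<le> \<eta> * (norm k)\<^sup>2" using par by auto
    have "X h \<bullet> h / 2 - Y k \<bullet> k / 2 = (AU (0, h) \<bullet> (0, h) + AV (0, k) \<bullet> (0, k)) / 2 + (\<eta> * (norm h)\<^sup>2) / 2 + (\<eta> * (norm k)\<^sup>2) / 2"
      unfolding Xf Yf X1(3) Y1(3) by (simp add: field_simps)
    also have "\<dots> \<le> (\<alpha> * (norm (h - k))\<^sup>2 + 2 * \<beta> * (norm h)\<^sup>2) / 2 + \<eta> * (norm h)\<^sup>2 + \<eta> * (norm k)\<^sup>2"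
      unfolding add_divide_distrib using le nn by linarith
    also have "\<dots> = \<alpha> / 2 * (norm (h - k))\<^sup>2 + \<beta> * (norm h)\<^sup>2 + \<eta> * ((norm h)\<^sup>2 + (norm k)\<^sup>2)"
      by (simp add: field_simps)
    finally show "X h \<bullet> h / 2 - Y k \<bullet> k / 2 \<le> \<alpha> / 2 * (norm (h - k))\<^sup>2 + \<beta> * (norm h)\<^sup>2 + \<eta> * ((norm h)\<^sup>2 + (norm k)\<^sup>2)" .
  qed
qed

section \<open>Quadratic forms of matrices\<close>

text \<open>Turns the second-order term into values of a quadratic form at the columns of the
  diffusion matrix, where the inequality for \<open>X\<close> and \<open>Y\<close> can be applied
  column by column.\<close>

lemma trace_quadratic_form:
  fixes A :: "real^'d^'n" and X :: "real^'n^'n"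
  shows "trace (A ** transpose A ** X) = (\<Sum>j\<in>UNIV. (X *v column j A) \<bullet> column j A)"
proof -
  have "trace (A ** transpose A ** X) = (\<Sum>i\<in>UNIV. \<Sum>k\<in>UNIV. \<Sum>j\<in>UNIV. A $ i $ j * A $ k $ j * X $ k $ i)"
    unfolding trace_def matrix_matrix_mult_def transpose_def by (simp add: sum_distrib_right)
  also have "\<dots> = (\<Sum>k\<in>UNIV. \<Sum>i\<in>UNIV. \<Sum>j\<in>UNIV. A $ i $ j * A $ k $ j * X $ k $ i)"
    by (rule sum.swap)
  also have "\<dots> = (\<Sum>k\<in>UNIV. \<Sum>j\<in>UNIV. \<Sum>i\<in>UNIV. A $ i $ j * A $ k $ j * X $ k $ i)"
    by (intro sum.cong refl sum.swap)
  also have "\<dots> = (\<Sum>j\<in>UNIV. \<Sum>k\<in>UNIV. \<Sum>i\<in>UNIV. A $ i $ j * A $ k $ j * X $ k $ i)"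
    by (rule sum.swap)
  also have "\<dots> = (\<Sum>j\<in>UNIV. (X *v column j A) \<bullet> column j A)"
    unfolding inner_vec_def matrix_vector_mult_def column_def
    by (simp add: sum_distrib_left sum_distrib_right mult_ac)
  finally show ?thesis .
qed

lemma vector_matrix_mult_component: "(p v* (A :: real^'d^'n)) $ j = p \<bullet> column j A"
  unfolding vector_matrix_mult_def inner_vec_def column_def by (simp add: mult.commute)

lemma sum_norm_column_sq: "(\<Sum>j\<in>UNIV. (norm (column j A))\<^sup>2) = (norm (A :: real^'d^'n))\<^sup>2"
  unfolding power2_norm_eq_inner inner_vec_def column_def
  by (subst sum.swap) simp

lemma norm_vector_matrix_mult_sq: "(norm (p v* (A :: real^'d^'n)))\<^sup>2 = (\<Sum>j\<in>UNIV. (p \<bullet> column j A)\<^sup>2)"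
proof -
  have "(norm (p v* A))\<^sup>2 = (\<Sum>j\<in>UNIV. (p v* A) $ j * (p v* A) $ j)"
    unfolding power2_norm_eq_inner inner_vec_def by simp
  then show ?thesis unfolding vector_matrix_mult_component by (simp add: power2_eq_square)
qed

lemma norm_vector_matrix_mult_le: "norm (p v* (A :: real^'d^'n)) \<le> norm p * norm A"
proof -
  have "(norm (p v* A))\<^sup>2 \<le> (\<Sum>j\<in>UNIV. (norm p)\<^sup>2 * (norm (column j A))\<^sup>2)"
    unfolding norm_vector_matrix_mult_sq
  proof (rule sum_mono)
    fix j show "(p \<bullet> column j A)\<^sup>2 \<le> (norm p)\<^sup>2 * (norm (column j A))\<^sup>2"
      using Cauchy_Schwarz_ineq[of p "column j A"] by (simp add: power2_norm_eq_inner)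
  qed
  also have "\<dots> = (norm p * norm A)\<^sup>2"
    unfolding sum_distrib_left[symmetric] sum_norm_column_sq by (simp add: power_mult_distrib)
  finally show ?thesis by (rule power2_le_imp_le) simp
qed

lemma vector_matrix_mult_scaleR: "(c *\<^sub>R p) v* (A :: real^'d^'n) = c *\<^sub>R (p v* A)"
  by (simp add: vec_eq_iff vector_matrix_mult_component)

lemma vector_matrix_mult_diff: "(p - q) v* (A :: real^'d^'n) = p v* A - q v* A"
  by (simp add: vec_eq_iff vector_matrix_mult_component inner_diff_left)

lemma vector_matrix_mult_diff_right: "p v* (A - B :: real^'d^'n) = p v* A - p v* B"
  by (simp add: vec_eq_iff vector_matrix_mult_def sum_subtractf algebra_simps)

lemma column_diff: "column j (A - B) = column j A - column j (B :: real^'d^'n)"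
  and column_scaleR: "column j (c *\<^sub>R A) = c *\<^sub>R column j A"
  unfolding column_def by (simp_all add: vec_eq_iff)

definition outer :: "real^'n \<Rightarrow> real^'n^'n" where
  "outer v = (\<chi> i j. v $ i * v $ j)"

lemma outer_mult: "outer v *v h = (v \<bullet> h) *\<^sub>R v"
  unfolding outer_def matrix_vector_mult_def inner_vec_def
  by (simp add: vec_eq_iff sum_distrib_left mult_ac)

text \<open>The expansions supply only a linear map. Its symmetric part has the same quadratic form
  and is the Hessian of half that form, as a test function requires.\<close>

lemma symmetric_matrix_of_form:
  fixes X :: "real^'n \<Rightarrow> real^'n"
  assumes "linear X"
  obtains M :: "real^'n^'n" where "\<And>h k. (M *v h) \<bullet> k = (M *v k) \<bullet> h" "\<And>h. (M *v h) \<bullet> h = X h \<bullet> h"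
proof -
  have lin: "Vector_Spaces.linear (*s) (*s) X" using assms by (simp add: linear_matrix_vector_mul_eq)
  define M where "M = (1/2) *\<^sub>R (matrix X + transpose (matrix X))"
  have 1: "(transpose (matrix X) *v h) \<bullet> k = X k \<bullet> h" for h k
  proof -
    have "(transpose (matrix X) *v h) \<bullet> k = h \<bullet> (matrix X *v k)"
      by (simp only: transpose_matrix_vector dot_lmul_matrix)
    then show ?thesis by (simp only: matrix_works[OF lin] inner_commute)
  qed
  have "(M *v h) \<bullet> k = (X h \<bullet> k + X k \<bullet> h) / 2" for h k
    unfolding M_def by (simp add: scaleR_matrix_vector_assoc[symmetric] matrix_vector_mult_add_rdistrib
      matrix_works[OF lin] 1 inner_add_left del: transpose_matrix_vector)
  note MX = this
  show ?thesis by (rule that[of M]) (simp_all add: MX)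
qed

section \<open>Smooth test functions\<close>

text \<open>Chain rule for the concave change of variable; its second derivative produces the
  negative rank-one term that later yields the squared gradient.\<close>

lemma C12_compose_exp:
  assumes "C12 T \<omega> \<omega>t D\<omega> D2\<omega>"
  shows "C12 T (\<lambda>t x. \<omega> t x - \<delta> * exp (- \<omega> t x)) (\<lambda>t x. (1 + \<delta> * exp (- \<omega> t x)) * \<omega>t t x)
     (\<lambda>t x. (1 + \<delta> * exp (- \<omega> t x)) *\<^sub>R D\<omega> t x)
     (\<lambda>t x. (1 + \<delta> * exp (- \<omega> t x)) *\<^sub>R D2\<omega> t x - (\<delta> * exp (- \<omega> t x)) *\<^sub>R outer (D\<omega> t x))"
proof -
  have d: "((\<lambda>s. \<omega> s x) has_real_derivative \<omega>t t x) (at t within {0..T})"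
    "(\<omega> t has_derivative (\<lambda>h. h \<bullet> D\<omega> t x)) (at x)"
    "(D\<omega> t has_derivative (\<lambda>h. D2\<omega> t x *v h)) (at x)" if "t \<in> {0..T}" for t x
    using assms that unfolding C12_def gderiv_def by auto
  have c: "continuous_on ({0..T} \<times> UNIV) (\<lambda>z. \<omega> (fst z) (snd z))"
    "continuous_on ({0..T} \<times> UNIV) (\<lambda>z. \<omega>t (fst z) (snd z))"
    "continuous_on ({0..T} \<times> UNIV) (\<lambda>z. D\<omega> (fst z) (snd z))"
    "continuous_on ({0..T} \<times> UNIV) (\<lambda>z. D2\<omega> (fst z) (snd z))"
    using assms unfolding C12_def split_def by auto
  have o: "continuous_on ({0..T} \<times> UNIV) (\<lambda>z. outer (D\<omega> (fst z) (snd z)))"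
    unfolding outer_def by (intro continuous_intros c)
  show ?thesis
    unfolding C12_def gderiv_def split_def
  proof (intro conjI ballI allI)
    fix t x assume t: "t \<in> {0..T}"
    show "((\<lambda>s. \<omega> s x - \<delta> * exp (- \<omega> s x)) has_real_derivative (1 + \<delta> * exp (- \<omega> t x)) * \<omega>t t x) (at t within {0..T})"
      by (auto intro!: derivative_eq_intros d(1)[OF t] simp: algebra_simps)
    show "((\<lambda>x. \<omega> t x - \<delta> * exp (- \<omega> t x)) has_derivative (\<lambda>h. h \<bullet> ((1 + \<delta> * exp (- \<omega> t x)) *\<^sub>R D\<omega> t x))) (at x)"
      by (rule derivative_eq_intros d(2)[OF t] refl)+ (auto simp: algebra_simps)
    show "((\<lambda>x. (1 + \<delta> * exp (- \<omega> t x)) *\<^sub>R D\<omega> t x) has_derivative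
        (\<lambda>h. ((1 + \<delta> * exp (- \<omega> t x)) *\<^sub>R D2\<omega> t x - (\<delta> * exp (- \<omega> t x)) *\<^sub>R outer (D\<omega> t x)) *v h)) (at x)"
      by (rule derivative_eq_intros d(2)[OF t] d(3)[OF t] refl)+
         (auto simp: matrix_vector_mult_diff_rdistrib scaleR_matrix_vector_assoc[symmetric] outer_mult inner_commute algebra_simps)
  qed (auto intro!: continuous_intros c o)
qed

text \<open>The test function for the unweighted problem: a paraboloid touching the weighted
  function, with the time penalty restored and the weight \<open>exp (l * t)\<close>
  removed.\<close>

lemma C12_exp_quadratic:
  fixes M :: "real^'n^'n" and x0 p :: "real^'n" and l c0 a t0 C B N :: real
  assumes sym: "\<And>h k. (M *v h) \<bullet> k = (M *v k) \<bullet> h"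
  defines "\<omega> \<equiv> \<lambda>t x. exp (- (l * t)) * (c0 + a * (t - t0) + p \<bullet> (x - x0) + (M *v (x - x0)) \<bullet> (x - x0) / 2
      + C * (t - t0)\<^sup>2 + B * exp (- (N * t)))"
  shows "C12 T \<omega> (\<lambda>t x. - l * \<omega> t x + exp (- (l * t)) * (a + 2 * C * (t - t0) - B * N * exp (- (N * t))))
     (\<lambda>t x. exp (- (l * t)) *\<^sub>R (p + M *v (x - x0))) (\<lambda>t x. exp (- (l * t)) *\<^sub>R M)"
proof -
  have Mc: "continuous_on A (\<lambda>z. M *v (snd z - x0))" for A :: "(real \<times> (real^'n)) set"
    by (intro bounded_linear.continuous_on[OF matrix_vector_mul_bounded_linear] continuous_intros)
  have Md: "((\<lambda>x. M *v (x - x0)) has_derivative (\<lambda>h. M *v h)) (at x)" for x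
    by (rule bounded_linear.has_derivative[OF matrix_vector_mul_bounded_linear])
       (auto intro!: derivative_eq_intros)
  show ?thesis
    unfolding C12_def gderiv_def split_def \<omega>_def
  proof (intro conjI ballI allI)
    fix t x assume t: "t \<in> {0..T}"
    show "((\<lambda>s. exp (- (l * s)) * (c0 + a * (s - t0) + p \<bullet> (x - x0) + (M *v (x - x0)) \<bullet> (x - x0) / 2
      + C * (s - t0)\<^sup>2 + B * exp (- (N * s)))) has_real_derivative
       - l * (exp (- (l * t)) * (c0 + a * (t - t0) + p \<bullet> (x - x0) + (M *v (x - x0)) \<bullet> (x - x0) / 2
      + C * (t - t0)\<^sup>2 + B * exp (- (N * t)))) + exp (- (l * t)) * (a + 2 * C * (t - t0) - B * N * exp (- (N * t)))) (at t within {0..T})"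
      by (rule derivative_eq_intros refl)+ (simp add: algebra_simps)
    show "((\<lambda>x. exp (- (l * t)) * (c0 + a * (t - t0) + p \<bullet> (x - x0) + (M *v (x - x0)) \<bullet> (x - x0) / 2
      + C * (t - t0)\<^sup>2 + B * exp (- (N * t)))) has_derivative (\<lambda>h. h \<bullet> (exp (- (l * t)) *\<^sub>R (p + M *v (x - x0))))) (at x)"
    proof -
      have qd: "((\<lambda>x. p \<bullet> (x - x0) + (M *v (x - x0)) \<bullet> (x - x0) / 2) has_derivative (\<lambda>h. h \<bullet> (p + M *v (x - x0)))) (at x)"
        by (rule derivative_eq_intros Md refl)+
           (auto simp: sym[of _ "x - x0"] inner_add_right inner_commute)
      define k where "k = c0 + a * (t - t0) + C * (t - t0)\<^sup>2 + B * exp (- (N * t))"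
      have "((\<lambda>x. exp (- (l * t)) * (p \<bullet> (x - x0) + (M *v (x - x0)) \<bullet> (x - x0) / 2 + k)) has_derivative
          (\<lambda>h. exp (- (l * t)) * (h \<bullet> (p + M *v (x - x0)) + 0))) (at x)"
        by (intro has_derivative_mult_right has_derivative_add qd has_derivative_const)
      then show ?thesis unfolding k_def by (simp add: add_ac)
    qed
    show "((\<lambda>x. exp (- (l * t)) *\<^sub>R (p + M *v (x - x0))) has_derivative (\<lambda>h. (exp (- (l * t)) *\<^sub>R M) *v h)) (at x)"
      by (rule derivative_eq_intros Md refl)+ (simp add: scaleR_matrix_vector_assoc)
  qed (auto intro!: continuous_intros Mc)
qed

section \<open>Semijets of sub- and supersolutions\<close>

text \<open>The quantitative content of the assumptions. The modulus of \<open>f\<close> in time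
  depends on a bound \<open>Z\<close> for the gradient argument, which forces the order of the later
  choices.\<close>

locale hjb_data =
  fixes T :: real and U :: "(real^'k) set"
    and b :: "real \<Rightarrow> real^'n \<Rightarrow> real^'k \<Rightarrow> real^'n"
    and \<sigma> :: "real \<Rightarrow> real^'n \<Rightarrow> real^'k \<Rightarrow> real^'d^'n"
    and f :: "real \<Rightarrow> real^'n \<Rightarrow> real \<Rightarrow> real^'d \<Rightarrow> real^'k \<Rightarrow> real"
    and G :: "real^'m^'n" and K :: "real^'m" and L M0 F0 k0 :: real
  assumes T_pos: "T > 0" and U_ne: "U \<noteq> {}"
    and const_pos: "L > 0" "M0 \<ge> 0" "F0 \<ge> 0" "k0 > 0"
    and lip_b: "t \<in> {0..T} \<Longrightarrow> norm (b t x v - b t y v) \<le> L * norm (x - y)"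
    and lip_\<sigma>: "t \<in> {0..T} \<Longrightarrow> norm (\<sigma> t x v - \<sigma> t y v) \<le> L * norm (x - y)"
    and lip_f: "t \<in> {0..T} \<Longrightarrow> \<bar>f t x r z v - f t x' r' z' v\<bar> \<le> L * (norm (x - x') + \<bar>r - r'\<bar> + norm (z - z'))"
    and bnd_b: "t \<in> {0..T} \<Longrightarrow> norm (b t x v) \<le> M0"
    and bnd_\<sigma>: "t \<in> {0..T} \<Longrightarrow> norm (\<sigma> t x v) \<le> M0"
    and bnd_f: "t \<in> {0..T} \<Longrightarrow> v \<in> U \<Longrightarrow> \<bar>f t x 0 0 v\<bar> \<le> F0"
    and time_modulus: "\<epsilon> > 0 \<Longrightarrow> \<exists>\<tau>>0. \<forall>t\<in>{0..T}. \<forall>s\<in>{0..T}. \<bar>t - s\<bar> \<le> \<tau> \<longrightarrow>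
        (\<forall>x v. norm (b t x v - b s x v) \<le> \<epsilon> \<and> norm (\<sigma> t x v - \<sigma> s x v) \<le> \<epsilon>)"
    and time_modulus_f: "\<epsilon> > 0 \<Longrightarrow> \<exists>\<tau>>0. \<forall>t\<in>{0..T}. \<forall>s\<in>{0..T}. \<bar>t - s\<bar> \<le> \<tau> \<longrightarrow>
        (\<forall>x r z v. norm z \<le> Z \<longrightarrow> \<bar>f t x r z v - f s x r z v\<bar> \<le> \<epsilon>)"
    and K_ge: "K $ i \<ge> k0"
begin

lemma f_growth:
  assumes "t \<in> {0..T}" "v \<in> U"
  shows "\<bar>f t x r z v\<bar> \<le> F0 + L * (\<bar>r\<bar> + norm z)"
  using lip_f[OF assms(1), of x r z v x 0 0] bnd_f[OF assms, of x] by (simp add: algebra_simps)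

text \<open>On reals an infimum is below its values only for sets bounded below, and the subsolution
  inequality is used at an arbitrary control.\<close>

lemma hamiltonian_bdd_below:
  assumes t: "t \<in> {0..T}"
  shows "bdd_below ((\<lambda>v. generator b \<sigma> t x v p X + f t x r (p v* \<sigma> t x v) v) ` U)"
proof -
  obtain B where B: "B > 0" "\<And>h. norm (X *v h) \<le> B * norm h"
    using bounded_linear.pos_bounded[OF matrix_vector_mul_bounded_linear, of X] by (auto simp: mult.commute)
  have M0: "M0 \<ge> 0" by (rule const_pos)
  have "- (1/2 * (B * M0\<^sup>2) + norm p * M0 + F0 + L * (\<bar>r\<bar> + norm p * M0)) \<le>
      generator b \<sigma> t x v p X + f t x r (p v* \<sigma> t x v) v" if v: "v \<in> U" for v
  proof -
    have "\<bar>\<Sum>j\<in>UNIV. (X *v column j (\<sigma> t x v)) \<bullet> column j (\<sigma> t x v)\<bar>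
      \<le> (\<Sum>j\<in>UNIV. \<bar>(X *v column j (\<sigma> t x v)) \<bullet> column j (\<sigma> t x v)\<bar>)" by (rule sum_abs)
    also have "\<dots> \<le> (\<Sum>j\<in>UNIV. B * (norm (column j (\<sigma> t x v)))\<^sup>2)"
    proof (rule sum_mono)
      fix j
      show "\<bar>(X *v column j (\<sigma> t x v)) \<bullet> column j (\<sigma> t x v)\<bar> \<le> B * (norm (column j (\<sigma> t x v)))\<^sup>2"
        using order_trans[OF Cauchy_Schwarz_ineq2 mult_right_mono[OF B(2)[of "column j (\<sigma> t x v)"] norm_ge_zero]]
        by (simp add: power2_eq_square mult.assoc)
    qed
    also have "\<dots> = B * (norm (\<sigma> t x v))\<^sup>2" by (simp add: sum_distrib_left[symmetric] sum_norm_column_sq)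
    also have "\<dots> \<le> B * M0\<^sup>2" using B bnd_\<sigma>[OF t] by (intro mult_left_mono power_mono) auto
    finally have 1: "\<bar>\<Sum>j\<in>UNIV. (X *v column j (\<sigma> t x v)) \<bullet> column j (\<sigma> t x v)\<bar> \<le> B * M0\<^sup>2" .
    have "\<bar>p \<bullet> b t x v\<bar> \<le> norm p * norm (b t x v)" by (rule Cauchy_Schwarz_ineq2)
    also have "\<dots> \<le> norm p * M0" using bnd_b[OF t] by (intro mult_left_mono) auto
    finally have 2: "\<bar>p \<bullet> b t x v\<bar> \<le> norm p * M0" .
    have "norm (p v* \<sigma> t x v) \<le> norm p * M0"
      by (rule order_trans[OF norm_vector_matrix_mult_le mult_left_mono[OF bnd_\<sigma>[OF t]]]) simp
    then have "L * (\<bar>r\<bar> + norm (p v* \<sigma> t x v)) \<le> L * (\<bar>r\<bar> + norm p * M0)"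
      using const_pos by (intro mult_left_mono) auto
    then have 3: "\<bar>f t x r (p v* \<sigma> t x v) v\<bar> \<le> F0 + L * (\<bar>r\<bar> + norm p * M0)"
      using f_growth[OF t v, of x r "p v* \<sigma> t x v"] by linarith
    show ?thesis unfolding generator_def trace_quadratic_form using 1 2 3 by linarith
  qed
  then show ?thesis by (intro bdd_belowI2)
qed

text \<open>A test function above \<open>w\<close> becomes one above \<open>u\<close> because the
  change of variable is increasing. Division by its derivative then returns to \<open>w\<close>: the
  constant \<open>K\<close> in the constraint is not scaled along with the gradient, which produces
  the strict margin, and the concavity pays for the unscaled driver.\<close>

lemma subsolution_jet:
  assumes sub: "viscosity_subsolution T U b \<sigma> f G K u"
    and \<delta>: "0 < \<delta>" "\<delta> \<le> 1" and BN: "0 \<le> B" "0 \<le> N"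
    and w: "\<And>t x. t \<in> {0..T} \<Longrightarrow> u t x = w t x - \<delta> * exp (- w t x)"
    and t0: "t0 \<in> {0<..<T}" and X: "linear X" and d: "d > 0"
    and touch: "\<And>t x. t \<in> {0..T} \<Longrightarrow> norm (t - t0, x - x0) < d \<Longrightarrow>
      exp (l * t) * w t x - B * exp (- (N * t)) \<le> exp (l * t0) * w t0 x0 - B * exp (- (N * t0))
        + a * (t - t0) + p \<bullet> (x - x0) + X (x - x0) \<bullet> (x - x0) / 2 + C * (t - t0)\<^sup>2"
    and W: "\<bar>w t0 x0\<bar> \<le> W"
  shows "exp (- (l * t0)) * (p v* G) $ i + K $ i \<ge> k0 * \<delta> * exp (- W) / (1 + exp W)" (is ?grad)
    and "v \<in> U \<Longrightarrow> l * w t0 x0 \<le> exp (- (l * t0)) * (a + (\<Sum>j\<in>UNIV. X (column j (\<sigma> t0 x0 v)) \<bullet> column j (\<sigma> t0 x0 v)) / 2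
        + p \<bullet> b t0 x0 v) + f t0 x0 (w t0 x0) (exp (- (l * t0)) *\<^sub>R (p v* \<sigma> t0 x0 v)) v
        + \<delta> * exp W * (F0 + L * W + L + 2 * L\<^sup>2)" (is "_ \<Longrightarrow> ?pde")
proof -
  obtain M :: "real^'n^'n" where M: "\<And>h k. (M *v h) \<bullet> k = (M *v k) \<bullet> h" "\<And>h. (M *v h) \<bullet> h = X h \<bullet> h"
    by (rule symmetric_matrix_of_form[OF X]) (rule that; assumption)
  have t0': "t0 \<in> {0..T}" using t0 by auto
  define c0 where "c0 = exp (l * t0) * w t0 x0 - B * exp (- (N * t0))"
  define \<omega> where "\<omega> t x = exp (- (l * t)) * (c0 + a * (t - t0) + p \<bullet> (x - x0) + (M *v (x - x0)) \<bullet> (x - x0) / 2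
      + C * (t - t0)\<^sup>2 + B * exp (- (N * t)))" for t x
  define \<omega>t where "\<omega>t t x = - l * \<omega> t x + exp (- (l * t)) * (a + 2 * C * (t - t0) - B * N * exp (- (N * t)))" for t x
  define D\<omega> where "D\<omega> t x = exp (- (l * t)) *\<^sub>R (p + M *v (x - x0))" for t x
  define D2\<omega> where "D2\<omega> t x = exp (- (l * t)) *\<^sub>R M" for t :: real and x :: "real^'n"
  have C12\<omega>: "C12 T \<omega> \<omega>t D\<omega> D2\<omega>"
    unfolding \<omega>_def \<omega>t_def D\<omega>_def D2\<omega>_def by (rule C12_exp_quadratic[OF M(1)])
  have \<omega>0: "\<omega> t0 x0 = w t0 x0"
    unfolding \<omega>_def c0_def by (simp add: mult.assoc[symmetric] exp_add[symmetric])
  have w_le: "w t x \<le> \<omega> t x" if "t \<in> {0..T}" "norm (t - t0, x - x0) < d" for t x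
  proof -
    have "w t x = exp (- (l * t)) * (exp (l * t) * w t x)" by (simp add: mult.assoc[symmetric] exp_add[symmetric])
    also have "\<dots> \<le> \<omega> t x" unfolding \<omega>_def
      by (rule mult_left_mono) (use touch[OF that] M(2)[of "x - x0"] in \<open>auto simp: c0_def\<close>)
    finally show ?thesis .
  qed
  have lm: "local_max_on ({0..T} \<times> UNIV) (\<lambda>(t, x). u t x - (\<omega> t x - \<delta> * exp (- \<omega> t x))) (t0, x0)"
    unfolding local_max_on_def
  proof (intro conjI exI[of _ d] d ballI)
    show "(t0, x0) \<in> {0..T} \<times> UNIV" using t0' by simp
    fix z assume z: "z \<in> {0..T} \<times> UNIV \<inter> ball (t0, x0) d"
    obtain t x where zz: "z = (t, x)" by (cases z)
    have t: "t \<in> {0..T}" using z zz by auto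
    have "norm (t - t0, x - x0) = dist (t0, x0) (t, x)" by (simp add: dist_norm norm_minus_commute power2_commute norm_Pair)
    then have "w t x \<le> \<omega> t x" using z zz w_le[OF t] by simp
    then have "exp (- \<omega> t x) \<le> exp (- w t x)" by simp
    then have "\<delta> * exp (- \<omega> t x) \<le> \<delta> * exp (- w t x)" using \<delta> by (intro mult_left_mono) auto
    then show "(case z of (t, x) \<Rightarrow> u t x - (\<omega> t x - \<delta> * exp (- \<omega> t x)))
      \<le> (case (t0, x0) of (t, x) \<Rightarrow> u t x - (\<omega> t x - \<delta> * exp (- \<omega> t x)))"
      unfolding zz using w[OF t, of x] w[OF t0', of x0] \<omega>0 \<open>w t x \<le> \<omega> t x\<close> by simp
  qed
  have int: "(t0, x0) \<in> interior ({0..T} \<times> UNIV)"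
    using t0 by (simp add: interior_Times)
  \<comment> \<open>At the touching point the change of variable has derivative
    \<open>g = 1 + E\<close> and second derivative \<open>- E\<close>.\<close>
  define E where "E = \<delta> * exp (- w t0 x0)"
  define e where "e = exp (- (l * t0))"
  define g where "g = 1 + E"
  have E0: "E > 0" unfolding E_def using \<delta> by simp
  have g1: "g \<ge> 1" unfolding g_def using E0 by simp
  have "exp (- w t0 x0) \<le> exp W" "exp (- W) \<le> exp (- w t0 x0)" using W by auto
  then have EW: "E \<le> \<delta> * exp W" "\<delta> * exp (- W) \<le> E" unfolding E_def using \<delta> by auto
  have e0: "e > 0" unfolding e_def by simp
  \<comment> \<open>The time derivative of the decreasing penalty has a favourable sign and is
    dropped at the end.\<close>
  define bn where "bn = B * N * exp (- (N * t0))"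
  have bn0: "bn \<ge> 0" unfolding bn_def using BN by simp
  have hjb: "hjb_operator U b \<sigma> f G K t0 x0 (g * (- l * w t0 x0 + e * (a - bn))) (u t0 x0)
      (g *\<^sub>R (e *\<^sub>R p)) (g *\<^sub>R (e *\<^sub>R M) - E *\<^sub>R outer (e *\<^sub>R p)) \<ge> 0"
  proof -
    have "hjb_operator U b \<sigma> f G K t0 x0 ((1 + \<delta> * exp (- \<omega> t0 x0)) * \<omega>t t0 x0) (\<omega> t0 x0 - \<delta> * exp (- \<omega> t0 x0))
      ((1 + \<delta> * exp (- \<omega> t0 x0)) *\<^sub>R D\<omega> t0 x0) ((1 + \<delta> * exp (- \<omega> t0 x0)) *\<^sub>R D2\<omega> t0 x0 - (\<delta> * exp (- \<omega> t0 x0)) *\<^sub>R outer (D\<omega> t0 x0)) \<ge> 0"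
      using sub[unfolded viscosity_subsolution_def, THEN conjunct2, rule_format, OF conjI[OF C12_compose_exp[OF C12\<omega>, of \<delta>] conjI[OF int conjI[OF lm]]]]
        w[OF t0', of x0] \<omega>0 by simp
    then show ?thesis
      unfolding g_def E_def \<omega>t_def D\<omega>_def D2\<omega>_def \<omega>0 e_def bn_def w[OF t0', symmetric] by simp
  qed
  let ?A = "g * (- l * w t0 x0 + e * (a - bn)) + (INF v\<in>U. generator b \<sigma> t0 x0 v (g *\<^sub>R (e *\<^sub>R p)) (g *\<^sub>R (e *\<^sub>R M) - E *\<^sub>R outer (e *\<^sub>R p)) + f t0 x0 (u t0 x0) ((g *\<^sub>R (e *\<^sub>R p)) v* \<sigma> t0 x0 v) v)"
  have all: "?A \<ge> 0" "\<And>i. ((g *\<^sub>R (e *\<^sub>R p)) v* G + K) $ i \<ge> 0"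
    using hjb unfolding hjb_operator_def by (subst (asm) Min_ge_iff; simp)+
  show ?grad
  proof -
    have "0 \<le> g * (e * (p v* G) $ i) + K $ i" using all(2)[of i] by (simp add: vector_matrix_mult_scaleR)
    then have "0 \<le> (g * (e * (p v* G) $ i) + K $ i) / g" using g1 by simp
    \<comment> \<open>Here \<open>K / g = K - K * (E / g)\<close>, so dividing costs the constraint
      a positive multiple of \<open>K\<close>.\<close>
    also have "\<dots> = e * (p v* G) $ i + K $ i - K $ i * (E / g)"
      using g1 E0 unfolding g_def by (simp add: field_simps)
    finally have "K $ i * (E / g) \<le> e * (p v* G) $ i + K $ i" by simp
    moreover have "k0 * (\<delta> * exp (- W) / (1 + exp W)) \<le> K $ i * (E / g)"
    proof (rule mult_mono[OF K_ge])
      have "\<delta> * exp W \<le> 1 * exp W" using \<delta> by (intro mult_right_mono) auto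
      then have "g \<le> 1 + exp W" unfolding g_def using EW by linarith
      then show "\<delta> * exp (- W) / (1 + exp W) \<le> E / g" using EW E0 g1 \<delta> by (intro frac_le) auto
      show "0 \<le> K $ i" using K_ge[of i] const_pos by simp
    qed (use \<delta> in \<open>auto intro!: divide_nonneg_pos add_pos_pos\<close>)
    ultimately show ?thesis unfolding e_def by simp
  qed
  assume v: "v \<in> U"
  define S where "S = (\<Sum>j\<in>UNIV. X (column j (\<sigma> t0 x0 v)) \<bullet> column j (\<sigma> t0 x0 v)) / 2"
  define \<zeta> where "\<zeta> = e *\<^sub>R (p v* \<sigma> t0 x0 v)"
  define \<beta> where "\<beta> = p \<bullet> b t0 x0 v"
  have gen: "generator b \<sigma> t0 x0 v (g *\<^sub>R (e *\<^sub>R p)) (g *\<^sub>R (e *\<^sub>R M) - E *\<^sub>R outer (e *\<^sub>R p))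
      = g * e * S - E / 2 * (norm \<zeta>)\<^sup>2 + g * e * \<beta>"
  proof -
    let ?c = "\<lambda>j. column j (\<sigma> t0 x0 v)"
    have "((g *\<^sub>R (e *\<^sub>R M) - E *\<^sub>R outer (e *\<^sub>R p)) *v ?c j) \<bullet> ?c j = g * e * (X (?c j) \<bullet> ?c j) - E * ((e *\<^sub>R p) \<bullet> ?c j)\<^sup>2" for j
      by (simp add: matrix_vector_mult_diff_rdistrib scaleR_matrix_vector_assoc[symmetric] outer_mult inner_diff_left M(2) power2_eq_square)
    then have "(\<Sum>j\<in>UNIV. ((g *\<^sub>R (e *\<^sub>R M) - E *\<^sub>R outer (e *\<^sub>R p)) *v ?c j) \<bullet> ?c j)
      = g * e * (2 * S) - E * (\<Sum>j\<in>UNIV. ((e *\<^sub>R p) \<bullet> ?c j)\<^sup>2)"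
      by (simp add: sum_subtractf sum_distrib_left[symmetric] S_def)
    also have "(\<Sum>j\<in>UNIV. ((e *\<^sub>R p) \<bullet> ?c j)\<^sup>2) = (norm \<zeta>)\<^sup>2"
      unfolding \<zeta>_def vector_matrix_mult_scaleR[symmetric] norm_vector_matrix_mult_sq ..
    finally show ?thesis unfolding generator_def trace_quadratic_form \<beta>_def by (simp add: algebra_simps)
  qed
  have fz: "(g *\<^sub>R (e *\<^sub>R p)) v* \<sigma> t0 x0 v = g *\<^sub>R \<zeta>"
    unfolding \<zeta>_def by (simp add: vector_matrix_mult_scaleR)
  have "(INF v\<in>U. generator b \<sigma> t0 x0 v (g *\<^sub>R (e *\<^sub>R p)) (g *\<^sub>R (e *\<^sub>R M) - E *\<^sub>R outer (e *\<^sub>R p)) + f t0 x0 (u t0 x0) ((g *\<^sub>R (e *\<^sub>R p)) v* \<sigma> t0 x0 v) v)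
      \<le> generator b \<sigma> t0 x0 v (g *\<^sub>R (e *\<^sub>R p)) (g *\<^sub>R (e *\<^sub>R M) - E *\<^sub>R outer (e *\<^sub>R p)) + f t0 x0 (u t0 x0) ((g *\<^sub>R (e *\<^sub>R p)) v* \<sigma> t0 x0 v) v"
    by (rule cINF_lower[OF hamiltonian_bdd_below[OF t0'] v])
  then have I: "0 \<le> g * (- l * w t0 x0 + e * (a - bn)) + (g * e * S - E / 2 * (norm \<zeta>)\<^sup>2 + g * e * \<beta>) + f t0 x0 (u t0 x0) (g *\<^sub>R \<zeta>) v"
    using all(1) unfolding gen fz by linarith
  define F where "F = f t0 x0 (w t0 x0) \<zeta> v"
  have f1: "f t0 x0 (u t0 x0) (g *\<^sub>R \<zeta>) v \<le> F + L * (E + E * norm \<zeta>)"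
  proof -
    have "\<bar>u t0 x0 - w t0 x0\<bar> = E" using w[OF t0', of x0] E0 unfolding E_def by simp
    moreover have "g *\<^sub>R \<zeta> - \<zeta> = E *\<^sub>R \<zeta>" unfolding g_def by (simp add: scaleR_left_distrib)
    ultimately show ?thesis
      using lip_f[OF t0', of x0 "u t0 x0" "g *\<^sub>R \<zeta>" v x0 "w t0 x0" \<zeta>] E0 unfolding F_def by (simp add: abs_le_iff)
  qed
  have f2: "- F \<le> F0 + L * (W + norm \<zeta>)"
  proof -
    have "L * (\<bar>w t0 x0\<bar> + norm \<zeta>) \<le> L * (W + norm \<zeta>)" using W const_pos by (intro mult_left_mono) auto
    then show ?thesis using f_growth[OF t0' v, of x0 "w t0 x0" \<zeta>] unfolding F_def by linarith
  qed
  define c1 where "c1 = F0 + L * W + L + 2 * L\<^sup>2"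
  have W0: "W \<ge> 0" using W by linarith
  have c1: "c1 \<ge> 0" unfolding c1_def using const_pos W0 by simp
  \<comment> \<open>One \<open>L\<close> comes from the growth of \<open>f\<close>, the other from
    its Lipschitz bound at the scaled gradient; completing the square absorbs both.\<close>
  have "2 * L * norm \<zeta> - (norm \<zeta>)\<^sup>2 / 2 \<le> 2 * L\<^sup>2"
    using zero_le_power2[of "2 * L - norm \<zeta>"] by (simp add: power2_diff power_mult_distrib)
  then have q: "F0 + L * (W + norm \<zeta>) + L * (1 + norm \<zeta>) - (norm \<zeta>)\<^sup>2 / 2 \<le> c1"
    unfolding c1_def by (simp add: algebra_simps)
  define R where "R = l * w t0 x0 - e * (a + S + \<beta>) - F"
  have gbn: "g * e * bn \<ge> 0" using g1 e0 bn0 by simp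
  \<comment> \<open>The driver in the equation lacks the factor \<open>g\<close>, so multiplication
    by \<open>g\<close> leaves \<open>- E * F\<close>. Every error term now carries the factor
    \<open>E\<close>, as does the squared gradient.\<close>
  have "g * R = g * l * w t0 x0 - g * e * a - g * e * S - g * e * \<beta> - g * F" unfolding R_def by (simp add: algebra_simps)
  also have "\<dots> \<le> - (g * F) - E / 2 * (norm \<zeta>)\<^sup>2 + F + L * (E + E * norm \<zeta>)"
    using I f1 gbn by (simp add: algebra_simps)
  also have "\<dots> = E * (- F + L * (1 + norm \<zeta>) - (norm \<zeta>)\<^sup>2 / 2)" unfolding g_def by (simp add: algebra_simps)
  also have "\<dots> \<le> E * c1" using f2 q E0 by (intro mult_left_mono) auto
  finally have gR: "g * R \<le> E * c1" .
  have "R \<le> E * c1"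
  proof (cases "R \<le> 0")
    case True
    then show ?thesis using E0 c1 by (meson mult_nonneg_nonneg less_imp_le order_trans)
  next
    case False
    then have "1 * R \<le> g * R" using g1 by (intro mult_right_mono) auto
    then show ?thesis using gR by simp
  qed
  also have "\<dots> \<le> \<delta> * exp W * c1" using EW c1 by (intro mult_right_mono)
  finally show ?pde unfolding R_def S_def[symmetric] \<beta>_def[symmetric] F_def \<zeta>_def e_def c1_def by simp
qed

text \<open>The supersolution is left untransformed. The slack \<open>\<epsilon>\<close> allows a
  control to be taken from the infimum without a minimiser.\<close>

lemma supersolution_jet:
  assumes super: "viscosity_supersolution T U b \<sigma> f G K u"
    and t0: "t0 \<in> {0<..<T}" and X: "linear X" and d: "d > 0"
    and touch: "\<And>t x. t \<in> {0..T} \<Longrightarrow> norm (t - t0, x - x0) < d \<Longrightarrow>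
      exp (l * t0) * u t0 x0 + a * (t - t0) + p \<bullet> (x - x0) + X (x - x0) \<bullet> (x - x0) / 2 - C * (t - t0)\<^sup>2 \<le> exp (l * t) * u t x"
    and \<epsilon>: "\<epsilon> > 0"
  shows "(\<exists>i. exp (- (l * t0)) * (p v* G) $ i + K $ i \<le> 0) \<or>
    (\<exists>v\<in>U. exp (- (l * t0)) * (a + (\<Sum>j\<in>UNIV. X (column j (\<sigma> t0 x0 v)) \<bullet> column j (\<sigma> t0 x0 v)) / 2
        + p \<bullet> b t0 x0 v) + f t0 x0 (u t0 x0) (exp (- (l * t0)) *\<^sub>R (p v* \<sigma> t0 x0 v)) v \<le> l * u t0 x0 + \<epsilon>)"
proof -
  obtain M :: "real^'n^'n" where M: "\<And>h k. (M *v h) \<bullet> k = (M *v k) \<bullet> h" "\<And>h. (M *v h) \<bullet> h = X h \<bullet> h"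
    by (rule symmetric_matrix_of_form[OF X]) (rule that; assumption)
  have t0': "t0 \<in> {0..T}" using t0 by auto
  define c0 where "c0 = exp (l * t0) * u t0 x0"
  \<comment> \<open>The general test function with penalty parameters \<open>0\<close> and with
    \<open>- C\<close> in place of \<open>C\<close>.\<close>
  define \<omega> where "\<omega> t x = exp (- (l * t)) * (c0 + a * (t - t0) + p \<bullet> (x - x0) + (M *v (x - x0)) \<bullet> (x - x0) / 2
      + (- C) * (t - t0)\<^sup>2 + 0 * exp (- (0 * t)))" for t x
  define \<omega>t where "\<omega>t t x = - l * \<omega> t x + exp (- (l * t)) * (a + 2 * (- C) * (t - t0) - 0 * 0 * exp (- (0 * t)))" for t x
  define D\<omega> where "D\<omega> t x = exp (- (l * t)) *\<^sub>R (p + M *v (x - x0))" for t x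
  define D2\<omega> where "D2\<omega> t x = exp (- (l * t)) *\<^sub>R M" for t :: real and x :: "real^'n"
  have C12\<omega>: "C12 T \<omega> \<omega>t D\<omega> D2\<omega>"
    unfolding \<omega>_def \<omega>t_def D\<omega>_def D2\<omega>_def by (rule C12_exp_quadratic[OF M(1)])
  have \<omega>0: "\<omega> t0 x0 = u t0 x0"
    unfolding \<omega>_def c0_def by (simp add: mult.assoc[symmetric] exp_add[symmetric])
  have w_le: "\<omega> t x \<le> u t x" if "t \<in> {0..T}" "norm (t - t0, x - x0) < d" for t x
  proof -
    have "\<omega> t x \<le> exp (- (l * t)) * (exp (l * t) * u t x)" unfolding \<omega>_def
      by (rule mult_left_mono) (use touch[OF that] M(2)[of "x - x0"] in \<open>auto simp: c0_def\<close>)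
    also have "\<dots> = u t x" by (simp add: mult.assoc[symmetric] exp_add[symmetric])
    finally show ?thesis .
  qed
  have lm: "local_min_on ({0..T} \<times> UNIV) (\<lambda>(t, x). u t x - \<omega> t x) (t0, x0)"
    unfolding local_min_on_def
  proof (intro conjI exI[of _ d] d ballI)
    show "(t0, x0) \<in> {0..T} \<times> UNIV" using t0' by simp
    fix z assume z: "z \<in> {0..T} \<times> UNIV \<inter> ball (t0, x0) d"
    obtain t x where zz: "z = (t, x)" by (cases z)
    have t: "t \<in> {0..T}" using z zz by auto
    have "norm (t - t0, x - x0) = dist (t0, x0) (t, x)" by (simp add: dist_norm norm_minus_commute power2_commute norm_Pair)
    then have "\<omega> t x \<le> u t x" using z zz w_le[OF t] by simp
    then show "(case (t0, x0) of (t, x) \<Rightarrow> u t x - \<omega> t x) \<le> (case z of (t, x) \<Rightarrow> u t x - \<omega> t x)"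
      unfolding zz using \<omega>0 by simp
  qed
  have int: "(t0, x0) \<in> interior ({0..T} \<times> UNIV)"
    using t0 by (simp add: interior_Times)
  define e where "e = exp (- (l * t0))"
  have hjb: "hjb_operator U b \<sigma> f G K t0 x0 (- l * u t0 x0 + e * a) (u t0 x0) (e *\<^sub>R p) (e *\<^sub>R M) \<le> 0"
  proof -
    have "hjb_operator U b \<sigma> f G K t0 x0 (\<omega>t t0 x0) (\<omega> t0 x0) (D\<omega> t0 x0) (D2\<omega> t0 x0) \<le> 0"
      using super[unfolded viscosity_supersolution_def, THEN conjunct2, rule_format, OF conjI[OF C12\<omega> conjI[OF int conjI[OF lm]]]]
        \<omega>0 by simp
    then show ?thesis
      unfolding \<omega>t_def D\<omega>_def D2\<omega>_def \<omega>0 e_def by simp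
  qed
  let ?f = "\<lambda>v. generator b \<sigma> t0 x0 v (e *\<^sub>R p) (e *\<^sub>R M) + f t0 x0 (u t0 x0) ((e *\<^sub>R p) v* \<sigma> t0 x0 v) v"
  have "- l * u t0 x0 + e * a + (INF v\<in>U. ?f v) \<le> 0 \<or> (\<exists>i. ((e *\<^sub>R p) v* G + K) $ i \<le> 0)"
    using hjb unfolding hjb_operator_def by (subst (asm) Min_le_iff) auto
  then show ?thesis
  proof
    assume "\<exists>i. ((e *\<^sub>R p) v* G + K) $ i \<le> 0"
    then show ?thesis unfolding e_def by (simp add: vector_matrix_mult_scaleR)
  next
    assume "- l * u t0 x0 + e * a + (INF v\<in>U. ?f v) \<le> 0"
    then have "(INF v\<in>U. ?f v) < l * u t0 x0 - e * a + \<epsilon>" using \<epsilon> by simp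
    then obtain y where "y \<in> ?f ` U" "y < l * u t0 x0 - e * a + \<epsilon>"
      using cInf_lessD[of "?f ` U"] U_ne by blast
    then obtain v where v: "v \<in> U" "?f v < l * u t0 x0 - e * a + \<epsilon>" by blast
    let ?c = "\<lambda>j. column j (\<sigma> t0 x0 v)"
    have "((e *\<^sub>R M) *v ?c j) \<bullet> ?c j = e * (X (?c j) \<bullet> ?c j)" for j
      by (simp add: scaleR_matrix_vector_assoc[symmetric] M(2))
    then have "generator b \<sigma> t0 x0 v (e *\<^sub>R p) (e *\<^sub>R M) = e * ((\<Sum>j\<in>UNIV. X (?c j) \<bullet> ?c j) / 2 + p \<bullet> b t0 x0 v)"
      unfolding generator_def trace_quadratic_form by (simp add: sum_distrib_left[symmetric] algebra_simps)
    then have "e * (a + (\<Sum>j\<in>UNIV. X (?c j) \<bullet> ?c j) / 2 + p \<bullet> b t0 x0 v) + f t0 x0 (u t0 x0) (e *\<^sub>R (p v* \<sigma> t0 x0 v)) v \<le> l * u t0 x0 + \<epsilon>"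
      using v(2) by (simp add: vector_matrix_mult_scaleR algebra_simps)
    then show ?thesis using v(1) unfolding e_def by blast
  qed
qed

end

section \<open>Comparison of a subsolution with a supersolution\<close>

text \<open>The map has slope at least \<open>1\<close>, so its inverse is nonexpansive; the
  intermediate value theorem on the interval from \<open>r\<close> to
  \<open>r + \<delta> * exp (- r)\<close> gives existence and both bounds.\<close>

lemma exp_perturbation_inverse:
  fixes \<delta> :: real
  assumes \<delta>: "\<delta> \<ge> 0"
  obtains \<psi> :: "real \<Rightarrow> real" where "\<And>r. \<psi> r - \<delta> * exp (- \<psi> r) = r" "\<And>r. r \<le> \<psi> r"
    "\<And>r. \<psi> r \<le> r + \<delta> * exp (- r)" "continuous_on UNIV \<psi>"
proof -
  have "\<exists>x. r \<le> x \<and> x \<le> r + \<delta> * exp (- r) \<and> x - \<delta> * exp (- x) = r" for r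
  proof (rule IVT')
    show "r \<le> r + \<delta> * exp (- r)" using \<delta> by simp
    show "r - \<delta> * exp (- r) \<le> r" using \<delta> by simp
    have "exp (- (r + \<delta> * exp (- r))) \<le> exp (- r)" using \<delta> by simp
    then have "\<delta> * exp (- (r + \<delta> * exp (- r))) \<le> \<delta> * exp (- r)" using \<delta> by (rule mult_left_mono)
    then show "r \<le> r + \<delta> * exp (- r) - \<delta> * exp (- (r + \<delta> * exp (- r)))" by simp
    show "continuous_on {r..r + \<delta> * exp (- r)} (\<lambda>x. x - \<delta> * exp (- x))" by (intro continuous_intros)
  qed
  then obtain \<psi> where \<psi>: "\<And>r. r \<le> \<psi> r" "\<And>r. \<psi> r \<le> r + \<delta> * exp (- r)" "\<And>r. \<psi> r - \<delta> * exp (- \<psi> r) = r"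
    by metis
  have le: "\<psi> r' - \<psi> r \<le> r' - r" if "\<psi> r \<le> \<psi> r'" for r r'
  proof -
    have "\<delta> * exp (- \<psi> r') \<le> \<delta> * exp (- \<psi> r)" using that \<delta> by (intro mult_left_mono) auto
    then show ?thesis using \<psi>(3)[of r] \<psi>(3)[of r'] by linarith
  qed
  have "1-lipschitz_on UNIV \<psi>"
  proof (rule lipschitz_onI)
    fix r r' show "dist (\<psi> r) (\<psi> r') \<le> 1 * dist r r'"
      using le[of r r'] le[of r' r] unfolding dist_real_def by argo
  qed simp
  then have "continuous_on UNIV \<psi>" by (rule lipschitz_on_continuous_on)
  then show ?thesis by (rule that[OF \<psi>(3,1,2)])
qed

lemma uniform_modulus_interval:
  fixes h :: "real \<Rightarrow> real"
  assumes "continuous_on {0..T} h" "\<epsilon> > 0"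
  obtains \<tau> where "\<tau> > 0" "\<And>t s. t \<in> {0..T} \<Longrightarrow> s \<in> {0..T} \<Longrightarrow> \<bar>t - s\<bar> \<le> \<tau> \<Longrightarrow> \<bar>h t - h s\<bar> \<le> \<epsilon>"
proof -
  have "uniformly_continuous_on {0..T} h" using assms by (intro compact_uniformly_continuous) auto
  then obtain d where d: "d > 0" "\<And>x x'. x \<in> {0..T} \<Longrightarrow> x' \<in> {0..T} \<Longrightarrow> dist x' x < d \<Longrightarrow> dist (h x') (h x) < \<epsilon>"
    unfolding uniformly_continuous_on_def using assms(2) by metis
  show ?thesis
  proof (rule that[of "d / 2"])
    show "d / 2 > 0" using d by simp
    show "\<bar>h t - h s\<bar> \<le> \<epsilon>" if "t \<in> {0..T}" "s \<in> {0..T}" "\<bar>t - s\<bar> \<le> d / 2" for t s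
      using d(2)[of s t] that d(1) by (simp add: dist_real_def)
  qed
qed

text \<open>
  Replaces the limit in the penalty parameter \<open>\<alpha> = 2 ^ j\<close>: only finitely many values of \<open>\<alpha>\<close> are
  possible, so the time penalty can be fixed before \<open>\<alpha>\<close> is chosen.
\<close>

lemma small_decrement:
  fixes m :: "nat \<Rightarrow> real"
  assumes "\<And>j. 0 \<le> m j" "\<And>j. m j \<le> h" "J > 0"
  shows "\<exists>j\<ge>j0. j < j0 + J \<and> m j - m (Suc j) \<le> h / real J"
proof (rule ccontr)
  assume nb: "\<not> ?thesis"
  have big: "h / real J < m (j0 + i) - m (Suc (j0 + i))" if "i < J" for i
    using nb that by (metis le_add1 add_less_cancel_left not_le)
  have "(\<Sum>i<J. m (j0 + i) - m (Suc (j0 + i))) = m j0 - m (j0 + J)"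
    using sum_lessThan_telescope'[of "\<lambda>i. m (j0 + i)" J] by simp
  moreover have "m j0 - m (j0 + J) \<le> h" using assms(1)[of "j0 + J"] assms(2)[of j0] by simp
  ultimately have le: "(\<Sum>i<J. m (j0 + i) - m (Suc (j0 + i))) \<le> h" by simp
  have "(\<Sum>i<J. h / real J) < (\<Sum>i<J. m (j0 + i) - m (Suc (j0 + i)))"
    by (rule sum_strict_mono) (use big assms(3) in auto)
  then show False using le assms(3) by simp
qed

context hjb_data
begin

text \<open>Every error is a multiple of the single parameter \<open>\<theta>\<close>. The time
  penalty \<open>\<gamma>\<close> does not appear in the bound, since its contribution has a sign;
  this permits choosing it after all other constants.\<close>

lemma pde_difference:
  fixes X Y :: "real^'n \<Rightarrow> real^'n"
  assumes t: "t \<in> {0..T}" and s: "s \<in> {0..T}" and l: "l \<ge> 0"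
    and small: "0 < \<eta>" "\<eta> \<le> \<theta>" "\<theta> \<le> 1" "0 \<le> \<epsilon>" "\<epsilon> \<le> \<theta>" "0 \<le> \<beta>" "\<beta> \<le> \<theta>" "\<beta> * norm x \<le> \<theta>"
      "0 \<le> \<alpha>" "\<alpha> * \<epsilon> \<le> \<theta>" "\<alpha> * (norm (x - y))\<^sup>2 \<le> \<theta>" "norm (x - y) \<le> \<theta>" "0 \<le> \<gamma>"
    and mod: "\<bar>exp (- (l * t)) - exp (- (l * s))\<bar> \<le> \<epsilon>" "\<bar>exp (- (l * t) / 2) - exp (- (l * s) / 2)\<bar> \<le> \<epsilon>"
      "\<And>x v. norm (b t x v - b s x v) \<le> \<epsilon>" "\<And>x v. norm (\<sigma> t x v - \<sigma> s x v) \<le> \<epsilon>"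
      "\<And>x r z v. norm z \<le> (\<alpha> + 1) * M0 \<Longrightarrow> \<bar>f t x r z v - f s x r z v\<bar> \<le> \<epsilon>"
    and a: "\<bar>a - \<gamma> * (t - s)\<bar> \<le> \<eta>" "\<bar>a' - \<gamma> * (t - s)\<bar> \<le> \<eta>"
    and pq: "norm (p - (\<alpha> *\<^sub>R (x - y) + (2 * \<beta>) *\<^sub>R x)) \<le> \<eta>" "norm (q - \<alpha> *\<^sub>R (x - y)) \<le> \<eta>"
    and XY: "linear X" "linear Y"
      "\<And>h k. X h \<bullet> h / 2 - Y k \<bullet> k / 2 \<le> \<alpha> / 2 * (norm (h - k))\<^sup>2 + \<beta> * (norm h)\<^sup>2 + \<eta> * ((norm h)\<^sup>2 + (norm k)\<^sup>2)"
  shows "exp (- (l * t)) * (p v* G) $ i - exp (- (l * s)) * (q v* G) $ i \<le> 6 * \<theta> * norm G" (is ?grad)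
    and "exp (- (l * t)) * (a + (\<Sum>j\<in>UNIV. X (column j (\<sigma> t x v)) \<bullet> column j (\<sigma> t x v)) / 2 + p \<bullet> b t x v)
        + f t x r1 (exp (- (l * t)) *\<^sub>R (p v* \<sigma> t x v)) v
      - (exp (- (l * s)) * (a' + (\<Sum>j\<in>UNIV. Y (column j (\<sigma> s y v)) \<bullet> column j (\<sigma> s y v)) / 2 + q \<bullet> b s y v)
        + f s y r2 (exp (- (l * s)) *\<^sub>R (q v* \<sigma> s y v)) v)
      \<le> L * \<bar>r1 - r2\<bar> + \<theta> * (3 + L\<^sup>2 + (M0 + 1)\<^sup>2 + 3 * M0\<^sup>2 + (1 + L) * (6 * M0 + 2 * L + 2) + L)" (is ?main)
proof -
  define e1 where "e1 = exp (- (l * t))"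
  define e2 where "e2 = exp (- (l * s))"
  define D where "D = norm (x - y)"
  have e: "0 < e1" "e1 \<le> 1" "0 < e2" "e2 \<le> 1" unfolding e1_def e2_def using t s l by auto
  have D0: "0 \<le> D" "D \<le> 1" "D \<le> \<theta>" unfolding D_def using small by auto
  have \<theta>0: "0 < \<theta>" using small by linarith
  have q_le: "norm q \<le> \<alpha> * D + \<eta>"
    using norm_triangle_ineq[of "q - \<alpha> *\<^sub>R (x - y)" "\<alpha> *\<^sub>R (x - y)"] pq(2) small unfolding D_def by simp
  have aDe: "\<alpha> * D * \<epsilon> \<le> \<theta>"
  proof -
    have "\<alpha> * \<epsilon> * D \<le> \<theta> * 1" by (rule mult_mono) (use small D0 \<theta>0 in auto)
    then show ?thesis by (simp add: mult_ac)
  qed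
  have \<eta>\<epsilon>: "\<eta> * \<epsilon> \<le> \<theta>"
  proof -
    have "\<eta> * \<epsilon> \<le> 1 * \<theta>" by (rule mult_mono) (use small in auto)
    then show ?thesis by simp
  qed
  have P: "norm (e1 *\<^sub>R p - e2 *\<^sub>R q) \<le> 6 * \<theta>"
  proof -
    have pq': "norm (p - q) \<le> 4 * \<theta>"
    proof -
      have "p - q = (p - (\<alpha> *\<^sub>R (x - y) + (2 * \<beta>) *\<^sub>R x)) - (q - \<alpha> *\<^sub>R (x - y)) + (2 * \<beta>) *\<^sub>R x" by simp
      then have "norm (p - q) \<le> norm ((p - (\<alpha> *\<^sub>R (x - y) + (2 * \<beta>) *\<^sub>R x)) - (q - \<alpha> *\<^sub>R (x - y))) + norm ((2 * \<beta>) *\<^sub>R x)"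
        by (metis norm_triangle_ineq)
      moreover have "norm ((p - (\<alpha> *\<^sub>R (x - y) + (2 * \<beta>) *\<^sub>R x)) - (q - \<alpha> *\<^sub>R (x - y))) \<le> \<eta> + \<eta>"
        by (rule order_trans[OF norm_triangle_ineq4 add_mono[OF pq]])
      moreover have "norm ((2 * \<beta>) *\<^sub>R x) = 2 * (\<beta> * norm x)" using small by simp
      ultimately show ?thesis using small by linarith
    qed
    have "e1 *\<^sub>R p - e2 *\<^sub>R q = e1 *\<^sub>R (p - q) + (e1 - e2) *\<^sub>R q" by (simp add: algebra_simps)
    then have "norm (e1 *\<^sub>R p - e2 *\<^sub>R q) \<le> norm (e1 *\<^sub>R (p - q)) + norm ((e1 - e2) *\<^sub>R q)"
      by (metis norm_triangle_ineq)
    also have "norm (e1 *\<^sub>R (p - q)) \<le> 1 * (4 * \<theta>)"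
      unfolding norm_scaleR by (rule mult_mono) (use e pq' in auto)
    also have "norm ((e1 - e2) *\<^sub>R q) \<le> \<epsilon> * (\<alpha> * D + \<eta>)"
      unfolding norm_scaleR by (rule mult_mono) (use mod(1) q_le small in \<open>auto simp: e1_def e2_def\<close>)
    also have "\<epsilon> * (\<alpha> * D + \<eta>) \<le> 2 * \<theta>" using aDe \<eta>\<epsilon> by (simp add: algebra_simps)
    finally show ?thesis by simp
  qed
  show ?grad
  proof -
    have "exp (- (l * t)) * (p v* G) $ i - exp (- (l * s)) * (q v* G) $ i = ((e1 *\<^sub>R p - e2 *\<^sub>R q) v* G) $ i"
      unfolding e1_def e2_def by (simp add: vector_matrix_mult_diff vector_matrix_mult_scaleR)
    also have "\<dots> \<le> norm ((e1 *\<^sub>R p - e2 *\<^sub>R q) v* G)" using component_le_norm_cart[of "(e1 *\<^sub>R p - e2 *\<^sub>R q) v* G" i] by linarith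
    also have "\<dots> \<le> norm (e1 *\<^sub>R p - e2 *\<^sub>R q) * norm G" by (rule norm_vector_matrix_mult_le)
    also have "\<dots> \<le> 6 * \<theta> * norm G" by (rule mult_right_mono[OF P]) simp
    finally show ?thesis .
  qed
  define S where "S = L * D + \<epsilon>"
  have QS: "norm q * S \<le> (2 * L + 2) * \<theta>"
  proof -
    have "norm q * S \<le> (\<alpha> * D + \<eta>) * S" using q_le D0 const_pos small unfolding S_def by (intro mult_right_mono) auto
    also have "\<dots> = L * (\<alpha> * D\<^sup>2) + \<alpha> * D * \<epsilon> + L * (\<eta> * D) + \<eta> * \<epsilon>"
      unfolding S_def by (simp add: algebra_simps power2_eq_square)
    also have "L * (\<alpha> * D\<^sup>2) \<le> L * \<theta>" using small const_pos unfolding D_def by (intro mult_left_mono) auto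
    also have "L * (\<eta> * D) \<le> L * \<theta>"
    proof (rule mult_left_mono)
      have "\<eta> * D \<le> \<theta> * 1" by (rule mult_mono) (use small D0 \<theta>0 in auto)
      then show "\<eta> * D \<le> \<theta>" by simp
    qed (use const_pos in simp)
    finally show ?thesis using aDe \<eta>\<epsilon> by (simp add: algebra_simps)
  qed
  have bdiff: "norm (b t x v - b s y v) \<le> S"
  proof -
    have "norm (b t x v - b s y v) \<le> norm (b t x v - b s x v) + norm (b s x v - b s y v)"
      using norm_triangle_ineq[of "b t x v - b s x v" "b s x v - b s y v"] by simp
    then show ?thesis using mod(3)[of x v] lip_b[OF s, of x v y] unfolding S_def D_def by linarith
  qed
  have \<sigma>diff: "norm (\<sigma> t x v - \<sigma> s y v) \<le> S"
  proof -
    have "norm (\<sigma> t x v - \<sigma> s y v) \<le> norm (\<sigma> t x v - \<sigma> s x v) + norm (\<sigma> s x v - \<sigma> s y v)"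
      using norm_triangle_ineq[of "\<sigma> t x v - \<sigma> s x v" "\<sigma> s x v - \<sigma> s y v"] by simp
    then show ?thesis using mod(4)[of x v] lip_\<sigma>[OF s, of x v y] unfolding S_def D_def by linarith
  qed
  have A: "e1 * a - e2 * a' \<le> 2 * \<theta>"
  proof -
    have "e1 * a \<le> e1 * (\<gamma> * (t - s) + \<eta>)" using a(1) e by (intro mult_left_mono) (auto simp: abs_le_iff)
    moreover have "e2 * (\<gamma> * (t - s) - \<eta>) \<le> e2 * a'" using a(2) e by (intro mult_left_mono) (auto simp: abs_le_iff)
    \<comment> \<open>The weight \<open>exp (- (l * t))\<close> decreases in time, so the terms with
      \<open>\<gamma>\<close> have a nonpositive difference.\<close>
    moreover have "(t - s) * (e1 - e2) \<le> 0"
    proof (cases "s \<le> t")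
      case True
      then have "l * s \<le> l * t" using l by (rule mult_left_mono)
      then have "e1 \<le> e2" unfolding e1_def e2_def by simp
      then show ?thesis using True by (simp add: mult_nonneg_nonpos)
    next
      case False
      then have "l * t \<le> l * s" using l by (intro mult_left_mono) auto
      then have "e2 \<le> e1" unfolding e1_def e2_def by simp
      then show ?thesis using False by (simp add: mult_nonpos_nonneg)
    qed
    then have "\<gamma> * ((t - s) * (e1 - e2)) \<le> 0" using small by (simp add: mult_nonneg_nonpos)
    moreover have "e1 * \<eta> \<le> 1 * \<theta>" "e2 * \<eta> \<le> 1 * \<theta>" by (rule mult_mono; use e small \<theta>0 in auto)+
    ultimately show ?thesis by (simp add: algebra_simps)
  qed
  \<comment> \<open>Square roots of the weights are put into the diffusion matrices, so that the
    inequality for \<open>X\<close> and \<open>Y\<close> applies with different weights on the two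
    sides.\<close>
  define c1 where "c1 = exp (- (l * t) / 2)"
  define c2 where "c2 = exp (- (l * s) / 2)"
  have c: "c1 * c1 = e1" "c2 * c2 = e2" "0 < c1" "c1 \<le> 1" "0 < c2" "c2 \<le> 1"
    unfolding c1_def c2_def e1_def e2_def exp_add[symmetric] using t s l by auto
  have B: "e1 * ((\<Sum>j\<in>UNIV. X (column j (\<sigma> t x v)) \<bullet> column j (\<sigma> t x v)) / 2)
      - e2 * ((\<Sum>j\<in>UNIV. Y (column j (\<sigma> s y v)) \<bullet> column j (\<sigma> s y v)) / 2)
      \<le> \<theta> * (L\<^sup>2 + (M0 + 1)\<^sup>2 + 3 * M0\<^sup>2)"
  proof -
    let ?A = "c1 *\<^sub>R \<sigma> t x v" and ?B = "c2 *\<^sub>R \<sigma> s y v"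
    have Xs: "e1 * (X (column j (\<sigma> t x v)) \<bullet> column j (\<sigma> t x v)) = X (column j ?A) \<bullet> column j ?A" for j
      using c(1) by (simp add: column_scaleR linear_scale[OF XY(1)] mult.assoc[symmetric])
    have Ys: "e2 * (Y (column j (\<sigma> s y v)) \<bullet> column j (\<sigma> s y v)) = Y (column j ?B) \<bullet> column j ?B" for j
      using c(2) by (simp add: column_scaleR linear_scale[OF XY(2)] mult.assoc[symmetric])
    have "e1 * ((\<Sum>j\<in>UNIV. X (column j (\<sigma> t x v)) \<bullet> column j (\<sigma> t x v)) / 2)
      - e2 * ((\<Sum>j\<in>UNIV. Y (column j (\<sigma> s y v)) \<bullet> column j (\<sigma> s y v)) / 2)
      = (\<Sum>j\<in>UNIV. X (column j ?A) \<bullet> column j ?A / 2 - Y (column j ?B) \<bullet> column j ?B / 2)"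
      unfolding sum_subtractf sum_divide_distrib[symmetric] Xs[symmetric] Ys[symmetric] sum_distrib_left[symmetric] by simp
    also have "\<dots> \<le> (\<Sum>j\<in>UNIV. \<alpha> / 2 * (norm (column j ?A - column j ?B))\<^sup>2 + \<beta> * (norm (column j ?A))\<^sup>2
        + \<eta> * ((norm (column j ?A))\<^sup>2 + (norm (column j ?B))\<^sup>2))"
      by (rule sum_mono) (rule XY(3))
    also have "\<dots> = \<alpha> / 2 * (norm (?A - ?B))\<^sup>2 + \<beta> * (norm ?A)\<^sup>2 + \<eta> * ((norm ?A)\<^sup>2 + (norm ?B)\<^sup>2)"
      unfolding sum.distrib sum_distrib_left[symmetric] column_diff[symmetric] sum_norm_column_sq ..
    also have "\<dots> \<le> \<theta> * (L\<^sup>2 + (M0 + 1)\<^sup>2) + \<theta> * M0\<^sup>2 + \<theta> * (M0\<^sup>2 + M0\<^sup>2)"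
    proof -
      have nA: "norm ?A \<le> M0" using mult_mono[of c1 1 "norm (\<sigma> t x v)" M0] c bnd_\<sigma>[OF t, of x v] by simp
      have nB: "norm ?B \<le> M0" using mult_mono[of c2 1 "norm (\<sigma> s y v)" M0] c bnd_\<sigma>[OF s, of y v] by simp
      have sq: "(norm ?A)\<^sup>2 \<le> M0\<^sup>2" "(norm ?B)\<^sup>2 \<le> M0\<^sup>2" by (rule power_mono[OF nA norm_ge_zero], rule power_mono[OF nB norm_ge_zero])
      have "?A - ?B = c1 *\<^sub>R (\<sigma> t x v - \<sigma> s y v) + (c1 - c2) *\<^sub>R \<sigma> s y v" by (simp add: algebra_simps)
      then have "norm (?A - ?B) \<le> norm (c1 *\<^sub>R (\<sigma> t x v - \<sigma> s y v)) + norm ((c1 - c2) *\<^sub>R \<sigma> s y v)"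
        by (metis norm_triangle_ineq)
      also have "norm (c1 *\<^sub>R (\<sigma> t x v - \<sigma> s y v)) \<le> 1 * S"
        unfolding norm_scaleR by (rule mult_mono) (use c \<sigma>diff in auto)
      also have "norm ((c1 - c2) *\<^sub>R \<sigma> s y v) \<le> \<epsilon> * M0"
        unfolding norm_scaleR by (rule mult_mono) (use mod(2) bnd_\<sigma>[OF s, of y v] small in \<open>auto simp: c1_def c2_def\<close>)
      finally have n: "norm (?A - ?B) \<le> L * D + \<epsilon> * (M0 + 1)" unfolding S_def by (simp add: algebra_simps)
      have "(norm (?A - ?B))\<^sup>2 \<le> (L * D + \<epsilon> * (M0 + 1))\<^sup>2" by (rule power_mono[OF n]) simp
      also have "\<dots> \<le> 2 * (L * D)\<^sup>2 + 2 * (\<epsilon> * (M0 + 1))\<^sup>2"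
        using zero_le_power2[of "L * D - \<epsilon> * (M0 + 1)"] by (simp add: power2_diff power2_sum)
      finally have "\<alpha> / 2 * (norm (?A - ?B))\<^sup>2 \<le> \<alpha> / 2 * (2 * (L * D)\<^sup>2 + 2 * (\<epsilon> * (M0 + 1))\<^sup>2)"
        using small by (intro mult_left_mono) auto
      also have "\<dots> = L\<^sup>2 * (\<alpha> * D\<^sup>2) + (M0 + 1)\<^sup>2 * (\<alpha> * \<epsilon> * \<epsilon>)"
        by (simp add: power_mult_distrib algebra_simps power2_eq_square)
      also have "\<dots> \<le> L\<^sup>2 * \<theta> + (M0 + 1)\<^sup>2 * \<theta>"
      proof (intro add_mono mult_left_mono)
        show "\<alpha> * D\<^sup>2 \<le> \<theta>" using small unfolding D_def by simp
        have "\<alpha> * \<epsilon> * \<epsilon> \<le> \<theta> * 1" by (rule mult_mono) (use small \<theta>0 in auto)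
        then show "\<alpha> * \<epsilon> * \<epsilon> \<le> \<theta>" by simp
      qed auto
      finally have h1: "\<alpha> / 2 * (norm (?A - ?B))\<^sup>2 \<le> \<theta> * (L\<^sup>2 + (M0 + 1)\<^sup>2)" by (simp add: algebra_simps)
      have h2: "\<beta> * (norm ?A)\<^sup>2 \<le> \<theta> * M0\<^sup>2" by (rule mult_mono) (use small sq \<theta>0 in auto)
      have h3: "\<eta> * ((norm ?A)\<^sup>2 + (norm ?B)\<^sup>2) \<le> \<theta> * (M0\<^sup>2 + M0\<^sup>2)"
        by (rule mult_mono[OF _ add_mono[OF sq]]) (use small \<theta>0 in auto)
      show ?thesis by (intro add_mono h1 h2 h3)
    qed
    finally show ?thesis by (simp add: algebra_simps)
  qed
  have C: "e1 * (p \<bullet> b t x v) - e2 * (q \<bullet> b s y v) \<le> 6 * \<theta> * M0 + (2 * L + 2) * \<theta>"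
  proof -
    have "e1 * (p \<bullet> b t x v) - e2 * (q \<bullet> b s y v) = (e1 *\<^sub>R p - e2 *\<^sub>R q) \<bullet> b t x v + e2 * (q \<bullet> (b t x v - b s y v))"
      by (simp add: inner_diff_left inner_diff_right algebra_simps)
    moreover have "(e1 *\<^sub>R p - e2 *\<^sub>R q) \<bullet> b t x v \<le> 6 * \<theta> * M0"
      by (rule order_trans[OF norm_cauchy_schwarz mult_mono[OF P bnd_b[OF t]]]) (use \<theta>0 in auto)
    moreover have "e2 * (q \<bullet> (b t x v - b s y v)) \<le> 1 * (norm q * S)"
    proof -
      have "q \<bullet> (b t x v - b s y v) \<le> norm q * S"
        by (rule order_trans[OF norm_cauchy_schwarz mult_left_mono[OF bdiff]]) simp
      then have "e2 * (q \<bullet> (b t x v - b s y v)) \<le> e2 * (norm q * S)" using e by (intro mult_left_mono) auto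
      also have "\<dots> \<le> 1 * (norm q * S)"
        using e D0 const_pos small unfolding S_def by (intro mult_right_mono mult_nonneg_nonneg add_nonneg_nonneg) auto
      finally show ?thesis .
    qed
    ultimately show ?thesis using QS by linarith
  qed
  define z1 where "z1 = e1 *\<^sub>R (p v* \<sigma> t x v)"
  define z2 where "z2 = e2 *\<^sub>R (q v* \<sigma> s y v)"
  have z12: "norm (z1 - z2) \<le> 6 * \<theta> * M0 + (2 * L + 2) * \<theta>"
  proof -
    have "z1 - z2 = (e1 *\<^sub>R p - e2 *\<^sub>R q) v* \<sigma> t x v + e2 *\<^sub>R (q v* (\<sigma> t x v - \<sigma> s y v))"
      unfolding z1_def z2_def by (simp add: vector_matrix_mult_diff vector_matrix_mult_scaleR vector_matrix_mult_diff_right algebra_simps)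
    then have "norm (z1 - z2) \<le> norm ((e1 *\<^sub>R p - e2 *\<^sub>R q) v* \<sigma> t x v) + norm (e2 *\<^sub>R (q v* (\<sigma> t x v - \<sigma> s y v)))"
      by (metis norm_triangle_ineq)
    also have "norm ((e1 *\<^sub>R p - e2 *\<^sub>R q) v* \<sigma> t x v) \<le> 6 * \<theta> * M0"
      by (rule order_trans[OF norm_vector_matrix_mult_le mult_mono[OF P bnd_\<sigma>[OF t]]]) (use \<theta>0 in auto)
    also have "norm (e2 *\<^sub>R (q v* (\<sigma> t x v - \<sigma> s y v))) \<le> 1 * (norm q * S)"
    proof -
      have "norm (q v* (\<sigma> t x v - \<sigma> s y v)) \<le> norm q * S"
        by (rule order_trans[OF norm_vector_matrix_mult_le mult_left_mono[OF \<sigma>diff]]) simp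
      then show ?thesis unfolding norm_scaleR by (intro mult_mono) (use e in auto)
    qed
    finally show ?thesis using QS by linarith
  qed
  \<comment> \<open>The gradient argument at which the modulus of \<open>f\<close> in time is
    applied; its bound grows with \<open>\<alpha>\<close>.\<close>
  have z2_le: "norm z2 \<le> (\<alpha> + 1) * M0"
  proof -
    have "norm z2 \<le> 1 * norm (q v* \<sigma> s y v)" unfolding z2_def using e by (simp add: mult_left_le_one_le)
    also have "norm (q v* \<sigma> s y v) \<le> norm q * norm (\<sigma> s y v)" by (rule norm_vector_matrix_mult_le)
    also have "norm q * norm (\<sigma> s y v) \<le> (\<alpha> + 1) * M0"
    proof (rule mult_mono)
      have "\<alpha> * D \<le> \<alpha> * 1" using D0 small by (intro mult_left_mono) auto
      then show "norm q \<le> \<alpha> + 1" using q_le small by linarith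
    qed (use bnd_\<sigma>[OF s] small in auto)
    finally show ?thesis by simp
  qed
  have F: "f t x r1 z1 v - f s y r2 z2 v \<le> L * \<bar>r1 - r2\<bar> + L * \<theta> + L * (6 * \<theta> * M0 + (2 * L + 2) * \<theta>) + \<theta>"
  proof -
    have "f t x r1 z1 v - f t y r2 z2 v \<le> L * (D + \<bar>r1 - r2\<bar> + norm (z1 - z2))"
      using lip_f[OF t, of x r1 z1 v y r2 z2] unfolding D_def by linarith
    also have "\<dots> \<le> L * (\<theta> + \<bar>r1 - r2\<bar> + (6 * \<theta> * M0 + (2 * L + 2) * \<theta>))"
      using D0 z12 const_pos by (intro mult_left_mono add_mono) auto
    finally have "f t x r1 z1 v - f t y r2 z2 v \<le> L * \<bar>r1 - r2\<bar> + L * \<theta> + L * (6 * \<theta> * M0 + (2 * L + 2) * \<theta>)"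
      by (simp add: distrib_left)
    then show ?thesis using mod(5)[OF z2_le, of y r2 v] small by (simp add: abs_le_iff)
  qed
  show ?main
    using A B C F unfolding z1_def z2_def e1_def[symmetric] e2_def[symmetric] by (simp add: algebra_simps)
qed

end

text \<open>Dividing by \<open>c + 1\<close> avoids a separate treatment of
  \<open>c = 0\<close>.\<close>

lemma small_factor:
  fixes x c a :: real
  assumes "0 \<le> c" "0 \<le> x" "x \<le> a / (c + 1)"
  shows "x * c \<le> a"
proof -
  have "x * (c + 1) \<le> a" using assms by (simp add: pos_le_divide_eq)
  then have "x * c + x \<le> a" by (simp add: algebra_simps)
  then show ?thesis using assms by linarith
qed

context hjb_data
begin

text \<open>An interior point with a positive gap is needed because the penalty at time
  \<open>0\<close> is tuned to cost little at \<open>tb\<close>. Failure of the inequality leads to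
  an interior near-maximum of the doubled functional, where either the strict gradient constraint or
  the proper equation is contradicted.\<close>

lemma comparison_interior:
  assumes sub: "viscosity_subsolution T U b \<sigma> f G K u1"
    and super: "viscosity_supersolution T U b \<sigma> f G K u2"
    and M: "\<And>t x. t \<in> {0..T} \<Longrightarrow> \<bar>u1 t x\<bar> \<le> M" "\<And>t x. t \<in> {0..T} \<Longrightarrow> \<bar>u2 t x\<bar> \<le> M"
    and terminal: "\<And>x. u1 T x \<le> u2 T x"
    and tb: "tb \<in> {0<..<T}"
  shows "u1 tb xb \<le> u2 tb xb"
proof (rule ccontr)

  \<comment> \<open>Choice of the parameters\<close>
  assume "\<not> u1 tb xb \<le> u2 tb xb"
  \<comment> \<open>A quarter of the gap: the time and space penalties at the reference point cost
    at most \<open>\<kappa>\<close> each, and the inexact maximum another \<open>\<kappa>\<close>,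
    so \<open>\<kappa>\<close> remains.\<close>
  define \<kappa> where "\<kappa> = (u1 tb xb - u2 tb xb) / 4"
  have \<kappa>: "\<kappa> > 0" unfolding \<kappa>_def using \<open>\<not> u1 tb xb \<le> u2 tb xb\<close> by simp
  have tb': "tb \<in> {0..T}" using tb by auto
  have M0': "M \<ge> 0" using M(1)[OF tb', of xb] by linarith
  \<comment> \<open>One more than the Lipschitz constant of \<open>f\<close>, so the gap itself
    survives after the driver is estimated.\<close>
  define l where "l = L + 1"
  have l: "l > 0" unfolding l_def using const_pos by simp
  define W where "W = M + exp M"
  have W: "W \<ge> 0" unfolding W_def using M0' by (simp add: add_nonneg_nonneg)
  define H0 where "H0 = exp (l * T) * (W + M) + 1"
  have H0: "H0 > 0" unfolding H0_def using W M0' by (simp add: add_nonneg_pos)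
  \<comment> \<open>Lower bound for the unweighted gap at the near-maximum; all errors together will
    reach only \<open>3 / 4\<close> of it.\<close>
  define \<nu> where "\<nu> = exp (- (l * T)) * (\<kappa> / 2)"
  have \<nu>: "\<nu> > 0" unfolding \<nu>_def using \<kappa> by simp
  define Ct where "Ct = 3 + L\<^sup>2 + (M0 + 1)\<^sup>2 + 3 * M0\<^sup>2 + (1 + L) * (6 * M0 + 2 * L + 2) + L"
  have Ct: "Ct \<ge> 0" unfolding Ct_def using const_pos by (intro add_nonneg_nonneg mult_nonneg_nonneg) auto
  define c1 where "c1 = F0 + L * W + L + 2 * L\<^sup>2"
  have c1: "c1 \<ge> 0" unfolding c1_def using const_pos W by (intro add_nonneg_nonneg mult_nonneg_nonneg) auto
  \<comment> \<open>The first bound limits the error of the change of variable in the equation, the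
    second its effect on the weighted terminal values.\<close>
  define \<delta> where "\<delta> = min 1 (min ((\<nu> / 4) / (exp W * c1 + 1)) ((\<kappa> / 4) / (exp (l * T) * exp M + 1)))"
  have \<delta>: "0 < \<delta>" "\<delta> \<le> 1" "\<delta> * (exp W * c1) \<le> \<nu> / 4" "\<delta> * (exp (l * T) * exp M) \<le> \<kappa> / 4"
  proof -
    have "exp W * c1 + 1 > 0" "exp (l * T) * exp M + 1 > 0" using c1 by (auto intro: add_nonneg_pos add_pos_pos)
    then have p: "(\<nu> / 4) / (exp W * c1 + 1) > 0" "(\<kappa> / 4) / (exp (l * T) * exp M + 1) > 0"
      using \<nu> \<kappa> by (intro divide_pos_pos; simp)+
    then show d0: "0 < \<delta>" and "\<delta> \<le> 1" unfolding \<delta>_def by auto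
    show "\<delta> * (exp W * c1) \<le> \<nu> / 4" by (rule small_factor) (use d0 c1 in \<open>auto simp: \<delta>_def\<close>)
    show "\<delta> * (exp (l * T) * exp M) \<le> \<kappa> / 4" by (rule small_factor) (use d0 in \<open>auto simp: \<delta>_def\<close>)
  qed
  obtain \<psi> where \<psi>: "\<And>r. \<psi> r - \<delta> * exp (- \<psi> r) = r" "\<And>r. r \<le> \<psi> r"
    "\<And>r. \<psi> r \<le> r + \<delta> * exp (- r)" "continuous_on UNIV \<psi>"
    using exp_perturbation_inverse[of \<delta>] \<delta>(1) by (metis less_imp_le)
  define w where "w t x = \<psi> (u1 t x)" for t x
  have w_eq: "u1 t x = w t x - \<delta> * exp (- w t x)" for t x unfolding w_def using \<psi>(1) by simp
  have w_ge: "u1 t x \<le> w t x" for t x unfolding w_def by (rule \<psi>(2))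
  have w_le: "w t x \<le> u1 t x + \<delta> * exp M" if "t \<in> {0..T}" for t x
  proof -
    have "exp (- u1 t x) \<le> exp M" using M(1)[OF that, of x] by simp
    then have "\<delta> * exp (- u1 t x) \<le> \<delta> * exp M" using \<delta> by (intro mult_left_mono) auto
    then show ?thesis unfolding w_def using \<psi>(3)[of "u1 t x"] by linarith
  qed
  have w_abs: "\<bar>w t x\<bar> \<le> W" if "t \<in> {0..T}" for t x
  proof -
    have "\<delta> * exp M \<le> 1 * exp M" using \<delta> by (intro mult_right_mono) auto
    then show ?thesis using w_ge[of t x] w_le[OF that, of x] M(1)[OF that, of x] exp_gt_zero[of M] unfolding W_def by linarith
  qed
  define c\<delta> where "c\<delta> = k0 * \<delta> * exp (- W) / (1 + exp W)"
  have c\<delta>: "c\<delta> > 0" unfolding c\<delta>_def using const_pos \<delta> by (intro divide_pos_pos mult_pos_pos add_pos_pos) auto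
  \<comment> \<open>Small against the gap in the equation and against the margin
    \<open>c\<delta>\<close> in the gradient constraint.\<close>
  define \<theta> where "\<theta> = min 1 (min ((\<nu> / 2) / (Ct + 1 + 1)) ((c\<delta> / 2) / (6 * norm G + 1)))"
  have \<theta>: "0 < \<theta>" "\<theta> \<le> 1" "\<theta> * (Ct + 1) \<le> \<nu> / 2" "\<theta> * (6 * norm G) \<le> c\<delta> / 2"
  proof -
    have "6 * norm G + 1 > 0" using norm_ge_zero[of G] by linarith
    then have p: "(\<nu> / 2) / (Ct + 1 + 1) > 0" "(c\<delta> / 2) / (6 * norm G + 1) > 0"
      using \<nu> c\<delta> Ct by (auto intro!: divide_pos_pos)
    then show d0: "0 < \<theta>" and "\<theta> \<le> 1" unfolding \<theta>_def by auto
    show "\<theta> * (Ct + 1) \<le> \<nu> / 2" by (rule small_factor) (use d0 Ct in \<open>auto simp: \<theta>_def\<close>)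
    show "\<theta> * (6 * norm G) \<le> c\<delta> / 2" by (rule small_factor) (use d0 in \<open>auto simp: \<theta>_def\<close>)
  qed
  \<comment> \<open>From \<open>\<beta> * (norm x)\<^sup>2 \<le> H0\<close> and
    \<open>\<beta> * H0 \<le> \<theta>\<^sup>2\<close> follows
    \<open>\<beta> * norm x \<le> \<theta>\<close>, although \<open>x\<close> itself is not bounded
    uniformly in \<open>\<beta>\<close>.\<close>
  define \<beta> where "\<beta> = min \<theta> (min (\<theta>\<^sup>2 / (H0 + 1)) (\<kappa> / ((norm xb)\<^sup>2 + 1)))"
  have \<beta>: "0 < \<beta>" "\<beta> \<le> \<theta>" "\<beta> * H0 \<le> \<theta>\<^sup>2" "\<beta> * (norm xb)\<^sup>2 \<le> \<kappa>"
  proof -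
    have p: "\<theta>\<^sup>2 / (H0 + 1) > 0" "\<kappa> / ((norm xb)\<^sup>2 + 1) > 0"
      using \<theta> \<kappa> H0 by (auto intro!: divide_pos_pos add_nonneg_pos)
    then show d0: "0 < \<beta>" and "\<beta> \<le> \<theta>" unfolding \<beta>_def using \<theta> by auto
    show "\<beta> * H0 \<le> \<theta>\<^sup>2" by (rule small_factor) (use d0 H0 in \<open>auto simp: \<beta>_def\<close>)
    show "\<beta> * (norm xb)\<^sup>2 \<le> \<kappa>" by (rule small_factor) (use d0 in \<open>auto simp: \<beta>_def\<close>)
  qed
  \<comment> \<open>Large enough for near-maximum points to lie strictly inside the ball, so that
    touching within \<open>Q\<close> is touching near the point.\<close>
  define R where "R = sqrt (H0 / \<beta>) + norm xb + 2"
  have R0: "R > 0" unfolding R_def using H0 \<beta> by (intro add_nonneg_pos add_nonneg_nonneg) auto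
  \<comment> \<open>Where \<open>exp (- (N * t)) \<ge> 1 / 2\<close> the penalty is at least
    \<open>H0\<close> and excludes a maximum, while \<open>N\<close> is large enough for the cost at
    \<open>tb\<close> to be at most \<open>\<kappa>\<close>.\<close>
  define B where "B = 2 * H0"
  define N where "N = B / (\<kappa> * tb)"
  have B: "B > 0" unfolding B_def using H0 by simp
  have N: "N > 0" unfolding N_def using B \<kappa> tb by simp
  have B_tb: "B * exp (- (N * tb)) \<le> \<kappa>"
  proof -
    have "B / \<kappa> = N * tb" unfolding N_def using tb \<kappa> by simp
    also have "\<dots> \<le> exp (N * tb)" using exp_ge_add_one_self[of "N * tb"] by linarith
    finally have "B \<le> \<kappa> * exp (N * tb)" using \<kappa> by (simp add: field_simps)
    then have "B * exp (- (N * tb)) \<le> \<kappa> * exp (N * tb) * exp (- (N * tb))" by (rule mult_right_mono) simp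
    then show ?thesis by (simp add: mult.assoc exp_add[symmetric])
  qed
  define Q where "Q = {0..T} \<times> cball (0 :: real^'n) R"
  have Q: "compact Q" unfolding Q_def by (intro compact_Times compact_cball compact_Icc)
  have xbR: "norm xb \<le> R" unfolding R_def using H0 \<beta> by simp
  have bQ: "(tb, xb) \<in> Q" unfolding Q_def using tb' xbR by simp
  define Uf where "Uf z = exp (l * fst z) * w (fst z) (snd z) - B * exp (- (N * fst z))" for z :: "real \<times> (real^'n)"
  define Vf where "Vf z = exp (l * fst z) * u2 (fst z) (snd z)" for z :: "real \<times> (real^'n)"
  have cu1: "continuous_on Q (\<lambda>z. u1 (fst z) (snd z))" and cu2: "continuous_on Q (\<lambda>z. u2 (fst z) (snd z))"
    using sub super unfolding viscosity_subsolution_def viscosity_supersolution_def Q_def split_def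
    by (auto elim!: continuous_on_subset)
  have cU: "continuous_on Q Uf" unfolding Uf_def w_def
    by (intro continuous_intros continuous_on_compose2[OF \<psi>(4) cu1]) auto
  have cV: "continuous_on Q Vf" unfolding Vf_def by (intro continuous_intros cu2)
  have UV_le: "Uf (t, x) - Vf (s, y) \<le> H0 - 1" if "t \<in> {0..T}" "s \<in> {0..T}" for t x s y
  proof -
    have e: "exp (l * t) \<le> exp (l * T)" "exp (l * s) \<le> exp (l * T)" using that l by auto
    have "exp (l * t) * w t x \<le> exp (l * t) * W" using w_abs[OF that(1), of x] by (intro mult_left_mono) auto
    also have "\<dots> \<le> exp (l * T) * W" using e W by (intro mult_right_mono)
    finally have 1: "exp (l * t) * w t x \<le> exp (l * T) * W" .
    have "exp (l * s) * (- u2 s y) \<le> exp (l * s) * M" using M(2)[OF that(2), of y] by (intro mult_left_mono) auto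
    also have "\<dots> \<le> exp (l * T) * M" using e M0' by (intro mult_right_mono)
    finally have 2: "exp (l * s) * (- u2 s y) \<le> exp (l * T) * M" .
    have "B * exp (- (N * t)) \<ge> 0" using B by simp
    then show ?thesis unfolding Uf_def Vf_def H0_def using 1 2 by (simp add: distrib_left)
  qed
  have \<kappa>4: "\<kappa> / 4 > 0" using \<kappa> by simp
  obtain \<rho> where \<rho>: "\<rho> > 0" "\<And>z z'. z \<in> Q \<Longrightarrow> z' \<in> Q \<Longrightarrow> dist z z' < \<rho> \<Longrightarrow> \<bar>Uf z - Uf z'\<bar> < \<kappa> / 4 \<and> \<bar>Vf z - Vf z'\<bar> < \<kappa> / 4"
  proof -
    have "uniformly_continuous_on Q Uf" "uniformly_continuous_on Q Vf"
      using compact_uniformly_continuous[OF _ Q] cU cV by auto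
    then obtain r1 r2 where r: "r1 > 0" "\<And>z z'. z \<in> Q \<Longrightarrow> z' \<in> Q \<Longrightarrow> dist z' z < r1 \<Longrightarrow> dist (Uf z') (Uf z) < \<kappa> / 4"
      "r2 > 0" "\<And>z z'. z \<in> Q \<Longrightarrow> z' \<in> Q \<Longrightarrow> dist z' z < r2 \<Longrightarrow> dist (Vf z') (Vf z) < \<kappa> / 4"
      unfolding uniformly_continuous_on_def using \<kappa>4 by metis
    show ?thesis
      by (rule that[of "min r1 r2"]) (use r in \<open>auto simp: dist_real_def\<close>)
  qed
  define \<theta>2 where "\<theta>2 = min \<theta> (\<rho> / 4)"
  have \<theta>2: "0 < \<theta>2" "\<theta>2 \<le> \<theta>" "\<theta>2 \<le> \<rho> / 4" unfolding \<theta>2_def using \<theta> \<rho> by auto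
  \<comment> \<open>\<open>j0\<close> makes \<open>\<alpha>\<close> large enough to force
    \<open>norm (x - y) \<le> \<theta>2\<close>; \<open>J\<close> is the number of candidates that
    guarantees a small decrement.\<close>
  obtain j0 :: nat where j0: "1 / \<theta>2 < 2 ^ j0" using real_arch_pow[of 2 "1 / \<theta>2"] by auto
  obtain J :: nat where J: "8 * H0 / \<theta>2 < real J" using reals_Archimedean2 by blast
  have "0 < 8 * H0 / \<theta>2" using H0 \<theta>2 by simp
  then have J0: "J > 0" using J by (metis less_trans of_nat_0_less_iff)
  have HJ: "H0 / real J \<le> \<theta>2 / 8" using J J0 \<theta>2 by (simp add: field_simps)
  \<comment> \<open>The largest candidate for \<open>\<alpha>\<close>. Moduli in time are taken for
    it, so they serve every candidate, and \<open>\<epsilon>\<close> keeps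
    \<open>\<alpha> * \<epsilon>\<close> small.\<close>
  define Am :: real where "Am = 2 ^ (j0 + J)"
  have Am: "Am \<ge> 1" unfolding Am_def by simp
  define \<epsilon> where "\<epsilon> = \<theta>2 / Am"
  have \<epsilon>: "0 < \<epsilon>" "\<epsilon> \<le> \<theta>2" "Am * \<epsilon> = \<theta>2" unfolding \<epsilon>_def using \<theta>2 Am by (auto simp: field_simps)
  obtain \<tau>1 where \<tau>1: "\<tau>1 > 0" "\<And>t s x v. t \<in> {0..T} \<Longrightarrow> s \<in> {0..T} \<Longrightarrow> \<bar>t - s\<bar> \<le> \<tau>1 \<Longrightarrow>
      norm (b t x v - b s x v) \<le> \<epsilon> \<and> norm (\<sigma> t x v - \<sigma> s x v) \<le> \<epsilon>"
    using time_modulus[OF \<epsilon>(1)] by blast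
  obtain \<tau>2 where \<tau>2: "\<tau>2 > 0" "\<And>t s x r z v. t \<in> {0..T} \<Longrightarrow> s \<in> {0..T} \<Longrightarrow> \<bar>t - s\<bar> \<le> \<tau>2 \<Longrightarrow>
      norm z \<le> (Am + 1) * M0 \<Longrightarrow> \<bar>f t x r z v - f s x r z v\<bar> \<le> \<epsilon>"
    using time_modulus_f[OF \<epsilon>(1), of "(Am + 1) * M0"] by blast
  obtain \<tau>3 where \<tau>3: "\<tau>3 > 0" "\<And>t s. t \<in> {0..T} \<Longrightarrow> s \<in> {0..T} \<Longrightarrow> \<bar>t - s\<bar> \<le> \<tau>3 \<Longrightarrow> \<bar>exp (- (l * t)) - exp (- (l * s))\<bar> \<le> \<epsilon>"
    by (rule uniform_modulus_interval[of T "\<lambda>t. exp (- (l * t))" \<epsilon>]) (use \<epsilon> in \<open>auto intro!: continuous_intros\<close>)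
  obtain \<tau>4 where \<tau>4: "\<tau>4 > 0" "\<And>t s. t \<in> {0..T} \<Longrightarrow> s \<in> {0..T} \<Longrightarrow> \<bar>t - s\<bar> \<le> \<tau>4 \<Longrightarrow> \<bar>exp (- (l * t) / 2) - exp (- (l * s) / 2)\<bar> \<le> \<epsilon>"
    by (rule uniform_modulus_interval[of T "\<lambda>t. exp (- (l * t) / 2)" \<epsilon>]) (use \<epsilon> in \<open>auto intro!: continuous_intros\<close>)
  have \<kappa>M: "\<kappa> / 2 / (M + 1) > 0" using \<kappa> M0' by simp
  obtain \<tau>5 where \<tau>5: "\<tau>5 > 0" "\<And>t s. t \<in> {0..T} \<Longrightarrow> s \<in> {0..T} \<Longrightarrow> \<bar>t - s\<bar> \<le> \<tau>5 \<Longrightarrow> \<bar>exp (l * t) - exp (l * s)\<bar> \<le> \<kappa> / 2 / (M + 1)"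
    by (rule uniform_modulus_interval[of T "\<lambda>t. exp (l * t)" "\<kappa> / 2 / (M + 1)"]) (use \<kappa>M in \<open>auto intro!: continuous_intros\<close>)
  have ln2: "ln 2 / (2 * N) > 0" using N by simp
  \<comment> \<open>The last entry keeps \<open>s\<close> positive once
    \<open>t > ln 2 / N\<close>.\<close>
  define \<tau> where "\<tau> = Min {\<tau>1, \<tau>2, \<tau>3, \<tau>4, \<tau>5, \<rho> / 4, ln 2 / (2 * N)}"
  have \<tau>: "\<tau> > 0" "\<tau> \<le> \<tau>1" "\<tau> \<le> \<tau>2" "\<tau> \<le> \<tau>3" "\<tau> \<le> \<tau>4" "\<tau> \<le> \<tau>5" "\<tau> \<le> \<rho> / 4" "\<tau> \<le> ln 2 / (2 * N)"
  proof -
    show "\<tau> > 0" unfolding \<tau>_def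
      by (subst Min_gr_iff) (use \<tau>1(1) \<tau>2(1) \<tau>3(1) \<tau>4(1) \<tau>5(1) \<rho>(1) ln2 in simp_all)
    show "\<tau> \<le> \<tau>1" "\<tau> \<le> \<tau>2" "\<tau> \<le> \<tau>3" "\<tau> \<le> \<tau>4" "\<tau> \<le> \<tau>5" "\<tau> \<le> \<rho> / 4" "\<tau> \<le> ln 2 / (2 * N)"
      unfolding \<tau>_def by (rule Min_le; simp only: finite.intros insert_iff simp_thms)+
  qed
  \<comment> \<open>Since the penalty is at most \<open>H0\<close> at the near-maximum, this value
    forces \<open>\<bar>t - s\<bar> \<le> \<tau>\<close>.\<close>
  define \<gamma> where "\<gamma> = 2 * H0 / \<tau>\<^sup>2"
  have \<gamma>: "\<gamma> > 0" unfolding \<gamma>_def using H0 \<tau>(1) by simp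
  define \<eta> where "\<eta> = min (\<theta>2 / 8) \<kappa>"
  have \<eta>: "\<eta> > 0" "\<eta> \<le> \<theta>2 / 8" "\<eta> \<le> \<kappa>" unfolding \<eta>_def using \<theta>2 \<kappa> by auto
  define pen where "pen \<alpha> t x s y = \<alpha> / 2 * (norm (x - y))\<^sup>2 + \<gamma> / 2 * (t - s)\<^sup>2 + \<beta> * (norm x)\<^sup>2"
    for \<alpha> t s :: real and x y :: "real^'n"
  have pen0: "pen \<alpha> t x s y \<ge> 0" if "\<alpha> \<ge> 0" for \<alpha> t x s y
    unfolding pen_def using that \<gamma> \<beta> by (intro add_nonneg_nonneg mult_nonneg_nonneg) auto
  define val where "val \<alpha> t x s y = Uf (t, x) - Vf (s, y) - pen \<alpha> t x s y" for \<alpha> t x s y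
  have val_le: "val \<alpha> t x s y \<le> H0" if "\<alpha> \<ge> 0" "(t, x) \<in> Q" "(s, y) \<in> Q" for \<alpha> t x s y
    using UV_le[of t s x y] pen0[OF that(1), of t x s y] that unfolding val_def Q_def by auto
  have val_b: "val \<alpha> tb xb tb xb \<ge> 2 * \<kappa>" for \<alpha>
  proof -
    have "4 * \<kappa> \<le> w tb xb - u2 tb xb" using w_ge[of tb xb] unfolding \<kappa>_def by simp
    moreover have "1 * (w tb xb - u2 tb xb) \<le> exp (l * tb) * (w tb xb - u2 tb xb)"
    proof (rule mult_right_mono)
      show "1 \<le> exp (l * tb)" using l tb by simp
      show "0 \<le> w tb xb - u2 tb xb" using calculation \<kappa> by linarith
    qed
    ultimately show ?thesis
      using B_tb \<beta>(4) unfolding val_def Uf_def Vf_def pen_def by (simp add: right_diff_distrib)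
  qed
  \<comment> \<open>The maximal value as a function of the exponent of the penalty, with
    \<open>\<gamma>\<close> already fixed.\<close>
  define mx where "mx j = (SUP z\<in>Q \<times> Q. val (2 ^ j) (fst (fst z)) (snd (fst z)) (fst (snd z)) (snd (snd z)))" for j :: nat
  have mx_ge: "val (2 ^ j) t x s y \<le> mx j" if "(t, x) \<in> Q" "(s, y) \<in> Q" for j t x s y
  proof -
    have "bdd_above ((\<lambda>z. val (2 ^ j) (fst (fst z)) (snd (fst z)) (fst (snd z)) (snd (snd z))) ` (Q \<times> Q))"
      by (rule bdd_aboveI2[of _ _ H0]) (auto intro!: val_le)
    from cSUP_upper[OF _ this, of "((t, x), (s, y))"] show ?thesis unfolding mx_def using that by simp
  qed
  have mx_le: "mx j \<le> c" if "\<And>t x s y. (t, x) \<in> Q \<Longrightarrow> (s, y) \<in> Q \<Longrightarrow> val (2 ^ j) t x s y \<le> c" for j c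
    unfolding mx_def by (rule cSUP_least) (use bQ that in auto)
  have "\<exists>j\<ge>j0. j < j0 + J \<and> mx j - mx (Suc j) \<le> H0 / real J"
  proof (rule small_decrement[OF _ _ J0])
    show "0 \<le> mx j" for j using mx_ge[OF bQ bQ, of j] val_b[of "2 ^ j"] \<kappa> by linarith
    show "mx j \<le> H0" for j by (rule mx_le) (rule val_le; simp)
  qed
  then obtain j where j: "j \<ge> j0" "j < j0 + J" "mx j - mx (Suc j) \<le> H0 / real J" by blast
  \<comment> \<open>The larger of the two consecutive penalties with a small decrement.\<close>
  define \<alpha> :: real where "\<alpha> = 2 ^ Suc j"
  have \<alpha>: "\<alpha> > 0" "\<alpha> \<le> Am" "1 / \<theta>2 < \<alpha>" "2 ^ j = \<alpha> / 2"
  proof -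
    show "\<alpha> > 0" "2 ^ j = \<alpha> / 2" unfolding \<alpha>_def by auto
    show "\<alpha> \<le> Am" unfolding \<alpha>_def Am_def by (rule power_increasing) (use j in auto)
    have "(2 :: real) ^ j0 \<le> \<alpha>" unfolding \<alpha>_def by (rule power_increasing) (use j in auto)
    then show "1 / \<theta>2 < \<alpha>" using j0 by linarith
  qed
  have nz: "Q \<noteq> {}" using bQ by blast

  \<comment> \<open>Location of the near-maximum\<close>
  obtain t x s y a p a' q X Y C d where tx: "(t, x) \<in> Q" and sy: "(s, y) \<in> Q" and d: "d > 0"
    and opt0: "\<And>t1 x1 s1 y1. (t1, x1) \<in> Q \<Longrightarrow> (s1, y1) \<in> Q \<Longrightarrow>
       Uf (t1, x1) - Vf (s1, y1) - (\<alpha> / 2 * (norm (x1 - y1))\<^sup>2 + \<gamma> / 2 * (t1 - s1)\<^sup>2 + \<beta> * (norm x1)\<^sup>2)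
       \<le> Uf (t, x) - Vf (s, y) - (\<alpha> / 2 * (norm (x - y))\<^sup>2 + \<gamma> / 2 * (t - s)\<^sup>2 + \<beta> * (norm x)\<^sup>2) + \<eta>"
    and aa: "\<bar>a - \<gamma> * (t - s)\<bar> \<le> \<eta>" "\<bar>a' - \<gamma> * (t - s)\<bar> \<le> \<eta>"
    and pq: "norm (p - (\<alpha> *\<^sub>R (x - y) + (2 * \<beta>) *\<^sub>R x)) \<le> \<eta>" "norm (q - \<alpha> *\<^sub>R (x - y)) \<le> \<eta>"
    and XY: "linear X" "linear Y"
    and tU: "\<And>\<tau> h. norm (\<tau>, h) < d \<Longrightarrow> (t + \<tau>, x + h) \<in> Q \<Longrightarrow>
       Uf (t + \<tau>, x + h) \<le> Uf (t, x) + a * \<tau> + p \<bullet> h + X h \<bullet> h / 2 + C * \<tau>\<^sup>2"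
    and tV: "\<And>\<tau> h. norm (\<tau>, h) < d \<Longrightarrow> (s + \<tau>, y + h) \<in> Q \<Longrightarrow>
       Vf (s, y) + a' * \<tau> + q \<bullet> h + Y h \<bullet> h / 2 - C * \<tau>\<^sup>2 \<le> Vf (s + \<tau>, y + h)"
    and XYle: "\<And>h k. X h \<bullet> h / 2 - Y k \<bullet> k / 2 \<le> \<alpha> / 2 * (norm (h - k))\<^sup>2 + \<beta> * (norm h)\<^sup>2 + \<eta> * ((norm h)\<^sup>2 + (norm k)\<^sup>2)"
    by (rule theorem_on_sums[OF Q nz cU cV less_imp_le[OF \<alpha>(1)] less_imp_le[OF \<beta>(1)] less_imp_le[OF \<gamma>] \<eta>(1)])
       (rule that; assumption)
  have t01: "t \<in> {0..T}" "s \<in> {0..T}" using tx sy unfolding Q_def by auto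
  have opt: "val \<alpha> t1 x1 s1 y1 \<le> val \<alpha> t x s y + \<eta>" if "(t1, x1) \<in> Q" "(s1, y1) \<in> Q" for t1 x1 s1 y1
    using opt0[OF that] unfolding val_def pen_def by simp
  have val_\<kappa>: "val \<alpha> t x s y \<ge> \<kappa>" using opt[OF bQ bQ] val_b[of \<alpha>] \<eta> by linarith
  have UV\<kappa>: "Uf (t, x) - Vf (s, y) \<ge> \<kappa>"
    using val_\<kappa> pen0[of \<alpha> t x s y] \<alpha>(1) unfolding val_def by linarith
  have pen_le: "pen \<alpha> t x s y \<le> H0" using val_\<kappa> UV_le[OF t01, of x y] \<kappa> unfolding val_def by linarith
  have parts: "\<alpha> / 2 * (norm (x - y))\<^sup>2 \<ge> 0" "\<gamma> / 2 * (t - s)\<^sup>2 \<ge> 0" "\<beta> * (norm x)\<^sup>2 \<ge> 0" using \<alpha> \<beta> \<gamma> by auto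
  have ts: "\<bar>t - s\<bar> \<le> \<tau>"
  proof -
    have "\<gamma> / 2 * (t - s)\<^sup>2 \<le> H0" using pen_le parts unfolding pen_def by linarith
    then have "H0 * (t - s)\<^sup>2 \<le> H0 * \<tau>\<^sup>2" unfolding \<gamma>_def using \<tau>(1) by (simp add: field_simps)
    then have "(t - s)\<^sup>2 \<le> \<tau>\<^sup>2" using H0 by simp
    then show ?thesis using \<tau>(1) by (simp add: abs_le_square_iff[symmetric])
  qed
  have \<beta>x2: "\<beta> * (norm x)\<^sup>2 \<le> H0" using pen_le parts unfolding pen_def by linarith
  have \<beta>x: "\<beta> * norm x \<le> \<theta>"
  proof (rule power2_le_imp_le)
    have "(\<beta> * norm x)\<^sup>2 = \<beta> * (\<beta> * (norm x)\<^sup>2)" by (simp add: power2_eq_square)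
    also have "\<dots> \<le> \<beta> * H0" using \<beta>x2 \<beta> by (intro mult_left_mono) auto
    finally show "(\<beta> * norm x)\<^sup>2 \<le> \<theta>\<^sup>2" using \<beta>(3) by linarith
  qed (use \<theta> in simp)
  \<comment> \<open>Halving \<open>\<alpha>\<close> raises the value at the near-maximum by a
    quarter of \<open>\<alpha> * (norm (x - y))\<^sup>2\<close>, and this raise is bounded by the
    decrement plus \<open>\<eta>\<close>.\<close>
  have \<alpha>D: "\<alpha> * (norm (x - y))\<^sup>2 \<le> \<theta>2"
  proof -
    have "val (2 ^ j) t x s y = val \<alpha> t x s y + \<alpha> / 4 * (norm (x - y))\<^sup>2"
      unfolding \<alpha>(4) val_def pen_def by (simp add: field_simps)
    then have "val \<alpha> t x s y + \<alpha> / 4 * (norm (x - y))\<^sup>2 \<le> mx j" using mx_ge[OF tx sy, of j] by simp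
    moreover have "mx (Suc j) \<le> val \<alpha> t x s y + \<eta>"
      by (rule mx_le) (use opt in \<open>simp add: \<alpha>_def\<close>)
    ultimately have "\<alpha> / 4 * (norm (x - y))\<^sup>2 \<le> \<theta>2 / 4" using j(3) HJ \<eta>(2) by linarith
    then show ?thesis by simp
  qed
  have D: "norm (x - y) \<le> \<theta>2"
  proof (rule power2_le_imp_le)
    have "1 \<le> \<alpha> * \<theta>2" using \<alpha>(3) \<theta>2(1) by (simp add: field_simps)
    then have "1 * (norm (x - y))\<^sup>2 \<le> (\<alpha> * \<theta>2) * (norm (x - y))\<^sup>2" by (rule mult_right_mono) simp
    also have "\<dots> = \<theta>2 * (\<alpha> * (norm (x - y))\<^sup>2)" by simp
    also have "\<dots> \<le> \<theta>2 * \<theta>2" using \<alpha>D \<theta>2 by (intro mult_left_mono) auto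
    finally show "(norm (x - y))\<^sup>2 \<le> \<theta>2\<^sup>2" by (simp add: power2_eq_square)
  qed (use \<theta>2 in simp)
  have xR: "norm x < R" and yR: "norm y < R"
  proof -
    have "(norm x)\<^sup>2 \<le> H0 / \<beta>" using \<beta>x2 \<beta>(1) by (simp add: field_simps)
    then have n: "norm x \<le> sqrt (H0 / \<beta>)" by (rule real_le_rsqrt)
    then show "norm x < R" unfolding R_def using norm_ge_zero[of xb] by linarith
    have "norm y \<le> norm x + norm (x - y)" using norm_triangle_ineq2[of y x] by (simp add: norm_minus_commute)
    then show "norm y < R" unfolding R_def using n D \<theta>2 \<theta> norm_ge_zero[of xb] by linarith
  qed
  have near: "Uf (T, z) - Vf (T, z) \<le> \<kappa> / 4" for z
  proof -
    have TT: "T \<in> {0..T}" using T_pos by simp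
    have "w T z - u2 T z \<le> \<delta> * exp M" using w_le[OF TT, of z] terminal[of z] by linarith
    then have "exp (l * T) * (w T z - u2 T z) \<le> exp (l * T) * (\<delta> * exp M)" by (rule mult_left_mono) simp
    also have "\<dots> \<le> \<kappa> / 4" using \<delta>(4) by (simp add: mult_ac)
    finally have "exp (l * T) * w T z - exp (l * T) * u2 T z \<le> \<kappa> / 4" by (simp add: right_diff_distrib)
    moreover have "B * exp (- (N * T)) \<ge> 0" using B by simp
    ultimately show ?thesis unfolding Uf_def Vf_def by simp
  qed
  have distxy: "dist (t1, x) (s1, y) < \<rho>" if "\<bar>t1 - s1\<bar> \<le> \<tau>" for t1 s1
  proof -
    have "dist (t1, x) (s1, y) = norm (t1 - s1, x - y)" by (simp add: dist_norm)
    also have "\<dots> \<le> norm (t1 - s1) + norm (x - y)" by (rule norm_Pair_le)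
    also have "\<dots> \<le> \<rho> / 4 + \<rho> / 4" using that \<tau>(7) D \<theta>2 by simp
    finally show ?thesis using \<rho> by linarith
  qed
  have TQ: "(T, x) \<in> Q" "(T, y) \<in> Q" unfolding Q_def using T_pos xR yR by auto
  \<comment> \<open>At \<open>t = T\<close> the other point could be moved to \<open>(T, x)\<close>
    at small cost by uniform continuity, where the terminal inequality leaves less than
    \<open>\<kappa>\<close>.\<close>
  have tT: "t < T"
  proof (rule ccontr)
    assume "\<not> t < T"
    then have tT: "t = T" using t01 by auto
    then have "\<bar>Vf (T, x) - Vf (s, y)\<bar> < \<kappa> / 4" using \<rho>(2)[OF TQ(1) sy] distxy[of T s] ts by simp
    moreover have "\<kappa> \<le> Uf (T, x) - Vf (s, y)" using UV\<kappa> tT by simp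
    ultimately show False using near[of x] \<kappa> unfolding abs_less_iff by linarith
  qed
  have sT: "s < T"
  proof (rule ccontr)
    assume "\<not> s < T"
    then have sT: "s = T" using t01 by auto
    then have "\<bar>Uf (t, x) - Uf (T, y)\<bar> < \<kappa> / 4" using \<rho>(2)[OF tx TQ(2)] distxy[of t T] ts by simp
    moreover have "\<kappa> \<le> Uf (t, x) - Vf (T, y)" using UV\<kappa> sT by simp
    ultimately show False using near[of y] \<kappa> unfolding abs_less_iff by linarith
  qed
  have t_big: "t > ln 2 / N"
  proof (rule ccontr)
    assume "\<not> t > ln 2 / N"
    then have "N * t \<le> ln 2" using N by (simp add: field_simps not_less)
    then have "exp (- (N * t)) \<ge> exp (- ln 2)" by simp
    also have "exp (- ln 2) = (1 / 2 :: real)" by (simp add: exp_minus)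
    finally have "B * exp (- (N * t)) \<ge> B * (1 / 2)" using B by (intro mult_left_mono) auto
    then have "B * exp (- (N * t)) \<ge> H0" unfolding B_def by simp
    moreover have "exp (l * t) * w t x - exp (l * s) * u2 s y \<le> H0 - 1"
    proof -
      have e: "exp (l * t) \<le> exp (l * T)" "exp (l * s) \<le> exp (l * T)" using t01 l by auto
      have "exp (l * t) * w t x \<le> exp (l * t) * W" using w_abs[OF t01(1), of x] by (intro mult_left_mono) auto
      moreover have "exp (l * t) * W \<le> exp (l * T) * W" using e W by (intro mult_right_mono)
      moreover have "exp (l * s) * (- u2 s y) \<le> exp (l * s) * M" using M(2)[OF t01(2), of y] by (intro mult_left_mono) auto
      moreover have "exp (l * s) * M \<le> exp (l * T) * M" using e M0' by (intro mult_right_mono)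
      ultimately show ?thesis unfolding H0_def by argo
    qed
    ultimately show False using UV\<kappa> \<kappa> unfolding Uf_def Vf_def by simp
  qed
  have tI: "t \<in> {0<..<T}" and sI: "s \<in> {0<..<T}"
  proof -
    have "ln 2 / N > 0" using N by simp
    then show "t \<in> {0<..<T}" using t_big tT by simp
    have "ln 2 / (2 * N) = (ln 2 / N) / 2" by simp
    then have "\<tau> \<le> (ln 2 / N) / 2" using \<tau>(8) by argo
    then have "s > 0" using t_big ts \<open>ln 2 / N > 0\<close> by argo
    then show "s \<in> {0<..<T}" using sT by simp
  qed

  \<comment> \<open>Contradiction from the two jets\<close>
  define e1 where "e1 = min d (R - norm x)"
  define e2 where "e2 = min d (R - norm y)"
  have e12: "e1 > 0" "e2 > 0" unfolding e1_def e2_def using d xR yR by auto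
  have touchU: "exp (l * t') * w t' x' - B * exp (- (N * t')) \<le> exp (l * t) * w t x - B * exp (- (N * t))
        + a * (t' - t) + p \<bullet> (x' - x) + X (x' - x) \<bullet> (x' - x) / 2 + C * (t' - t)\<^sup>2"
    if "t' \<in> {0..T}" "norm (t' - t, x' - x) < e1" for t' x'
  proof -
    have "norm (x' - x) \<le> norm (t' - t, x' - x)" by (rule norm_snd_le)
    then have "norm x' < R" using that(2) norm_triangle_ineq2[of x' x] unfolding e1_def by simp
    then have "(t + (t' - t), x + (x' - x)) \<in> Q" unfolding Q_def using that(1) by simp
    from tU[OF _ this] show ?thesis using that(2) unfolding e1_def Uf_def by simp
  qed
  have touchV: "exp (l * s) * u2 s y + a' * (t' - s) + q \<bullet> (x' - y) + Y (x' - y) \<bullet> (x' - y) / 2 - C * (t' - s)\<^sup>2 \<le> exp (l * t') * u2 t' x'"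
    if "t' \<in> {0..T}" "norm (t' - s, x' - y) < e2" for t' x'
  proof -
    have "norm (x' - y) \<le> norm (t' - s, x' - y)" by (rule norm_snd_le)
    then have "norm x' < R" using that(2) norm_triangle_ineq2[of x' y] unfolding e2_def by simp
    then have "(s + (t' - s), y + (x' - y)) \<in> Q" unfolding Q_def using that(1) by simp
    from tV[OF _ this] show ?thesis using that(2) unfolding e2_def Vf_def by simp
  qed
  note subj = subsolution_jet[OF sub \<delta>(1,2) less_imp_le[OF B] less_imp_le[OF N] w_eq tI XY(1) e12(1) touchU w_abs[OF t01(1)]]
  have \<alpha>\<epsilon>: "\<alpha> * \<epsilon> \<le> \<theta>2"
    using mult_right_mono[OF \<alpha>(2), of \<epsilon>] \<epsilon> by simp
  note diff = pde_difference[OF t01 less_imp_le[OF l] \<eta>(1) _ \<theta>(2) less_imp_le[OF \<epsilon>(1)] _ less_imp_le[OF \<beta>(1)] \<beta>(2) \<beta>x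
      less_imp_le[OF \<alpha>(1)] _ _ _ less_imp_le[OF \<gamma>] \<tau>3(2)[OF t01] \<tau>4(2)[OF t01] _ _ _ aa pq XY XYle]
  have sm: "\<eta> \<le> \<theta>" "\<epsilon> \<le> \<theta>" "\<alpha> * \<epsilon> \<le> \<theta>" "\<alpha> * (norm (x - y))\<^sup>2 \<le> \<theta>" "norm (x - y) \<le> \<theta>"
    using \<eta> \<theta>2 \<epsilon> \<alpha>\<epsilon> \<alpha>D D by linarith+
  have tss: "\<bar>t - s\<bar> \<le> \<tau>1" "\<bar>t - s\<bar> \<le> \<tau>2" "\<bar>t - s\<bar> \<le> \<tau>3" "\<bar>t - s\<bar> \<le> \<tau>4" "\<bar>t - s\<bar> \<le> \<tau>5"
    using ts \<tau> by linarith+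
  have mb: "norm (b t x v - b s x v) \<le> \<epsilon>" "norm (\<sigma> t x v - \<sigma> s x v) \<le> \<epsilon>" for x v
    using \<tau>1(2)[OF t01 tss(1)] by auto
  have mf: "\<bar>f t x r z v - f s x r z v\<bar> \<le> \<epsilon>" if "norm z \<le> (\<alpha> + 1) * M0" for x r z v
  proof -
    have "(\<alpha> + 1) * M0 \<le> (Am + 1) * M0" using \<alpha>(2) const_pos by (intro mult_right_mono) auto
    then show ?thesis using \<tau>2(2)[OF t01 tss(2)] that by force
  qed
  note diff' = diff[OF sm(1,2,3,4,5) tss(3,4) mb mf]
  from supersolution_jet[OF super sI XY(2) e12(2) touchV \<eta>(1)]
  show False
  proof
    assume "\<exists>i. exp (- (l * s)) * (q v* G) $ i + K $ i \<le> 0"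
    then obtain i where "exp (- (l * s)) * (q v* G) $ i + K $ i \<le> 0" by blast
    moreover have "exp (- (l * t)) * (p v* G) $ i + K $ i \<ge> c\<delta>" unfolding c\<delta>_def by (rule subj(1))
    ultimately have "c\<delta> \<le> 6 * \<theta> * norm G" using diff'(1)[of i] by linarith
    then show False using \<theta>(4) c\<delta> by (simp add: mult_ac)
  next
    assume "\<exists>v\<in>U. exp (- (l * s)) * (a' + (\<Sum>j\<in>UNIV. Y (column j (\<sigma> s y v)) \<bullet> column j (\<sigma> s y v)) / 2
        + q \<bullet> b s y v) + f s y (u2 s y) (exp (- (l * s)) *\<^sub>R (q v* \<sigma> s y v)) v \<le> l * u2 s y + \<eta>"
    then obtain v where v: "v \<in> U" and II: "exp (- (l * s)) * (a' + (\<Sum>j\<in>UNIV. Y (column j (\<sigma> s y v)) \<bullet> column j (\<sigma> s y v)) / 2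
        + q \<bullet> b s y v) + f s y (u2 s y) (exp (- (l * s)) *\<^sub>R (q v* \<sigma> s y v)) v \<le> l * u2 s y + \<eta>" by blast
    have I: "l * w t x \<le> exp (- (l * t)) * (a + (\<Sum>j\<in>UNIV. X (column j (\<sigma> t x v)) \<bullet> column j (\<sigma> t x v)) / 2
        + p \<bullet> b t x v) + f t x (w t x) (exp (- (l * t)) *\<^sub>R (p v* \<sigma> t x v)) v + \<delta> * exp W * c1"
      unfolding c1_def using subj(2) v by blast
    \<comment> \<open>The weighted gap compares different times; replacing one weight by the other
      costs at most \<open>\<kappa> / 2\<close>.\<close>
    have gap: "w t x - u2 s y \<ge> \<nu>"
    proof -
      have "B * exp (- (N * t)) \<ge> 0" using B by simp
      then have 1: "exp (l * t) * w t x - exp (l * s) * u2 s y \<ge> \<kappa>" using UV\<kappa> unfolding Uf_def Vf_def by simp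
      have "(exp (l * t) - exp (l * s)) * u2 s y \<le> \<bar>exp (l * t) - exp (l * s)\<bar> * \<bar>u2 s y\<bar>"
        by (metis abs_ge_self abs_mult)
      also have "\<dots> \<le> (\<kappa> / 2 / (M + 1)) * M"
        by (rule mult_mono) (use \<tau>5(2)[OF t01 tss(5)] M(2)[OF t01(2), of y] \<kappa>M in auto)
      also have "\<dots> \<le> \<kappa> / 2" by (rule small_factor) (use M0' \<kappa>M in auto)
      finally have "(exp (l * t) - exp (l * s)) * u2 s y \<le> \<kappa> / 2" .
      then have "exp (l * t) * (w t x - u2 s y) \<ge> \<kappa> / 2" using 1 by (simp add: algebra_simps)
      then have "exp (- (l * t)) * (\<kappa> / 2) \<le> exp (- (l * t)) * (exp (l * t) * (w t x - u2 s y))"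
        by (rule mult_left_mono) simp
      also have "\<dots> = w t x - u2 s y" by (simp add: mult.assoc[symmetric] exp_add[symmetric])
      finally have "exp (- (l * t)) * (\<kappa> / 2) \<le> w t x - u2 s y" .
      moreover have "\<nu> \<le> exp (- (l * t)) * (\<kappa> / 2)" unfolding \<nu>_def
        by (rule mult_right_mono) (use t01 l \<kappa> in auto)
      ultimately show ?thesis by linarith
    qed
    \<comment> \<open>With \<open>l = L + 1\<close> the Lipschitz term cancels all but one copy of
      the gap, which is then bounded by \<open>3 / 4 * \<nu>\<close>.\<close>
    have "l * w t x - l * u2 s y \<le> L * \<bar>w t x - u2 s y\<bar> + \<theta> * Ct + \<eta> + \<delta> * exp W * c1"
      using diff'(2)[of v "w t x" "u2 s y"] I II unfolding Ct_def by linarith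
    moreover have "\<bar>w t x - u2 s y\<bar> = w t x - u2 s y" using gap \<nu> by simp
    ultimately have "w t x - u2 s y \<le> \<theta> * Ct + \<eta> + \<delta> * exp W * c1" unfolding l_def by (simp add: algebra_simps)
    also have "\<dots> \<le> \<theta> * Ct + \<theta> + \<nu> / 4" using sm(1) \<delta>(3) by (simp add: mult_ac)
    also have "\<dots> \<le> \<nu> / 2 + \<nu> / 4" using \<theta>(3) by (simp add: algebra_simps)
    finally show False using gap \<nu> by linarith
  qed
qed

text \<open>Both functions are continuous up to the end points, so the inequality extends from
  interior times, in particular to time \<open>0\<close>.\<close>

lemma comparison:
  assumes sub: "viscosity_subsolution T U b \<sigma> f G K u1"
    and super: "viscosity_supersolution T U b \<sigma> f G K u2"
    and bd: "\<And>t x. t \<in> {0..T} \<Longrightarrow> \<bar>u1 t x\<bar> \<le> M" "\<And>t x. t \<in> {0..T} \<Longrightarrow> \<bar>u2 t x\<bar> \<le> M"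
    and terminal: "\<And>x. u1 T x \<le> u2 T x"
    and t: "t \<in> {0..T}"
  shows "u1 t x \<le> u2 t x"
proof -
  have cl: "closure {0<..<T} = {0..T}" using T_pos by simp
  have c: "continuous_on ({0..T} \<times> UNIV) (\<lambda>z. u1 (fst z) (snd z))" "continuous_on ({0..T} \<times> UNIV) (\<lambda>z. u2 (fst z) (snd z))"
    using sub super unfolding viscosity_subsolution_def viscosity_supersolution_def split_def by auto
  have i: "continuous_on {0..T} (\<lambda>s. (s, x))" by (intro continuous_intros)
  have "continuous_on {0..T} (\<lambda>s. u1 s x)" "continuous_on {0..T} (\<lambda>s. u2 s x)"
    using continuous_on_compose2[OF c(1) i] continuous_on_compose2[OF c(2) i] by auto
  then have "continuous_on (closure {0<..<T}) (\<lambda>s. u1 s x - u2 s x)"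
    unfolding cl by (intro continuous_intros)
  then have "u1 t x - u2 t x \<le> 0"
    by (rule continuous_le_on_closure) (use t comparison_interior[OF sub super bd terminal] in \<open>auto simp: cl\<close>)
  then show ?thesis by simp
qed

end

section \<open>Uniqueness\<close>

lemma finite_common_threshold:
  fixes P :: "'a \<Rightarrow> real \<Rightarrow> bool"
  assumes "finite k" and "\<And>z. z \<in> k \<Longrightarrow> \<exists>\<tau>>0. \<forall>r. r \<le> \<tau> \<longrightarrow> P z r"
  shows "\<exists>\<tau>>0. \<forall>z\<in>k. \<forall>r. r \<le> \<tau> \<longrightarrow> P z r"
  using assms
proof (induction k rule: finite_induct)
  case empty
  show ?case by (intro exI[of _ 1]) auto
next
  case (insert z k)
  then obtain \<tau>1 where "\<tau>1 > 0" "\<And>z r. z \<in> k \<Longrightarrow> r \<le> \<tau>1 \<Longrightarrow> P z r" by force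
  moreover obtain \<tau>2 where "\<tau>2 > 0" "\<And>r. r \<le> \<tau>2 \<Longrightarrow> P z r" using insert.prems[of z] by auto
  ultimately show ?case by (intro exI[of _ "min \<tau>1 \<tau>2"]) auto
qed

text \<open>Finitely many \<open>z\<close> that are \<open>\<epsilon> / (3 * L)\<close>-dense in the
  ball of radius \<open>Z\<close> have a common modulus; the Lipschitz bound in \<open>z\<close>
  carries it to the whole ball at the price of two further thirds of
  \<open>\<epsilon>\<close>.\<close>

lemma lipschitz_in_z_time_modulus:
  fixes f :: "real \<Rightarrow> 'x::metric_space \<Rightarrow> real \<Rightarrow> 'd::euclidean_space \<Rightarrow> 'k::metric_space \<Rightarrow> real"
  assumes uc: "\<And>z. uniformly_continuous_on ({0..T} \<times> UNIV \<times> UNIV \<times> UNIV) (\<lambda>(s, x, y, u). f s x y z u)"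
    and lip: "\<And>t x r z z' v. t \<in> {0..T} \<Longrightarrow> \<bar>f t x r z v - f t x r z' v\<bar> \<le> L * norm (z - z')"
    and L: "L > 0" and \<epsilon>: "\<epsilon> > 0"
  shows "\<exists>\<tau>>0. \<forall>t\<in>{0..T}. \<forall>s\<in>{0..T}. \<bar>t - s\<bar> \<le> \<tau> \<longrightarrow>
        (\<forall>x r z v. norm z \<le> Z \<longrightarrow> \<bar>f t x r z v - f s x r z v\<bar> \<le> \<epsilon>)"
proof -
  define r where "r = \<epsilon> / (3 * L)"
  have r: "r > 0" unfolding r_def using L \<epsilon> by simp
  have "seq_compact (cball (0 :: 'd) Z)" using compact_cball compact_imp_seq_compact by blast
  from seq_compact_imp_totally_bounded[OF this, rule_format, OF r]
  obtain k where k: "finite k" "k \<subseteq> cball (0 :: 'd) Z" "cball 0 Z \<subseteq> (\<Union>z\<in>k. ball z r)"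
    by (elim exE conjE) (rule that)
  have "\<exists>\<tau>>0. \<forall>z\<in>k. \<forall>d. d \<le> \<tau> \<longrightarrow> (\<forall>t\<in>{0..T}. \<forall>s\<in>{0..T}. \<bar>t - s\<bar> \<le> d \<longrightarrow> (\<forall>x r v. \<bar>f t x r z v - f s x r z v\<bar> \<le> \<epsilon> / 3))"
  proof (rule finite_common_threshold[OF k(1)])
    fix z assume "z \<in> k"
    have "\<epsilon> / 3 > 0" using \<epsilon> by simp
    from uc[of z, unfolded uniformly_continuous_on_def, rule_format, OF this]
    obtain d where d: "d > 0" and dd: "\<forall>p\<in>{0..T} \<times> UNIV \<times> UNIV \<times> UNIV. \<forall>p'\<in>{0..T} \<times> UNIV \<times> UNIV \<times> UNIV.
        dist p' p < d \<longrightarrow> dist ((\<lambda>(s, x, y, u). f s x y z u) p') ((\<lambda>(s, x, y, u). f s x y z u) p) < \<epsilon> / 3"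
      by (elim exE conjE) (rule that)
    have "\<bar>f t x r z v - f s x r z v\<bar> \<le> \<epsilon> / 3" if "t \<in> {0..T}" "s \<in> {0..T}" "\<bar>t - s\<bar> \<le> d / 2" for t s x r v
      using dd[rule_format, of "(s, x, r, v)" "(t, x, r, v)"] that d by (simp add: dist_Pair_Pair dist_real_def)
    then show "\<exists>\<tau>>0. \<forall>d. d \<le> \<tau> \<longrightarrow> (\<forall>t\<in>{0..T}. \<forall>s\<in>{0..T}. \<bar>t - s\<bar> \<le> d \<longrightarrow> (\<forall>x r v. \<bar>f t x r z v - f s x r z v\<bar> \<le> \<epsilon> / 3))"
      using d by (intro exI[of _ "d / 2"] conjI allI impI ballI) auto
  qed
  then obtain \<tau> where \<tau>: "\<tau> > 0" and mod: "\<forall>z\<in>k. \<forall>d. d \<le> \<tau> \<longrightarrow> (\<forall>t\<in>{0..T}. \<forall>s\<in>{0..T}. \<bar>t - s\<bar> \<le> d \<longrightarrow> (\<forall>x r v. \<bar>f t x r z v - f s x r z v\<bar> \<le> \<epsilon> / 3))"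
    by (elim exE conjE) (rule that)
  show ?thesis
  proof (intro exI[of _ \<tau>] conjI ballI impI allI \<tau>)
    fix t s :: real and x y and z :: 'd and v assume *: "t \<in> {0..T}" "s \<in> {0..T}" "\<bar>t - s\<bar> \<le> \<tau>" "norm z \<le> Z"
    then have "z \<in> (\<Union>z\<in>k. ball z r)" by (intro subsetD[OF k(3)]) simp
    then obtain z0 where z0: "z0 \<in> k" "dist z0 z < r" unfolding UN_iff mem_ball by (elim bexE) (rule that)
    have "L * norm (z - z0) \<le> L * r" using z0(2) L by (intro mult_left_mono) (auto simp: dist_norm norm_minus_commute)
    also have "L * r = \<epsilon> / 3" unfolding r_def using L by simp
    finally have "L * norm (z - z0) \<le> \<epsilon> / 3" .
    then show "\<bar>f t x y z v - f s x y z v\<bar> \<le> \<epsilon>"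
      using lip[OF *(1), of x y z v z0] lip[OF *(2), of x y z v z0] mod[rule_format, OF z0(1) order_refl *(1,2,3), of x y v] by linarith
  qed
qed

text \<open>The delicate constant is \<open>F0\<close>: boundedness of \<open>f\<close> in
  \<open>x\<close> is assumed separately for each value of the other arguments. Finitely many times
  and one control suffice, combined with the modulus in time and the Lipschitz bound over the
  bounded set \<open>U\<close>.\<close>

lemma hjb_data_from_assumptions:
  fixes T :: real
    and U :: "(real^'k) set"
    and b :: "real \<Rightarrow> real^'n \<Rightarrow> real^'k \<Rightarrow> real^'n"
    and \<sigma> :: "real \<Rightarrow> real^'n \<Rightarrow> real^'k \<Rightarrow> real^'d^'n"
    and f :: "real \<Rightarrow> real^'n \<Rightarrow> real \<Rightarrow> real^'d \<Rightarrow> real^'k \<Rightarrow> real"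
    and K :: "real^'m"
  assumes T: "T > 0" and U: "compact U" "U \<noteq> {}"
    and A1: "lipschitz_diffusion_coeffs T b \<sigma>"
    and A2: "lipschitz_driver_terminal T f \<Phi>"
    and A3: "positive_singular_cost K"
    and A4: "bounded_ucont_data T b \<sigma> f \<Phi>"
  shows "\<exists>L M0 F0 k0. hjb_data T U b \<sigma> f K L M0 F0 k0"
proof -
  obtain C1 where C1: "C1 > 0" "\<And>s x1 x2 u1 u2. s \<in> {0..T} \<Longrightarrow>
      norm (b s x1 u1 - b s x2 u2) + norm (\<sigma> s x1 u1 - \<sigma> s x2 u2) \<le> C1 * (norm (x1 - x2) + norm (u1 - u2))"
  proof -
    from A1[unfolded lipschitz_diffusion_coeffs_def, THEN conjunct2, THEN conjunct2]
    obtain C1 where "C1 > 0" and "\<forall>s\<in>{0..T}. \<forall>x1 x2 u1 u2.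
          norm (b s x1 u1 - b s x2 u2) + norm (\<sigma> s x1 u1 - \<sigma> s x2 u2) \<le> C1 * (norm (x1 - x2) + norm (u1 - u2))"
      by (elim exE conjE) (rule that)
    then show ?thesis by (intro that[of C1]) simp_all
  qed
  obtain C2 where C2: "C2 > 0" "\<And>s x1 x2 y1 y2 z1 z2 u1 u2. s \<in> {0..T} \<Longrightarrow>
      \<bar>f s x1 y1 z1 u1 - f s x2 y2 z2 u2\<bar> + \<bar>\<Phi> x1 - \<Phi> x2\<bar>
        \<le> C2 * (norm (x1 - x2) + \<bar>y1 - y2\<bar> + norm (z1 - z2) + norm (u1 - u2))"
  proof -
    from A2[unfolded lipschitz_driver_terminal_def, THEN conjunct2, THEN conjunct2]
    obtain C2 where "C2 > 0" and "\<forall>s\<in>{0..T}. \<forall>x1 x2 y1 y2 z1 z2 u1 u2.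
          \<bar>f s x1 y1 z1 u1 - f s x2 y2 z2 u2\<bar> + \<bar>\<Phi> x1 - \<Phi> x2\<bar>
            \<le> C2 * (norm (x1 - x2) + \<bar>y1 - y2\<bar> + norm (z1 - z2) + norm (u1 - u2))"
      by (elim exE conjE) (rule that)
    then show ?thesis by (intro that[of C2]) simp_all
  qed
  define L where "L = C1 + C2"
  have L: "L > 0" "C1 \<le> L" "C2 \<le> L" unfolding L_def using C1 C2 by auto
  have lip_f: "\<bar>f t x r z v - f t x' r' z' v'\<bar> \<le> L * (norm (x - x') + \<bar>r - r'\<bar> + norm (z - z') + norm (v - v'))"
    if "t \<in> {0..T}" for t x r z v x' r' z' v'
  proof -
    have "\<bar>f t x r z v - f t x' r' z' v'\<bar> \<le> C2 * (norm (x - x') + \<bar>r - r'\<bar> + norm (z - z') + norm (v - v'))"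
      using C2(2)[OF that, of x r z v x' r' z' v'] abs_ge_zero[of "\<Phi> x - \<Phi> x'"] by linarith
    also have "\<dots> \<le> L * (norm (x - x') + \<bar>r - r'\<bar> + norm (z - z') + norm (v - v'))"
      using L by (intro mult_right_mono) auto
    finally show ?thesis .
  qed
  have "bounded ((\<lambda>(t, x, v). b t x v) ` ({0..T} \<times> UNIV \<times> UNIV))" "bounded ((\<lambda>(t, x, v). \<sigma> t x v) ` ({0..T} \<times> UNIV \<times> UNIV))"
    using A4 unfolding bounded_ucont_data_def by auto
  then obtain Mb M\<sigma> where Mb0: "\<forall>y\<in>(\<lambda>(t, x, v). b t x v) ` ({0..T} \<times> UNIV \<times> UNIV). norm y \<le> Mb"
    and M\<sigma>0: "\<forall>y\<in>(\<lambda>(t, x, v). \<sigma> t x v) ` ({0..T} \<times> UNIV \<times> UNIV). norm y \<le> M\<sigma>"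
    unfolding bounded_iff by (elim exE) (rule that)
  have Mb: "norm (b t x v) \<le> Mb" and M\<sigma>: "norm (\<sigma> t x v) \<le> M\<sigma>" if "t \<in> {0..T}" for t x v
    using that by (intro bspec[OF Mb0] bspec[OF M\<sigma>0] image_eqI[of _ _ "(t, x, v)"]; simp)+
  obtain k0 where k0: "k0 > 0" "\<And>i. K $ i > k0" using A3 unfolding positive_singular_cost_def by blast
  have ucf: "uniformly_continuous_on ({0..T} \<times> UNIV \<times> UNIV \<times> UNIV) (\<lambda>(s, x, y, u). f s x y z u)" for z
    by (rule A2[unfolded lipschitz_driver_terminal_def, THEN conjunct1, rule_format])
  have tmf: "\<exists>\<tau>>0. \<forall>t\<in>{0..T}. \<forall>s\<in>{0..T}. \<bar>t - s\<bar> \<le> \<tau> \<longrightarrow>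
        (\<forall>x r z v. norm z \<le> Z \<longrightarrow> \<bar>f t x r z v - f s x r z v\<bar> \<le> \<epsilon>)" if "\<epsilon> > 0" for \<epsilon> Z
  proof (rule lipschitz_in_z_time_modulus[OF ucf _ L(1) that])
    fix t x r z z' v assume "t \<in> {0..T}"
    from lip_f[OF this, of x r z v x r z' v] show "\<bar>f t x r z v - f t x r z' v\<bar> \<le> L * norm (z - z')" by simp
  qed
  have tm: "\<exists>\<tau>>0. \<forall>t\<in>{0..T}. \<forall>s\<in>{0..T}. \<bar>t - s\<bar> \<le> \<tau> \<longrightarrow>
        (\<forall>x v. norm (b t x v - b s x v) \<le> \<epsilon> \<and> norm (\<sigma> t x v - \<sigma> s x v) \<le> \<epsilon>)" if \<epsilon>: "\<epsilon> > 0" for \<epsilon>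
  proof -
    have "uniformly_continuous_on ({0..T} \<times> UNIV \<times> UNIV) (\<lambda>(s, x, u). b s x u)"
      "uniformly_continuous_on ({0..T} \<times> UNIV \<times> UNIV) (\<lambda>(s, x, u). \<sigma> s x u)"
      using A1 unfolding lipschitz_diffusion_coeffs_def by auto
    note uc = this(1)[unfolded uniformly_continuous_on_def, rule_format, OF \<epsilon>] this(2)[unfolded uniformly_continuous_on_def, rule_format, OF \<epsilon>]
    from uc(1) obtain d1 where d1: "d1 > 0" and dd1: "\<forall>p\<in>{0..T} \<times> UNIV \<times> UNIV. \<forall>p'\<in>{0..T} \<times> UNIV \<times> UNIV. dist p' p < d1 \<longrightarrow>
          dist ((\<lambda>(s, x, u). b s x u) p') ((\<lambda>(s, x, u). b s x u) p) < \<epsilon>"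
      by (elim exE conjE) (rule that)
    from uc(2) obtain d2 where d2: "d2 > 0" and dd2: "\<forall>p\<in>{0..T} \<times> UNIV \<times> UNIV. \<forall>p'\<in>{0..T} \<times> UNIV \<times> UNIV. dist p' p < d2 \<longrightarrow>
          dist ((\<lambda>(s, x, u). \<sigma> s x u) p') ((\<lambda>(s, x, u). \<sigma> s x u) p) < \<epsilon>"
      by (elim exE conjE) (rule that)
    show ?thesis
    proof (intro exI[of _ "min d1 d2 / 2"] conjI ballI impI allI)
      show "min d1 d2 / 2 > 0" using d1 d2 by simp
      fix t s x v assume *: "t \<in> {0..T}" "s \<in> {0..T}" "\<bar>t - s\<bar> \<le> min d1 d2 / 2"
      then have "\<bar>t - s\<bar> < d1" "\<bar>t - s\<bar> < d2" using d1 d2 by auto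
      then show "norm (b t x v - b s x v) \<le> \<epsilon>" "norm (\<sigma> t x v - \<sigma> s x v) \<le> \<epsilon>"
        using dd1[rule_format, of "(s, x, v)" "(t, x, v)"] dd2[rule_format, of "(s, x, v)" "(t, x, v)"] *
        by (simp_all add: dist_Pair_Pair dist_real_def dist_norm)
    qed
  qed
  obtain F0 where F0: "\<And>t x v. t \<in> {0..T} \<Longrightarrow> v \<in> U \<Longrightarrow> \<bar>f t x 0 0 v\<bar> \<le> F0" "F0 \<ge> 0"
  proof -
    obtain v0 where v0: "v0 \<in> U" using U by blast
    obtain BU where BU: "\<And>v. v \<in> U \<Longrightarrow> norm v \<le> BU" using compact_imp_bounded[OF U(1)] unfolding bounded_iff by blast
    obtain \<tau> where \<tau>: "\<tau> > 0" "\<And>t s x. t \<in> {0..T} \<Longrightarrow> s \<in> {0..T} \<Longrightarrow> \<bar>t - s\<bar> \<le> \<tau> \<Longrightarrow> \<bar>f t x 0 0 v0 - f s x 0 0 v0\<bar> \<le> 1"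
    proof -
      obtain \<tau> where "\<tau> > 0" "\<forall>t\<in>{0..T}. \<forall>s\<in>{0..T}. \<bar>t - s\<bar> \<le> \<tau> \<longrightarrow>
        (\<forall>x r z v. norm z \<le> 0 \<longrightarrow> \<bar>f t x r z v - f s x r z v\<bar> \<le> 1)" using tmf[of 1 0] by auto
      then show ?thesis by (intro that[of \<tau>]) auto
    qed
    have "seq_compact {0..T::real}" by (intro compact_imp_seq_compact compact_Icc)
    from seq_compact_imp_totally_bounded[OF this, rule_format, OF \<tau>(1)]
    obtain k where k: "finite k" "k \<subseteq> {0..T}" "{0..T} \<subseteq> (\<Union>t\<in>k. ball t \<tau>)"
      by (elim exE conjE) (rule that)
    have "bounded (\<Union>t\<in>k. range (\<lambda>x. f t x 0 0 v0))"
      using k A4 unfolding bounded_ucont_data_def by (intro bounded_UN) auto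
    then obtain B where B0: "\<forall>y\<in>(\<Union>t\<in>k. range (\<lambda>x. f t x 0 0 v0)). norm y \<le> B" unfolding bounded_iff by (elim exE) (rule that)
    have B: "\<bar>f t x 0 0 v0\<bar> \<le> B" if "t \<in> k" for t x
      using bspec[OF B0 UN_I[OF that rangeI[of _ x]]] by simp
    have main: "\<bar>f t x 0 0 v\<bar> \<le> B + 1 + L * (BU + BU)" if t: "t \<in> {0..T}" and v: "v \<in> U" for t x v
    proof -
      have "t \<in> (\<Union>t\<in>k. ball t \<tau>)" by (rule subsetD[OF k(3) t])
      then obtain s where s: "s \<in> k" "dist s t < \<tau>" unfolding UN_iff mem_ball by (elim bexE) (rule that)
      have "\<bar>f t x 0 0 v0 - f s x 0 0 v0\<bar> \<le> 1" using \<tau>(2)[OF t, of s x] s k(2) by (auto simp: dist_real_def abs_minus_commute)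
      moreover have "\<bar>f t x 0 0 v - f t x 0 0 v0\<bar> \<le> L * norm (v - v0)" using lip_f[OF t, of x 0 0 v x 0 0 v0] by simp
      moreover have "L * norm (v - v0) \<le> L * (BU + BU)"
        using norm_triangle_ineq4[of v v0] BU[OF v] BU[OF v0] L by (intro mult_left_mono) auto
      ultimately show ?thesis using B[OF s(1), of x] by linarith
    qed
    show ?thesis
      by (rule that[OF order_trans[OF main abs_ge_self] abs_ge_zero])
  qed
  have "hjb_data T U b \<sigma> f K L (max (max Mb M\<sigma>) 0) F0 k0"
  proof
    show "T > 0" "U \<noteq> {}" "L > 0" "max (max Mb M\<sigma>) 0 \<ge> 0" "F0 \<ge> 0" "k0 > 0"
      using T U L F0 k0 by auto
    show "k0 \<le> K $ i" for i using k0(2)[of i] by simp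
    show "\<bar>f t x 0 0 v\<bar> \<le> F0" if "t \<in> {0..T}" "v \<in> U" for t x v using F0(1)[OF that] .
    show "norm (b t x v) \<le> max (max Mb M\<sigma>) 0" "norm (\<sigma> t x v) \<le> max (max Mb M\<sigma>) 0" if "t \<in> {0..T}" for t x v
      using Mb[OF that, of x v] M\<sigma>[OF that, of x v] by auto
    show "\<bar>f t x r z v - f t x' r' z' v\<bar> \<le> L * (norm (x - x') + \<bar>r - r'\<bar> + norm (z - z'))" if "t \<in> {0..T}" for t x r z v x' r' z'
      using lip_f[OF that, of x r z v x' r' z' v] by simp
    have "norm (b t x v - b t y v) + norm (\<sigma> t x v - \<sigma> t y v) \<le> L * norm (x - y)" if "t \<in> {0..T}" for t x v y
      using C1(2)[OF that, of x v y v] mult_right_mono[OF L(2), of "norm (x - y)"] by simp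
    then show "norm (b t x v - b t y v) \<le> L * norm (x - y)" "norm (\<sigma> t x v - \<sigma> t y v) \<le> L * norm (x - y)" if "t \<in> {0..T}" for t x v y
      using that norm_ge_zero[of "b t x v - b t y v"] norm_ge_zero[of "\<sigma> t x v - \<sigma> t y v"] by (smt (verit))+
  qed (use tm tmf in auto)
  then show ?thesis by blast
qed

theorem theorem21:
  fixes T :: real
    and U :: "(real^'k) set"
    and b :: "real \<Rightarrow> real^'n \<Rightarrow> real^'k \<Rightarrow> real^'n"
    and \<sigma> :: "real \<Rightarrow> real^'n \<Rightarrow> real^'k \<Rightarrow> real^'d^'n"
    and f :: "real \<Rightarrow> real^'n \<Rightarrow> real \<Rightarrow> real^'d \<Rightarrow> real^'k \<Rightarrow> real"
    and \<Phi> :: "real^'n \<Rightarrow> real"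
    and G :: "real^'m^'n"
    and K :: "real^'m"
    and u1 u2 :: "real \<Rightarrow> real^'n \<Rightarrow> real"
  assumes "T > 0" and "compact U" and "U \<noteq> {}"
    and A1: "lipschitz_diffusion_coeffs T b \<sigma>"
    and A2: "lipschitz_driver_terminal T f \<Phi>"
    and A3: "positive_singular_cost K"
    and A4: "bounded_ucont_data T b \<sigma> f \<Phi>"
    and A5: "driver_spatial_modulus T f"
    and "bounded_continuous T u1" and "viscosity_solution T U b \<sigma> f \<Phi> G K u1"
    and "bounded_continuous T u2" and "viscosity_solution T U b \<sigma> f \<Phi> G K u2"
  shows "\<forall>t\<in>{0..T}. \<forall>x. u1 t x = u2 t x"
proof -
  obtain L M0 F0 k0 where "hjb_data T U b \<sigma> f K L M0 F0 k0"
    using hjb_data_from_assumptions[OF assms(1-3) A1 A2 A3 A4] by blast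
  then interpret hjb_data T U b \<sigma> f G K L M0 F0 k0 .
  from assms(9,11)
  obtain M1 M2 where M12: "\<forall>y\<in>(\<lambda>(t, x). u1 t x) ` ({0..T} \<times> UNIV). norm y \<le> M1" "\<forall>y\<in>(\<lambda>(t, x). u2 t x) ` ({0..T} \<times> UNIV). norm y \<le> M2"
    unfolding bounded_continuous_def bounded_iff by (elim exE conjE) (rule that)
  have M: "\<bar>u1 t x\<bar> \<le> max M1 M2" "\<bar>u2 t x\<bar> \<le> max M1 M2" if "t \<in> {0..T}" for t x
    using bspec[OF M12(1) image_eqI[of _ _ "(t, x)"]] bspec[OF M12(2) image_eqI[of _ _ "(t, x)"]] that by auto
  have sub: "viscosity_subsolution T U b \<sigma> f G K u1" "viscosity_subsolution T U b \<sigma> f G K u2"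
    and super: "viscosity_supersolution T U b \<sigma> f G K u1" "viscosity_supersolution T U b \<sigma> f G K u2"
    and terminal: "u1 T x = \<Phi> x" "u2 T x = \<Phi> x" for x
    using assms(10,12) unfolding viscosity_solution_def by auto
  show ?thesis
  proof (intro ballI allI antisym)
    fix t x assume t: "t \<in> {0..T}"
    show "u1 t x \<le> u2 t x"
      by (rule comparison[OF sub(1) super(2) M _ t]) (simp_all add: terminal)
    show "u2 t x \<le> u1 t x"
      by (rule comparison[OF sub(2) super(1) M(2,1) _ t]) (simp_all add: terminal)
  qed
qed

end
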